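(* If there is an $n$-ary trace definition of a structure $\mathcal{M}$ in a structure $\mathcal{N}$ then $\mathrm{opd}(\mathcal{M})\le n\,\mathrm{opd}(\mathcal{N})$. If $\kappa$ is an infinite cardinal then the collection of theories of op-dimension $<\kappa$ is closed under trace definability (if $T$ has op-dimension $<\kappa$ and $T$ trace defines $T^*$, then $T^*$ has op-dimension $<\kappa$); hence theories of finite op-dimension are closed under trace definability.
   Context: Conventions: structures and theories are first order; theories are complete and consistent; "definable" means definable with parameters. An $n$-ary trace definition of $\mathcal{M}$ in $\mathcal{N}$ is a map $\tau\colon M\to N^n$ ($n\ge 1$) such that for every $m\ge 1$ and every $\mathcal{M}$-definable $X\subseteq M^m$ there is an $\mathcal{N}$-definable $Y\subseteq N^{mn}$ with $X=\{(a_1,\dots,a_m)\in M^m : (\tau(a_1),\dots,\tau(a_m))\in Y\}$. $T$ trace defines $T^*$ if every (equivalently, some) model of $T^*$ has a trace definition in a model of $T$. Op-dimension (Guingona–Hill): for a definable set $X$ in $\mathcal{M}$ and a cardinal $\kappa$, $\mathrm{opd}(X)\ge\kappa$ if in a sufficiently saturated elementary extension there is an IRD-array of depth $\kappa$ and length $\omega$ in $X$, i.e. formulas $\varphi_\alpha(x;y_\alpha)$ and tuples $b_{\alpha,i}$, for $\alpha<\kappa$, $i<\omega$, such that for every $g\colon\kappa\to\omega$ there is $a\in X$ with $\varphi_\alpha(a;b_{\alpha,i})\Leftrightarrow g(\alpha)<i$ for all $\alpha,i$. $\mathrm{opd}(\mathcal{M})=\mathrm{opd}(M)$ (with $x$ a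 single variable) and $\mathrm{opd}(T)=\mathrm{opd}(\mathcal{M})$ for $\mathcal{M}\models T$. Op-dimension is $<\kappa$ if it is not $\ge\kappa$. *)

theory Defs
  imports Main
begin

unbundle cardinal_syntax

section \<open>First-order structures\<close>

record ('f, 'r) lang =
  funs :: "'f set"
  rels :: "'r set"
  farity :: "'f \<Rightarrow> nat"
  rarity :: "'r \<Rightarrow> nat"

datatype 'f tm = Var nat | Fn 'f "'f tm list"

datatype ('f, 'r) fm =
    Eq "'f tm" "'f tm"
  | Rel 'r "'f tm list"
  | Neg "('f, 'r) fm"
  | Conj "('f, 'r) fm" "('f, 'r) fm"
  | Ex nat "('f, 'r) fm"

fun wf_tm :: "('f, 'r) lang \<Rightarrow> 'f tm \<Rightarrow> bool" where
  "wf_tm L (Var x) \<longleftrightarrow> True"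
| "wf_tm L (Fn f ts) \<longleftrightarrow>
     f \<in> funs L \<and> length ts = farity L f \<and> (\<forall>t\<in>set ts. wf_tm L t)"

fun wf_fm :: "('f, 'r) lang \<Rightarrow> ('f, 'r) fm \<Rightarrow> bool" where
  "wf_fm L (Eq s t) \<longleftrightarrow> wf_tm L s \<and> wf_tm L t"
| "wf_fm L (Rel r ts) \<longleftrightarrow>
     r \<in> rels L \<and> length ts = rarity L r \<and> (\<forall>t\<in>set ts. wf_tm L t)"
| "wf_fm L (Neg \<phi>) \<longleftrightarrow> wf_fm L \<phi>"
| "wf_fm L (Conj \<phi> \<psi>) \<longleftrightarrow> wf_fm L \<phi> \<and> wf_fm L \<psi>"
| "wf_fm L (Ex x \<phi>) \<longleftrightarrow> wf_fm L \<phi>"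

fun vars_tm :: "'f tm \<Rightarrow> nat set" where
  "vars_tm (Var x) = {x}"
| "vars_tm (Fn f ts) = (\<Union>t\<in>set ts. vars_tm t)"

fun fv :: "('f, 'r) fm \<Rightarrow> nat set" where
  "fv (Eq s t) = vars_tm s \<union> vars_tm t"
| "fv (Rel r ts) = (\<Union>t\<in>set ts. vars_tm t)"
| "fv (Neg \<phi>) = fv \<phi>"
| "fv (Conj \<phi> \<psi>) = fv \<phi> \<union> fv \<psi>"
| "fv (Ex x \<phi>) = fv \<phi> - {x}"

record ('a, 'f, 'r) fo_struct =
  carrier :: "'a set"
  fint :: "'f \<Rightarrow> 'a list \<Rightarrow> 'a"
  rint :: "'r \<Rightarrow> 'a list \<Rightarrow> bool"

definition tuples :: "'a set \<Rightarrow> nat \<Rightarrow> 'a list set" where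
  "tuples A m = {as. length as = m \<and> set as \<subseteq> A}"

definition is_struct :: "('f, 'r) lang \<Rightarrow> ('a, 'f, 'r) fo_struct \<Rightarrow> bool" where
  "is_struct L M \<longleftrightarrow> carrier M \<noteq> {} \<and>
     (\<forall>f\<in>funs L. \<forall>as\<in>tuples (carrier M) (farity L f). fint M f as \<in> carrier M)"

fun eval :: "('a, 'f, 'r) fo_struct \<Rightarrow> (nat \<Rightarrow> 'a) \<Rightarrow> 'f tm \<Rightarrow> 'a" where
  "eval M e (Var x) = e x"
| "eval M e (Fn f ts) = fint M f (map (eval M e) ts)"

fun sat :: "('a, 'f, 'r) fo_struct \<Rightarrow> (nat \<Rightarrow> 'a) \<Rightarrow> ('f, 'r) fm \<Rightarrow> bool" where
  "sat M e (Eq s t) \<longleftrightarrow> eval M e s = eval M e t"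
| "sat M e (Rel r ts) \<longleftrightarrow> rint M r (map (eval M e) ts)"
| "sat M e (Neg \<phi>) \<longleftrightarrow> \<not> sat M e \<phi>"
| "sat M e (Conj \<phi> \<psi>) \<longleftrightarrow> sat M e \<phi> \<and> sat M e \<psi>"
| "sat M e (Ex x \<phi>) \<longleftrightarrow> (\<exists>a\<in>carrier M. sat M (e(x := a)) \<phi>)"

text \<open>A formula with \<^prop>\<open>fv \<phi> \<subseteq> {..<m}\<close> is a formula in the tuple of variables
  \<open>0, ..., m - 1\<close>; it is evaluated at tuples of length \<open>m\<close>.\<close>

definition fm_in :: "('f, 'r) lang \<Rightarrow> nat \<Rightarrow> ('f, 'r) fm \<Rightarrow> bool" where
  "fm_in L m \<phi> \<longleftrightarrow> wf_fm L \<phi> \<and> fv \<phi> \<subseteq> {..<m}"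

definition holds :: "('a, 'f, 'r) fo_struct \<Rightarrow> ('f, 'r) fm \<Rightarrow> 'a list \<Rightarrow> bool" where
  "holds M \<phi> as \<longleftrightarrow> sat M (\<lambda>i. as ! i) \<phi>"

text \<open>Definability is with parameters \<open>bs\<close>.\<close>

definition definable ::
  "('f, 'r) lang \<Rightarrow> ('a, 'f, 'r) fo_struct \<Rightarrow> nat \<Rightarrow> 'a list set \<Rightarrow> bool" where
  "definable L M m X \<longleftrightarrow> (\<exists>\<phi> bs. set bs \<subseteq> carrier M \<and> fm_in L (m + length bs) \<phi> \<and>
     X = {as \<in> tuples (carrier M) m. holds M \<phi> (as @ bs)})"


section \<open>Theories\<close>

definition sentences :: "('f, 'r) lang \<Rightarrow> ('f, 'r) fm set" where
  "sentences L = {\<phi>. fm_in L 0 \<phi>}"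

definition is_model ::
  "('f, 'r) lang \<Rightarrow> ('f, 'r) fm set \<Rightarrow> ('a, 'f, 'r) fo_struct \<Rightarrow> bool" where
  "is_model L T M \<longleftrightarrow> is_struct L M \<and> (\<forall>\<phi>\<in>T. holds M \<phi> [])"

text \<open>A formula of HOL cannot quantify over the type carrying a model. The type of formulas is
  infinite and at least as large as the set of symbols, so by downward Loewenheim-Skolem every
  model of \<open>T\<close>, over any type, is elementarily equivalent to one whose carrier is a subset of
  this type; the two notions below therefore agree with consistency and consequence with respect
  to arbitrary models.\<close>

definition consistent :: "('f, 'r) lang \<Rightarrow> ('f, 'r) fm set \<Rightarrow> bool" where
  "consistent L T \<longleftrightarrow> (\<exists>M :: (('f, 'r) fm, 'f, 'r) fo_struct. is_model L T M)"

definition entails :: "('f, 'r) lang \<Rightarrow> ('f, 'r) fm set \<Rightarrow> ('f, 'r) fm \<Rightarrow> bool" where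
  "entails L T \<phi> \<longleftrightarrow>
     (\<forall>M :: (('f, 'r) fm, 'f, 'r) fo_struct. is_model L T M \<longrightarrow> holds M \<phi> [])"

definition complete_theory :: "('f, 'r) lang \<Rightarrow> ('f, 'r) fm set \<Rightarrow> bool" where
  "complete_theory L T \<longleftrightarrow> T \<subseteq> sentences L \<and> consistent L T \<and>
     (\<forall>\<phi>\<in>sentences L. entails L T \<phi> \<or> entails L T (Neg \<phi>))"


section \<open>Trace definitions\<close>

text \<open>\<open>N\<close>-definable subsets of \<open>N\<^sup>m\<^sup>n\<close> are sets of lists of length \<open>m * n\<close>; the tuple
  \<open>(\<tau> a\<^sub>1, ..., \<tau> a\<^sub>m)\<close> is the concatenation of the \<open>n\<close>-tuples \<open>\<tau> a\<^sub>i\<close>.\<close>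

definition trace_definition ::
  "('g, 's) lang \<Rightarrow> ('a, 'g, 's) fo_struct \<Rightarrow> ('f, 'r) lang \<Rightarrow> ('b, 'f, 'r) fo_struct
    \<Rightarrow> nat \<Rightarrow> ('a \<Rightarrow> 'b list) \<Rightarrow> bool" where
  "trace_definition L' M L N n \<tau> \<longleftrightarrow> n \<ge> 1 \<and> (\<forall>a\<in>carrier M. \<tau> a \<in> tuples (carrier N) n) \<and>
     (\<forall>m\<ge>1. \<forall>X. definable L' M m X \<longrightarrow>
        (\<exists>Y. definable L N (m * n) Y \<and>
             X = {as \<in> tuples (carrier M) m. concat (map \<tau> as) \<in> Y}))"

text \<open>\<open>T\<close> trace defines \<open>T'\<close> if some model of \<open>T'\<close> has a trace definition in a model of \<open>T\<close>.
  The two type arguments are the types carrying these models.\<close>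

definition trace_defines ::
  "'b itself \<Rightarrow> 'a itself \<Rightarrow> ('f, 'r) lang \<Rightarrow> ('f, 'r) fm set
    \<Rightarrow> ('g, 's) lang \<Rightarrow> ('g, 's) fm set \<Rightarrow> bool" where
  "trace_defines _ _ L T L' T' \<longleftrightarrow>
     (\<exists>(M :: ('a, 'g, 's) fo_struct) (N :: ('b, 'f, 'r) fo_struct) n \<tau>.
        is_model L' T' M \<and> is_model L T N \<and> trace_definition L' M L N n \<tau>)"


section \<open>Op-dimension\<close>

text \<open>Up to isomorphism, an elementary extension is an elementary embedding.\<close>

definition elementary_embedding ::
  "('f, 'r) lang \<Rightarrow> ('a, 'f, 'r) fo_struct \<Rightarrow> ('b, 'f, 'r) fo_struct \<Rightarrow> ('a \<Rightarrow> 'b) \<Rightarrow> bool" where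
  "elementary_embedding L M N h \<longleftrightarrow> h ` carrier M \<subseteq> carrier N \<and>
     (\<forall>m \<phi> as. fm_in L m \<phi> \<and> as \<in> tuples (carrier M) m \<longrightarrow>
        (holds M \<phi> as \<longleftrightarrow> holds N \<phi> (map h as)))"

text \<open>The usual \<open>\<theta>\<close>-saturation: types over fewer than \<open>\<theta>\<close> parameters are realized. A formula
  \<open>\<phi>(x, bs)\<close> with parameters \<open>bs\<close> is the pair \<open>(\<phi>, bs)\<close>, with \<open>x\<close> the variable \<open>0\<close>.\<close>

definition saturated ::
  "('f, 'r) lang \<Rightarrow> ('a, 'f, 'r) fo_struct \<Rightarrow> 'c rel \<Rightarrow> bool" where
  "saturated L M \<theta> \<longleftrightarrow> (\<forall>A p. A \<subseteq> carrier M \<and> |A| <o \<theta> \<and>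
     (\<forall>(\<phi>, bs)\<in>p. set bs \<subseteq> A \<and> fm_in L (1 + length bs) \<phi>) \<and>
     (\<forall>q. finite q \<and> q \<subseteq> p \<longrightarrow> (\<exists>a\<in>carrier M. \<forall>(\<phi>, bs)\<in>q. holds M \<phi> (a # bs))) \<longrightarrow>
     (\<exists>a\<in>carrier M. \<forall>(\<phi>, bs)\<in>p. holds M \<phi> (a # bs)))"

text \<open>An IRD-array of depth \<open>\<kappa>\<close> and length \<open>\<omega>\<close>, with \<open>x\<close> the single variable \<open>0\<close> and
  \<open>y\<^sub>\<alpha>\<close> the variables \<open>1, ..., m \<alpha>\<close> of \<open>\<phi> \<alpha>\<close>.\<close>

definition ird_array :: "('f, 'r) lang \<Rightarrow> ('a, 'f, 'r) fo_struct \<Rightarrow> 'k rel \<Rightarrow> bool" where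
  "ird_array L M \<kappa> \<longleftrightarrow> (\<exists>(m :: 'k \<Rightarrow> nat) \<phi> (b :: 'k \<Rightarrow> nat \<Rightarrow> 'a list).
     (\<forall>\<alpha>\<in>Field \<kappa>. fm_in L (1 + m \<alpha>) (\<phi> \<alpha>) \<and> (\<forall>i. b \<alpha> i \<in> tuples (carrier M) (m \<alpha>))) \<and>
     (\<forall>g :: 'k \<Rightarrow> nat. \<exists>a\<in>carrier M. \<forall>\<alpha>\<in>Field \<kappa>. \<forall>i.
        holds M (\<phi> \<alpha>) (a # b \<alpha> i) \<longleftrightarrow> g \<alpha> < i))"

text \<open>\<open>opd(M) \<ge> \<kappa>\<close>. An array of depth \<open>\<kappa>\<close> and length \<open>\<omega>\<close> involves \<open>\<kappa> + \<aleph>\<^sub>0\<close> parameters, so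
  sufficiently saturated means \<open>(\<kappa> + \<aleph>\<^sub>0)\<^sup>+\<close>-saturated; whether there is an array does not depend on
  the choice of such an extension. With \<open>\<nu> = |M| + |L| + \<kappa> + \<aleph>\<^sub>0\<close> there is a \<open>\<nu>\<^sup>+\<close>-saturated
  elementary extension of cardinality at most \<open>2\<^sup>\<nu>\<close>, so the type of \<open>M'\<close> is large enough.\<close>

definition opd_ge :: "('f, 'r) lang \<Rightarrow> ('a, 'f, 'r) fo_struct \<Rightarrow> 'k rel \<Rightarrow> bool" where
  "opd_ge L M \<kappa> \<longleftrightarrow>
     (\<exists>(M' :: (('a + 'f + 'r + 'k + nat) set, 'f, 'r) fo_struct) h.
        is_struct L M' \<and> elementary_embedding L M M' h \<and>
        saturated L M' (cardSuc (\<kappa> +c natLeq)) \<and> ird_array L M' \<kappa>)"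

text \<open>\<open>opd(T) \<ge> \<kappa>\<close>; for complete \<open>T\<close> this does not depend on the model, and as above there is a
  model over the type of formulas.\<close>

definition theory_opd_ge :: "('f, 'r) lang \<Rightarrow> ('f, 'r) fm set \<Rightarrow> 'k rel \<Rightarrow> bool" where
  "theory_opd_ge L T \<kappa> \<longleftrightarrow>
     (\<exists>M :: (('f, 'r) fm, 'f, 'r) fo_struct. is_model L T M \<and> opd_ge L M \<kappa>)"

abbreviation theory_opd_less :: "('f, 'r) lang \<Rightarrow> ('f, 'r) fm set \<Rightarrow> 'k rel \<Rightarrow> bool" where
  "theory_opd_less L T \<kappa> \<equiv> \<not> theory_opd_ge L T \<kappa>"

text \<open>Bounded by a natural number, which is formally stronger than \<open>opd(T) < \<aleph>\<^sub>0\<close>.\<close>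

definition theory_opd_finite :: "('f, 'r) lang \<Rightarrow> ('f, 'r) fm set \<Rightarrow> bool" where
  "theory_opd_finite L T \<longleftrightarrow> (\<exists>d :: nat. theory_opd_less L T |{..<d}| )"

end

theory Submission
  imports Defs "HOL-Library.Ramsey"
begin

text \<open>An IRD-array in \<open>M\<close> yields finite patterns in \<open>M\<close> by elementarity. A trace definition turns
  them into finite patterns of \<open>n\<close>-tuples of \<open>N\<close> of the same depth, and by compactness and saturation
  finite patterns in \<open>N\<close> give an IRD-array in a saturated extension. The remaining point is
  subadditivity: a pattern of \<open>n\<close>-tuples splits into \<open>n\<close> patterns of single elements. By Ramsey's
  theorem the parameter sequences may be taken mutually indiscernible, also over the tuple on either
  side of its cuts. The index \<open>\<alpha>\<close> is then assigned to the least \<open>j\<close> such that the first \<open>j + 1\<close>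
  coordinates detect the position of the cut in the \<open>\<alpha>\<close>-th sequence. As the first \<open>j\<close> coordinates do
  not detect the cuts assigned to \<open>j\<close>, these cuts can be moved independently while keeping the first
  \<open>j\<close> coordinates as parameters, which is a pattern of the next coordinate alone.\<close>

section \<open>Definable predicates\<close>

text \<open>The definitions prescribe types: the saturated extension in \<open>opd_ge\<close> lives
  on sets over a sum type, the models in \<open>theory_opd_ge\<close> on the type of formulas.
  Finite patterns get rid of the extension, since for fixed formulas their existence is expressed by
  sentences and therefore passes between elementarily equivalent structures on any types. On the way
  back a saturated extension of bounded size is needed; its elements are names for realizations of
  types, because names can be counted and coded. The splitting argument needs indiscernible
  sequences, but no extension containing them is built. An ultrafilter on the configurations in
  \<open>N\<close> replaces it, and truth means membership in the ultrafilter. Integer indices put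
  every cut between -1 and 0, so that moving a cut by one step is a reindexing and detecting it
  means that some definable property changes under this step. The obstacle is that a pattern needs
  parameters independent of the cuts, whereas the tuples realizing different cuts differ in all
  coordinates. Quantifying over the next coordinate leaves a property of the earlier ones, which do
  not notice the moves; so one configuration serves for all cuts.\<close>

lemma eval_cong: "(\<And>x. x \<in> vars_tm t \<Longrightarrow> e x = e' x) \<Longrightarrow> eval M e t = eval M e' t"
proof (induction t)
  case (Fn f ts)
  then have "map (eval M e) ts = map (eval M e') ts" by (auto intro!: map_cong)
  then show ?case by (simp del: map_eq_conv)
qed simp

lemma sat_cong: "(\<And>x. x \<in> fv \<phi> \<Longrightarrow> e x = e' x) \<Longrightarrow> sat M e \<phi> \<longleftrightarrow> sat M e' \<phi>"
proof (induction \<phi> arbitrary: e e')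
  case (Eq s t)
  then show ?case using eval_cong[of s e e' M] eval_cong[of t e e' M] by simp
next
  case (Rel r ts)
  then have "map (eval M e) ts = map (eval M e') ts" by (auto intro!: map_cong eval_cong)
  then show ?case by (simp del: map_eq_conv)
next
  case (Neg \<phi>)
  show ?case using Neg.IH[of e e'] Neg.prems by simp
next
  case (Conj \<phi> \<psi>)
  show ?case using Conj.IH(1)[of e e'] Conj.IH(2)[of e e'] Conj.prems by simp
next
  case (Ex x \<phi>)
  have "sat M (e(x := a)) \<phi> \<longleftrightarrow> sat M (e'(x := a)) \<phi>" for a
    by (rule Ex.IH) (use Ex.prems in auto)
  then show ?case by simp
qed

lemma finite_vars_tm [simp]: "finite (vars_tm t)"
  by (induction t) auto

lemma finite_fv [simp]: "finite (fv \<phi>)"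
  by (induction \<phi>) auto

lemma fv_bound: obtains k where "fv \<phi> \<subseteq> {..<k}"
  by (meson finite_fv finite_nat_iff_bounded)

section \<open>Capture-avoiding renaming of variables\<close>

primrec ren_tm :: "(nat \<Rightarrow> nat) \<Rightarrow> 'f tm \<Rightarrow> 'f tm" where
  "ren_tm \<rho> (Var x) = Var (\<rho> x)"
| "ren_tm \<rho> (Fn f ts) = Fn f (map (ren_tm \<rho>) ts)"

text \<open>The renaming is the last argument so that it can change in the recursion. A bound
  variable becomes one outside the image of the free variables of the body, so that nothing is
  captured even if \<rho> is not injective.\<close>

primrec ren :: "('f, 'r) fm \<Rightarrow> (nat \<Rightarrow> nat) \<Rightarrow> ('f, 'r) fm" where
  "ren (Eq s t) = (\<lambda>\<rho>. Eq (ren_tm \<rho> s) (ren_tm \<rho> t))"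
| "ren (Rel r ts) = (\<lambda>\<rho>. Rel r (map (ren_tm \<rho>) ts))"
| "ren (Neg \<phi>) = (\<lambda>\<rho>. Neg (ren \<phi> \<rho>))"
| "ren (Conj \<phi> \<psi>) = (\<lambda>\<rho>. Conj (ren \<phi> \<rho>) (ren \<psi> \<rho>))"
| "ren (Ex x \<phi>) = (\<lambda>\<rho>. let y = (SOME y. y \<notin> \<rho> ` fv \<phi>) in Ex y (ren \<phi> (\<rho>(x := y))))"

lemma fresh_nat: "(SOME y. y \<notin> \<rho> ` fv \<phi>) \<notin> (\<rho> ` fv \<phi> :: nat set)"
  by (rule someI_ex) (meson ex_new_if_finite finite_fv finite_imageI infinite_UNIV_nat)

lemma eval_ren_tm: "eval M e (ren_tm \<rho> t) = eval M (e \<circ> \<rho>) t"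
proof (induction t)
  case (Fn f ts)
  then have "map (eval M e \<circ> ren_tm \<rho>) ts = map (eval M (e \<circ> \<rho>)) ts"
    by (intro map_cong) (auto simp: comp_def)
  then show ?case by (simp add: comp_def del: map_eq_conv)
qed simp

lemma wf_ren_tm: "wf_tm L (ren_tm \<rho> t) \<longleftrightarrow> wf_tm L t"
  by (induction t) auto

lemma vars_ren_tm: "vars_tm (ren_tm \<rho> t) = \<rho> ` vars_tm t"
  by (induction t) auto

lemma sat_ren: "sat M e (ren \<phi> \<rho>) \<longleftrightarrow> sat M (e \<circ> \<rho>) \<phi>"
proof (induction \<phi> arbitrary: e \<rho>)
  case (Rel r ts)
  have "map (eval M e \<circ> ren_tm \<rho>) ts = map (eval M (e \<circ> \<rho>)) ts"
    by (intro map_cong) (auto simp: eval_ren_tm)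
  then show ?case by (simp add: comp_def del: map_eq_conv)
next
  case (Ex x \<phi>)
  define y where "y = (SOME y. y \<notin> \<rho> ` fv \<phi>)"
  have y: "y \<notin> \<rho> ` fv \<phi>" unfolding y_def by (rule fresh_nat)
  have "sat M (e(y := a) \<circ> \<rho>(x := y)) \<phi> \<longleftrightarrow> sat M ((e \<circ> \<rho>)(x := a)) \<phi>" for a
    by (rule sat_cong) (use y in auto)
  then have "(\<exists>a\<in>carrier M. sat M (e(y := a) \<circ> \<rho>(x := y)) \<phi>) \<longleftrightarrow> (\<exists>a\<in>carrier M. sat M ((e \<circ> \<rho>)(x := a)) \<phi>)"
    by blast
  then show ?case unfolding ren.simps Let_def sat.simps Ex.IH y_def[symmetric] .
qed (auto simp: eval_ren_tm)

lemma wf_ren: "wf_fm L (ren \<phi> \<rho>) \<longleftrightarrow> wf_fm L \<phi>"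
  by (induction \<phi> arbitrary: \<rho>) (auto simp: wf_ren_tm Let_def)

lemma fv_ren: "fv (ren \<phi> \<rho>) \<subseteq> \<rho> ` fv \<phi>"
proof (induction \<phi> arbitrary: \<rho>)
  case (Ex x \<phi>)
  define y where "y = (SOME y. y \<notin> \<rho> ` fv \<phi>)"
  have "fv (ren \<phi> (\<rho>(x := y))) \<subseteq> (\<rho>(x := y)) ` fv \<phi>" by (rule Ex.IH)
  then show ?case by (auto simp: Let_def simp flip: y_def split: if_splits)
qed (fastforce simp: vars_ren_tm)+

text \<open>Variables are indexed by an arbitrary type. The predicates \<open>P\<close> and \<open>Q\<close> are defined by one
  and the same formula in the two structures, so that closure under the connectives is proved
  only once for definability (\<open>M = N\<close>) and for transfer between \<open>M\<close> and \<open>N\<close>.\<close>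

definition dfn :: "('f, 'r) lang \<Rightarrow> ('a, 'f, 'r) fo_struct \<Rightarrow> ('b, 'f, 'r) fo_struct \<Rightarrow> 'v set
    \<Rightarrow> (('v \<Rightarrow> 'a) \<Rightarrow> bool) \<Rightarrow> (('v \<Rightarrow> 'b) \<Rightarrow> bool) \<Rightarrow> bool" where
  "dfn L M N V P Q \<longleftrightarrow> (\<exists>\<phi> s. wf_fm L \<phi> \<and> s ` fv \<phi> \<subseteq> V \<and>
     (\<forall>c. range c \<subseteq> carrier M \<longrightarrow> (P c \<longleftrightarrow> sat M (c \<circ> s) \<phi>)) \<and>
     (\<forall>c. range c \<subseteq> carrier N \<longrightarrow> (Q c \<longleftrightarrow> sat N (c \<circ> s) \<phi>)))"

lemma dfnI:
  assumes "wf_fm L \<phi>" "s ` fv \<phi> \<subseteq> V"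
    and "\<And>c. range c \<subseteq> carrier M \<Longrightarrow> P c \<longleftrightarrow> sat M (c \<circ> s) \<phi>"
    and "\<And>c. range c \<subseteq> carrier N \<Longrightarrow> Q c \<longleftrightarrow> sat N (c \<circ> s) \<phi>"
  shows "dfn L M N V P Q"
  using assms unfolding dfn_def by blast

lemma dfnE:
  assumes "dfn L M N V P Q"
  obtains \<phi> s where "wf_fm L \<phi>" "s ` fv \<phi> \<subseteq> V"
    and "\<And>c. range c \<subseteq> carrier M \<Longrightarrow> P c \<longleftrightarrow> sat M (c \<circ> s) \<phi>"
    and "\<And>c. range c \<subseteq> carrier N \<Longrightarrow> Q c \<longleftrightarrow> sat N (c \<circ> s) \<phi>"
  using assms unfolding dfn_def by blast

lemma dfn_mono: "dfn L M N V P Q \<Longrightarrow> V \<subseteq> W \<Longrightarrow> dfn L M N W P Q"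
  unfolding dfn_def by (meson subset_trans)

lemma dfn_cong:
  assumes "dfn L M N V P Q"
    and "\<And>c. range c \<subseteq> carrier M \<Longrightarrow> P' c \<longleftrightarrow> P c"
    and "\<And>c. range c \<subseteq> carrier N \<Longrightarrow> Q' c \<longleftrightarrow> Q c"
  shows "dfn L M N V P' Q'"
  using assms by (elim dfnE, intro dfnI) auto

lemma dfn_agree:
  assumes "dfn L M N V P Q" "range c \<subseteq> carrier M" "range c' \<subseteq> carrier M"
    and "\<And>v. v \<in> V \<Longrightarrow> c v = c' v"
  shows "P c \<longleftrightarrow> P c'"
proof -
  obtain \<phi> s where s: "s ` fv \<phi> \<subseteq> V"
    and P: "\<And>c. range c \<subseteq> carrier M \<Longrightarrow> P c \<longleftrightarrow> sat M (c \<circ> s) \<phi>"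
    using dfnE[OF assms(1)] by metis
  have "sat M (c \<circ> s) \<phi> \<longleftrightarrow> sat M (c' \<circ> s) \<phi>"
    by (rule sat_cong) (use s assms(4) in auto)
  then show ?thesis using P assms by simp
qed

lemma dfn_finite_support:
  assumes "dfn L M N V P Q"
  obtains W where "finite W" "W \<subseteq> V" "dfn L M N W P Q"
proof -
  obtain \<phi> s where "wf_fm L \<phi>" "s ` fv \<phi> \<subseteq> V"
     "\<And>c. range c \<subseteq> carrier M \<Longrightarrow> P c \<longleftrightarrow> sat M (c \<circ> s) \<phi>"
     "\<And>c. range c \<subseteq> carrier N \<Longrightarrow> Q c \<longleftrightarrow> sat N (c \<circ> s) \<phi>" using dfnE[OF assms] by metis
  then show ?thesis by (intro that[of "s ` fv \<phi>"] dfnI[of L \<phi> s]) auto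
qed

lemma dfn_not:
  assumes "dfn L M N V P Q"
  shows "dfn L M N V (\<lambda>c. \<not> P c) (\<lambda>c. \<not> Q c)"
proof -
  obtain \<phi> s where *: "wf_fm L \<phi>" "s ` fv \<phi> \<subseteq> V"
     "\<And>c. range c \<subseteq> carrier M \<Longrightarrow> P c \<longleftrightarrow> sat M (c \<circ> s) \<phi>"
     "\<And>c. range c \<subseteq> carrier N \<Longrightarrow> Q c \<longleftrightarrow> sat N (c \<circ> s) \<phi>" using dfnE[OF assms] by metis
  show ?thesis by (rule dfnI[where \<phi> = "Neg \<phi>" and s = s]) (simp_all add: *)
qed

lemma dfn_conj:
  fixes P P' :: "('v \<Rightarrow> 'a) \<Rightarrow> bool"
  assumes "dfn L M N V P Q" "dfn L M N V P' Q'"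
  shows "dfn L M N V (\<lambda>c. P c \<and> P' c) (\<lambda>c. Q c \<and> Q' c)"
proof -
  obtain \<phi> s where 1: "wf_fm L \<phi>" "s ` fv \<phi> \<subseteq> V"
     "\<And>c. range c \<subseteq> carrier M \<Longrightarrow> P c \<longleftrightarrow> sat M (c \<circ> s) \<phi>"
     "\<And>c. range c \<subseteq> carrier N \<Longrightarrow> Q c \<longleftrightarrow> sat N (c \<circ> s) \<phi>" using dfnE[OF assms(1)] by metis
  obtain \<phi>' s' where 2: "wf_fm L \<phi>'" "s' ` fv \<phi>' \<subseteq> V"
     "\<And>c. range c \<subseteq> carrier M \<Longrightarrow> P' c \<longleftrightarrow> sat M (c \<circ> s') \<phi>'"
     "\<And>c. range c \<subseteq> carrier N \<Longrightarrow> Q' c \<longleftrightarrow> sat N (c \<circ> s') \<phi>'" using dfnE[OF assms(2)] by metis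
  \<comment> \<open>The two formulas name their variables by unrelated maps; even numbers are
    reserved for the first formula and odd ones for the second.\<close>
  define t where "t i = (if even i then s (i div 2) else s' (i div 2))" for i
  have t: "c \<circ> t \<circ> (\<lambda>i. 2 * i) = c \<circ> s" "c \<circ> t \<circ> (\<lambda>i. Suc (2 * i)) = c \<circ> s'" for c :: "'v \<Rightarrow> 'x"
    by (auto simp: t_def)
  show ?thesis
  proof (rule dfnI[where s = t])
    show "wf_fm L (Conj (ren \<phi> (\<lambda>i. 2 * i)) (ren \<phi>' (\<lambda>i. Suc (2 * i))))"
      using 1 2 by (simp add: wf_ren)
    have "t ` (\<lambda>i. 2 * i) ` fv \<phi> = s ` fv \<phi>"
      "t ` (\<lambda>i. Suc (2 * i)) ` fv \<phi>' = s' ` fv \<phi>'"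
      unfolding image_image by (simp_all add: t_def)
    then have "t ` fv (ren \<phi> (\<lambda>i. 2 * i)) \<subseteq> V" "t ` fv (ren \<phi>' (\<lambda>i. Suc (2 * i))) \<subseteq> V"
      using image_mono[OF fv_ren, of t \<phi> "\<lambda>i. 2 * i"]
        image_mono[OF fv_ren, of t \<phi>' "\<lambda>i. Suc (2 * i)"] 1(2) 2(2)
      by (metis subset_trans)+
    then show "t ` fv (Conj (ren \<phi> (\<lambda>i. 2 * i)) (ren \<phi>' (\<lambda>i. Suc (2 * i)))) \<subseteq> V"
      by (simp only: fv.simps image_Un Un_least)
  qed (simp_all add: 1 2 sat_ren t)
qed

text \<open>The formula has to be closed because \<open>V\<close> may be empty. It is true because
  an assignment into the carrier exists only if the carrier is nonempty.\<close>

lemma dfn_True: "dfn L M N V (\<lambda>c. True) (\<lambda>c. True)"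
  by (rule dfnI[where \<phi> = "Ex 0 (Eq (Var 0) (Var 0))"]) auto

lemma dfn_ball:
  assumes "finite I" "\<And>i. i \<in> I \<Longrightarrow> dfn L M N V (P i) (Q i)"
  shows "dfn L M N V (\<lambda>c. \<forall>i\<in>I. P i c) (\<lambda>c. \<forall>i\<in>I. Q i c)"
  using assms by (induction I rule: finite_induct) (auto intro: dfn_True dfn_conj)

lemma dfn_iff_const:
  assumes "dfn L M N V P Q"
  shows "dfn L M N V (\<lambda>c. P c \<longleftrightarrow> b) (\<lambda>c. Q c \<longleftrightarrow> b)"
  using assms dfn_not[OF assms] by (cases b) auto

lemma dfn_compose:
  fixes P :: "('v \<Rightarrow> 'a) \<Rightarrow> bool" and \<sigma> :: "'v \<Rightarrow> 'w"
  assumes "dfn L M N V P Q"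
  shows "dfn L M N (\<sigma> ` V) (\<lambda>c. P (c \<circ> \<sigma>)) (\<lambda>c. Q (c \<circ> \<sigma>))"
  using assms
proof (rule dfnE)
  fix \<phi> s
  assume *: "wf_fm L \<phi>" "s ` fv \<phi> \<subseteq> V"
     "\<And>c. range c \<subseteq> carrier M \<Longrightarrow> P c \<longleftrightarrow> sat M (c \<circ> s) \<phi>"
     "\<And>c. range c \<subseteq> carrier N \<Longrightarrow> Q c \<longleftrightarrow> sat N (c \<circ> s) \<phi>"
  have r: "range c \<subseteq> A \<Longrightarrow> range (c \<circ> \<sigma>) \<subseteq> A" for c :: "'w \<Rightarrow> 'x" and A by auto
  show ?thesis
  proof (rule dfnI[where \<phi> = \<phi> and s = "\<sigma> \<circ> s"])
    show "(\<sigma> \<circ> s) ` fv \<phi> \<subseteq> \<sigma> ` V" using *(2) by auto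
  qed (simp_all only: *(1) *(3,4)[OF r] comp_assoc)
qed

lemma dfn_ex:
  fixes P :: "('v \<Rightarrow> 'a) \<Rightarrow> bool" and Q :: "('v \<Rightarrow> 'c) \<Rightarrow> bool"
  assumes "dfn L M N V P Q"
  shows "dfn L M N (V - {v}) (\<lambda>c. \<exists>a\<in>carrier M. P (c(v := a))) (\<lambda>c. \<exists>a\<in>carrier N. Q (c(v := a)))"
  using assms
proof (rule dfnE)
  fix \<phi> s
  assume *: "wf_fm L \<phi>" "s ` fv \<phi> \<subseteq> V"
     "\<And>c. range c \<subseteq> carrier M \<Longrightarrow> P c \<longleftrightarrow> sat M (c \<circ> s) \<phi>"
     "\<And>c. range c \<subseteq> carrier N \<Longrightarrow> Q c \<longleftrightarrow> sat N (c \<circ> s) \<phi>"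
  \<comment> \<open>Several indices may stand for \<open>v\<close>; all of them are merged into the
    variable 0, which is then bound.\<close>
  define \<rho> where "\<rho> i = (if s i = v then 0 else Suc i)" for i
  define t where "t i = (case i of 0 \<Rightarrow> v | Suc i \<Rightarrow> s i)" for i
  have eq: "(c \<circ> t)(0 := a) \<circ> \<rho> = c(v := a) \<circ> s" for c :: "'v \<Rightarrow> 'x" and a
    by (auto simp: \<rho>_def t_def)
  have r: "range c \<subseteq> A \<Longrightarrow> a \<in> A \<Longrightarrow> range (c(v := a)) \<subseteq> A" for c :: "'v \<Rightarrow> 'x" and A a by auto
  show ?thesis
  proof (rule dfnI[where s = t])
    show "wf_fm L (Ex 0 (ren \<phi> \<rho>))" using * by (simp add: wf_ren)
    show "t ` fv (Ex 0 (ren \<phi> \<rho>)) \<subseteq> V - {v}"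
      using *(2) fv_ren[of \<phi> \<rho>] by (fastforce simp: \<rho>_def t_def split: if_splits)
  next
    fix c :: "'v \<Rightarrow> 'a"
    assume "range c \<subseteq> carrier M"
    then show "(\<exists>a\<in>carrier M. P (c(v := a))) \<longleftrightarrow> sat M (c \<circ> t) (Ex 0 (ren \<phi> \<rho>))"
      unfolding sat.simps sat_ren eq using *(3)[OF r] by blast
  next
    fix c :: "'v \<Rightarrow> 'c"
    assume "range c \<subseteq> carrier N"
    then show "(\<exists>a\<in>carrier N. Q (c(v := a))) \<longleftrightarrow> sat N (c \<circ> t) (Ex 0 (ren \<phi> \<rho>))"
      unfolding sat.simps sat_ren eq using *(4)[OF r] by blast
  qed
qed

lemma dfn_exs:
  fixes P :: "('v \<Rightarrow> 'a) \<Rightarrow> bool"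
  assumes "finite W" "dfn L M N V P Q"
  shows "dfn L M N (V - W) (\<lambda>c. \<exists>c'. range c' \<subseteq> carrier M \<and> (\<forall>v. v \<notin> W \<longrightarrow> c' v = c v) \<and> P c')
     (\<lambda>c. \<exists>c'. range c' \<subseteq> carrier N \<and> (\<forall>v. v \<notin> W \<longrightarrow> c' v = c v) \<and> Q c')"
  using assms(1)
proof (induction W rule: finite_induct)
  case empty
  have "(\<exists>c'. range c' \<subseteq> A \<and> (\<forall>v. v \<notin> {} \<longrightarrow> c' v = c v) \<and> R c') \<longleftrightarrow> R c" if "range c \<subseteq> A"
    for c :: "'v \<Rightarrow> 'x" and A R
    using that by (metis empty_iff ext)
  note this[of _ "carrier M" P] this[of _ "carrier N" Q]
  then show ?case by (intro dfn_cong[OF dfn_mono[OF assms(2), of "V - {}"]]) auto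
next
  case (insert w W)
  have eq: "(\<exists>a\<in>A. \<exists>c'. range c' \<subseteq> A \<and> (\<forall>v. v \<notin> W \<longrightarrow> c' v = (c(w := a)) v) \<and> R c') \<longleftrightarrow>
     (\<exists>c'. range c' \<subseteq> A \<and> (\<forall>v. v \<notin> insert w W \<longrightarrow> c' v = c v) \<and> R c')" (is "?l \<longleftrightarrow> ?r")
    if "range c \<subseteq> A" for c :: "'v \<Rightarrow> 'x" and A R
  proof
    assume ?r
    then obtain c' where "range c' \<subseteq> A" "\<forall>v. v \<notin> insert w W \<longrightarrow> c' v = c v" "R c'" by blast
    then show ?l by (intro bexI[of _ "c' w"] exI[of _ c']) auto
  next
    assume ?l
    then obtain a c' where "range c' \<subseteq> A" "\<forall>v. v \<notin> W \<longrightarrow> c' v = (c(w := a)) v" "R c'" by blast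
    then show ?r by (intro exI[of _ c']) auto
  qed
  have V: "V - insert w W = V - W - {w}" by auto
  show ?case unfolding V
    by (rule dfn_cong[OF dfn_ex[OF insert.IH, of w]]) (rule eq[symmetric], assumption)+
qed

section \<open>Elementary equivalence\<close>

definition el_equiv :: "('f, 'r) lang \<Rightarrow> ('a, 'f, 'r) fo_struct \<Rightarrow> ('b, 'f, 'r) fo_struct \<Rightarrow> bool" where
  "el_equiv L M N \<longleftrightarrow> (\<forall>\<phi>\<in>sentences L. holds M \<phi> [] \<longleftrightarrow> holds N \<phi> [])"

lemma el_equiv_sym: "el_equiv L M N \<Longrightarrow> el_equiv L N M"
  by (auto simp: el_equiv_def)

lemma elementary_embedding_imp_el_equiv:
  assumes "elementary_embedding L M N h"
  shows "el_equiv L M N"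
proof -
  have "[] \<in> tuples (carrier M) 0" by (simp add: tuples_def)
  then have "holds M \<phi> [] \<longleftrightarrow> holds N \<phi> (map h [])" if "fm_in L 0 \<phi>" for \<phi>
    using assms that unfolding elementary_embedding_def by blast
  then show ?thesis by (simp add: el_equiv_def sentences_def)
qed

text \<open>Only finitely many variables occur; binding them all by \<open>dfn_exs\<close> leaves a
  formula without free variables, that is, a sentence.\<close>

lemma el_equiv_dfn_ex:
  fixes P :: "('v \<Rightarrow> 'a) \<Rightarrow> bool" and Q :: "('v \<Rightarrow> 'b) \<Rightarrow> bool"
  assumes "el_equiv L M N" "carrier M \<noteq> {}" "carrier N \<noteq> {}"
    and "dfn L M N V P Q" "range c \<subseteq> carrier M" "P c"
  shows "\<exists>c. range c \<subseteq> carrier N \<and> Q c"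
proof -
  obtain W where W: "finite W" "dfn L M N W P Q"
    using dfn_finite_support[OF assms(4)] by metis
  obtain d :: "'v \<Rightarrow> 'b" where d: "range d \<subseteq> carrier N"
    using assms(3) by (meson ex_in_conv image_subset_iff rangeI)
  show ?thesis using dfn_exs[OF W]
  proof (rule dfnE)
    fix \<phi> s assume \<phi>: "wf_fm L \<phi>" "s ` fv \<phi> \<subseteq> (W - W :: 'v set)"
       "\<And>c. range c \<subseteq> carrier M \<Longrightarrow>
          (\<exists>c'. range c' \<subseteq> carrier M \<and> (\<forall>v. v \<notin> W \<longrightarrow> c' v = c v) \<and> P c') \<longleftrightarrow> sat M (c \<circ> s) \<phi>"
       "\<And>c. range c \<subseteq> carrier N \<Longrightarrow>
          (\<exists>c'. range c' \<subseteq> carrier N \<and> (\<forall>v. v \<notin> W \<longrightarrow> c' v = c v) \<and> Q c') \<longleftrightarrow> sat N (c \<circ> s) \<phi>"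
    have fv: "fv \<phi> = {}" using \<phi>(2) by auto
    then have "sat K e \<phi> \<longleftrightarrow> holds K \<phi> []" for K :: "('x, _, _) fo_struct" and e
      unfolding holds_def by (intro sat_cong) simp
    moreover have "\<phi> \<in> sentences L" using \<phi>(1) fv by (simp add: sentences_def fm_in_def)
    ultimately have "sat M (c \<circ> s) \<phi> \<longleftrightarrow> sat N (d \<circ> s) \<phi>"
      using assms(1) unfolding el_equiv_def by metis
    then show "\<exists>c. range c \<subseteq> carrier N \<and> Q c" using \<phi>(3)[OF assms(5)] \<phi>(4)[OF d] assms(5,6) by blast
  qed
qed

section \<open>Finite patterns\<close>

definition env :: "nat \<Rightarrow> (nat \<Rightarrow> 'a) \<Rightarrow> (nat \<Rightarrow> 'a) \<Rightarrow> nat \<Rightarrow> 'a" where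
  "env n x y v = (if v < n then x v else y (v - n))"

text \<open>Tuples are total sequences, which avoids any bookkeeping of lengths: \<open>env\<close>
  reads only the first \<open>n\<close> entries of \<open>x\<close>, and a formula reads only
  finitely many entries of \<open>y\<close>.\<close>

definition pattern :: "('a, 'f, 'r) fo_struct \<Rightarrow> nat \<Rightarrow> ('k \<Rightarrow> ('f, 'r) fm) \<Rightarrow> 'k set \<Rightarrow> nat
    \<Rightarrow> ('k \<Rightarrow> nat \<Rightarrow> nat \<Rightarrow> 'a) \<Rightarrow> bool" where
  "pattern N n \<phi> F k y \<longleftrightarrow> (\<forall>g :: 'k \<Rightarrow> nat. \<exists>x. range x \<subseteq> carrier N \<and>
     (\<forall>\<alpha>\<in>F. \<forall>i<k. sat N (env n x (y \<alpha> i)) (\<phi> \<alpha>) \<longleftrightarrow> g \<alpha> < i))"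

text \<open>By compactness this says that some elementary extension of \<open>N\<close> has an IRD-array indexed by
  \<open>A\<close> in the \<open>n\<close>-tuples, with \<open>\<phi> \<alpha>\<close> in the variables \<open>0, ..., n - 1\<close> for the tuple and the
  remaining variables for the parameters.\<close>

definition finpat :: "('f, 'r) lang \<Rightarrow> ('a, 'f, 'r) fo_struct \<Rightarrow> nat \<Rightarrow> 'k set \<Rightarrow> bool" where
  "finpat L N n A \<longleftrightarrow> (\<exists>\<phi>. (\<forall>\<alpha>\<in>A. wf_fm L (\<phi> \<alpha>)) \<and> (\<forall>F k. finite F \<and> F \<subseteq> A \<longrightarrow>
     (\<exists>y. (\<forall>\<alpha> i. range (y \<alpha> i) \<subseteq> carrier N) \<and> pattern N n \<phi> F k y)))"

lemma finpatI:
  assumes "\<And>\<alpha>. \<alpha> \<in> A \<Longrightarrow> wf_fm L (\<phi> \<alpha>)"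
    and "\<And>F k. finite F \<Longrightarrow> F \<subseteq> A \<Longrightarrow>
      \<exists>y. (\<forall>\<alpha> i. range (y \<alpha> i) \<subseteq> carrier N) \<and> pattern N n \<phi> F k y"
  shows "finpat L N n A"
  using assms unfolding finpat_def by blast

lemma finpatE:
  assumes "finpat L N n A"
  obtains \<phi> where "\<forall>\<alpha>\<in>A. wf_fm L (\<phi> \<alpha>)"
    and "\<forall>F k. finite F \<and> F \<subseteq> A \<longrightarrow>
      (\<exists>y. (\<forall>\<alpha> i. range (y \<alpha> i) \<subseteq> carrier N) \<and> pattern N n \<phi> F k y)"
  using assms unfolding finpat_def by (elim exE conjE)

lemma patternD:
  "pattern N n \<phi> F k y \<Longrightarrow> \<exists>x. range x \<subseteq> carrier N \<and>
     (\<forall>\<alpha>\<in>F. \<forall>i<k. sat N (env n x (y \<alpha> i)) (\<phi> \<alpha>) \<longleftrightarrow> g \<alpha> < i)"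
  unfolding pattern_def by (drule spec[of _ g])

lemma pattern_antimono:
  assumes "pattern N n \<phi> F k y" "F' \<subseteq> F" "k' \<le> k"
  shows "pattern N n \<phi> F' k' y"
  unfolding pattern_def
proof
  fix g
  obtain x where "range x \<subseteq> carrier N"
      "\<forall>\<alpha>\<in>F. \<forall>i<k. sat N (env n x (y \<alpha> i)) (\<phi> \<alpha>) \<longleftrightarrow> g \<alpha> < i"
    using patternD[OF assms(1), of g] by (elim exE conjE)
  then show "\<exists>x. range x \<subseteq> carrier N \<and>
      (\<forall>\<alpha>\<in>F'. \<forall>i<k'. sat N (env n x (y \<alpha> i)) (\<phi> \<alpha>) \<longleftrightarrow> g \<alpha> < i)"
    using assms(2,3) by (intro exI[of _ x]) auto
qed

lemma finpat_reindex:
  fixes A :: "'k set" and B :: "'j set"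
  assumes "finpat L N n A" "inj_on f B" "f ` B \<subseteq> A"
  shows "finpat L N n B"
proof -
  obtain \<phi> where wf: "\<forall>\<alpha>\<in>A. wf_fm L (\<phi> \<alpha>)"
    and pat: "\<forall>F k. finite F \<and> F \<subseteq> A \<longrightarrow>
      (\<exists>y. (\<forall>\<alpha> i. range (y \<alpha> i) \<subseteq> carrier N) \<and> pattern N n \<phi> F k y)"
    by (rule finpatE[OF assms(1)])
  show ?thesis
  proof (rule finpatI[where \<phi> = "\<phi> \<circ> f"])
    show "wf_fm L ((\<phi> \<circ> f) \<alpha>)" if "\<alpha> \<in> B" for \<alpha>
      using wf that assms(3) by auto
  next
    fix F :: "'j set" and k
    assume F: "finite F" "F \<subseteq> B"
    then have fF: "finite (f ` F)" "f ` F \<subseteq> A" using assms(3) by auto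
    obtain y where y: "\<forall>\<alpha> i. range (y \<alpha> i) \<subseteq> carrier N" "pattern N n \<phi> (f ` F) k y"
      using pat[THEN spec[of _ "f ` F"], THEN spec[of _ k], THEN mp, OF conjI[OF fF]] by (elim exE conjE)
    have "pattern N n (\<phi> \<circ> f) F k (y \<circ> f)"
      unfolding pattern_def
    proof
      fix g :: "'j \<Rightarrow> nat"
      obtain x where "range x \<subseteq> carrier N"
        "\<forall>\<beta>\<in>f ` F. \<forall>i<k. sat N (env n x (y \<beta> i)) (\<phi> \<beta>) \<longleftrightarrow> (g \<circ> inv_into B f) \<beta> < i"
        using patternD[OF y(2), of "g \<circ> inv_into B f"] by (elim exE conjE)
      moreover have "inv_into B f (f \<alpha>) = \<alpha>" if "\<alpha> \<in> F" for \<alpha>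
        using F(2) assms(2) that by (meson inv_into_f_f subsetD)
      ultimately show "\<exists>x. range x \<subseteq> carrier N \<and> (\<forall>\<alpha>\<in>F. \<forall>i<k.
          sat N (env n x ((y \<circ> f) \<alpha> i)) ((\<phi> \<circ> f) \<alpha>) \<longleftrightarrow> g \<alpha> < i)"
        by (intro exI[of _ x]) auto
    qed
    then show "\<exists>y. (\<forall>\<alpha> i. range (y \<alpha> i) \<subseteq> carrier N) \<and> pattern N n (\<phi> \<circ> f) F k y"
      using y(1) by (intro exI[of _ "y \<circ> f"]) auto
  qed
qed

text \<open>Positions up to \<open>k\<close> cannot tell a cut beyond \<open>k\<close> from one at
  \<open>k\<close>. Hence finitely many cut functions suffice, and being a pattern is a finite
  conjunction.\<close>

lemma truncate_cuts: "\<exists>g'\<in>F \<rightarrow>\<^sub>E {..k}. \<forall>\<alpha>\<in>F. \<forall>i\<le>k. g' \<alpha> < i \<longleftrightarrow> g \<alpha> < i" for k :: nat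
  by (rule bexI[of _ "restrict (\<lambda>\<alpha>. min k (g \<alpha>)) F"]) auto

text \<open>Being the parameters of a finite pattern is a first order property of them. The variable
  \<open>None\<close> stands for the realization, which gets quantified, and
  \<open>Some (\<alpha>, i, l)\<close> for the entries of the parameters.\<close>

lemma dfn_pattern:
  fixes M :: "('a, 'f, 'r) fo_struct" and N :: "('b, 'f, 'r) fo_struct" and F :: "'k set"
  assumes "finite F" "\<And>\<alpha>. \<alpha> \<in> F \<Longrightarrow> wf_fm L (\<phi> \<alpha>)"
  shows "dfn L M N UNIV (\<lambda>c. pattern M 1 \<phi> F k (\<lambda>\<alpha> i l. c (Some (\<alpha>, i, l))))
    (\<lambda>c. pattern N 1 \<phi> F k (\<lambda>\<alpha> i l. c (Some (\<alpha>, i, l))))"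
proof -
  define s where "s \<alpha> i v = (if v < 1 then None else Some (\<alpha>, i, v - 1))" for \<alpha> :: 'k and i v :: nat
  have eq: "pattern K 1 \<phi> F k (\<lambda>\<alpha> i l. c (Some (\<alpha>, i, l))) \<longleftrightarrow>
      (\<forall>g\<in>F \<rightarrow>\<^sub>E {..k}. \<exists>a\<in>carrier K. \<forall>\<alpha>\<in>F. \<forall>i\<in>{..<k}. sat K (c(None := a) \<circ> s \<alpha> i) (\<phi> \<alpha>) \<longleftrightarrow> g \<alpha> < i)"
      (is "?l \<longleftrightarrow> ?r")
    for K :: "('x, 'f, 'r) fo_struct" and c
  proof
    assume l: ?l
    show ?r
    proof
      fix g
      obtain x where x: "range x \<subseteq> carrier K"
         "\<forall>\<alpha>\<in>F. \<forall>i<k. sat K (env 1 x (\<lambda>l. c (Some (\<alpha>, i, l)))) (\<phi> \<alpha>) \<longleftrightarrow> g \<alpha> < i"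
        using patternD[OF l, of g] by (elim exE conjE)
      have "c(None := x 0) \<circ> s \<alpha> i = env 1 x (\<lambda>l. c (Some (\<alpha>, i, l)))" for \<alpha> i
        by (auto simp: s_def env_def)
      then show "\<exists>a\<in>carrier K. \<forall>\<alpha>\<in>F. \<forall>i\<in>{..<k}. sat K (c(None := a) \<circ> s \<alpha> i) (\<phi> \<alpha>) \<longleftrightarrow> g \<alpha> < i"
        using x by (intro bexI[of _ "x 0"]) auto
    qed
  next
    assume r: ?r
    show ?l unfolding pattern_def
    proof
      fix g :: "'k \<Rightarrow> nat"
      obtain g' where g': "g' \<in> F \<rightarrow>\<^sub>E {..k}" "\<And>\<alpha> i. \<alpha> \<in> F \<Longrightarrow> i \<le> k \<Longrightarrow> g' \<alpha> < i \<longleftrightarrow> g \<alpha> < i"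
        using truncate_cuts by metis
      obtain a where "a \<in> carrier K" and a: "\<And>\<alpha> i. \<alpha> \<in> F \<Longrightarrow> i < k \<Longrightarrow>
          sat K (c(None := a) \<circ> s \<alpha> i) (\<phi> \<alpha>) \<longleftrightarrow> g' \<alpha> < i"
        using r g'(1) by (metis lessThan_iff)
      have "c(None := a) \<circ> s \<alpha> i = env 1 (\<lambda>_. a) (\<lambda>l. c (Some (\<alpha>, i, l)))" for \<alpha> i
        by (auto simp: s_def env_def)
      with \<open>a \<in> carrier K\<close> a g'(2) show "\<exists>x. range x \<subseteq> carrier K \<and>
          (\<forall>\<alpha>\<in>F. \<forall>i<k. sat K (env 1 x (\<lambda>l. c (Some (\<alpha>, i, l)))) (\<phi> \<alpha>) \<longleftrightarrow> g \<alpha> < i)"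
        by (intro exI[of _ "\<lambda>_. a"]) auto
    qed
  qed
  have "dfn L M N UNIV (\<lambda>c. sat M (c \<circ> s \<alpha> i) (\<phi> \<alpha>)) (\<lambda>c. sat N (c \<circ> s \<alpha> i) (\<phi> \<alpha>))"
    if "\<alpha> \<in> F" for \<alpha> i
    by (rule dfnI[where \<phi> = "\<phi> \<alpha>" and s = "s \<alpha> i"]) (use that assms in auto)
  then have "dfn L M N UNIV
      (\<lambda>c. \<forall>\<alpha>\<in>F. \<forall>i\<in>{..<k}. sat M (c \<circ> s \<alpha> i) (\<phi> \<alpha>) \<longleftrightarrow> g \<alpha> < i)
      (\<lambda>c. \<forall>\<alpha>\<in>F. \<forall>i\<in>{..<k}. sat N (c \<circ> s \<alpha> i) (\<phi> \<alpha>) \<longleftrightarrow> g \<alpha> < i)" for g :: "'k \<Rightarrow> nat"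
    by (intro dfn_ball dfn_iff_const) (use assms(1) in auto)
  from dfn_mono[OF dfn_ex[OF this, of None] subset_UNIV] show ?thesis
    unfolding eq by (intro dfn_ball finite_PiE assms(1)) auto
qed

lemma finpat_el_equiv:
  fixes M :: "('a, 'f, 'r) fo_struct" and N :: "('b, 'f, 'r) fo_struct" and A :: "'k set"
  assumes "el_equiv L M N" "carrier M \<noteq> {}" "carrier N \<noteq> {}" "finpat L M 1 A"
  shows "finpat L N 1 A"
proof -
  obtain \<phi> where wf: "\<forall>\<alpha>\<in>A. wf_fm L (\<phi> \<alpha>)"
    and pat: "\<forall>F k. finite F \<and> F \<subseteq> A \<longrightarrow>
      (\<exists>y. (\<forall>\<alpha> i. range (y \<alpha> i) \<subseteq> carrier M) \<and> pattern M 1 \<phi> F k y)"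
    by (rule finpatE[OF assms(4)])
  show ?thesis
  proof (rule finpatI[where \<phi> = \<phi>])
    fix F k
    assume F: "finite F" "F \<subseteq> A"
    obtain y where y: "\<forall>\<alpha> i. range (y \<alpha> i) \<subseteq> carrier M" "pattern M 1 \<phi> F k y"
      using pat[THEN spec[of _ F], THEN spec[of _ k], THEN mp, OF conjI[OF F]] by (elim exE conjE)
    obtain a where a: "a \<in> carrier M" using assms(2) by blast
    define c where "c v = (case v of None \<Rightarrow> a | Some (\<alpha>, i, l) \<Rightarrow> y \<alpha> i l)" for v
    have c: "range c \<subseteq> carrier M" using y(1) a by (fastforce simp: c_def split: option.split)
    have "dfn L M N UNIV (\<lambda>c. pattern M 1 \<phi> F k (\<lambda>\<alpha> i l. c (Some (\<alpha>, i, l))))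
        (\<lambda>c. pattern N 1 \<phi> F k (\<lambda>\<alpha> i l. c (Some (\<alpha>, i, l))))"
      by (rule dfn_pattern) (use F wf in auto)
    from el_equiv_dfn_ex[OF assms(1-3) this c]
    obtain d where "range d \<subseteq> carrier N" "pattern N 1 \<phi> F k (\<lambda>\<alpha> i l. d (Some (\<alpha>, i, l)))"
      using y(2) by (auto simp: c_def)
    then show "\<exists>y. (\<forall>\<alpha> i. range (y \<alpha> i) \<subseteq> carrier N) \<and> pattern N 1 \<phi> F k y"
      by (intro exI[of _ "\<lambda>\<alpha> i l. d (Some (\<alpha>, i, l))"]) auto
  qed (use wf in blast)
qed

lemma ird_array_imp_finpat:
  assumes "is_struct L M" "ird_array L M \<kappa>"
  shows "finpat L M 1 (Field \<kappa>)"
proof -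
  obtain m \<phi> and b :: "_ \<Rightarrow> nat \<Rightarrow> _" where *: "\<forall>\<alpha>\<in>Field \<kappa>. fm_in L (1 + m \<alpha>) (\<phi> \<alpha>) \<and> (\<forall>i. b \<alpha> i \<in> tuples (carrier M) (m \<alpha>))"
    and g: "\<forall>g. \<exists>a\<in>carrier M. \<forall>\<alpha>\<in>Field \<kappa>. \<forall>i. holds M (\<phi> \<alpha>) (a # b \<alpha> i) \<longleftrightarrow> g \<alpha> < i"
    using assms(2) unfolding ird_array_def by (elim exE conjE)
  have \<phi>: "fm_in L (1 + m \<alpha>) (\<phi> \<alpha>)" and b: "b \<alpha> i \<in> tuples (carrier M) (m \<alpha>)"
    if "\<alpha> \<in> Field \<kappa>" for \<alpha> i using * that by blast+
  obtain a0 where a0: "a0 \<in> carrier M" using assms(1) by (auto simp: is_struct_def)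
  \<comment> \<open>The finite tuples are padded by \<open>a0\<close> to sequences in the carrier;
    \<open>\<phi> \<alpha>\<close> does not read the padding.\<close>
  define y where "y \<alpha> i l = (if \<alpha> \<in> Field \<kappa> \<and> l < m \<alpha> then b \<alpha> i ! l else a0)" for \<alpha> i l
  have y: "range (y \<alpha> i) \<subseteq> carrier M" for \<alpha> i
    using b[of \<alpha> i] a0 by (auto simp: y_def tuples_def subset_iff)
  have eq: "sat M (env 1 (\<lambda>_. a) (y \<alpha> i)) (\<phi> \<alpha>) \<longleftrightarrow> holds M (\<phi> \<alpha>) (a # b \<alpha> i)"
    if "\<alpha> \<in> Field \<kappa>" for \<alpha> i a
    unfolding holds_def
  proof (rule sat_cong)
    fix v assume "v \<in> fv (\<phi> \<alpha>)"
    then have "v < 1 + m \<alpha>" using \<phi>[OF that] by (auto simp: fm_in_def)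
    then show "env 1 (\<lambda>_. a) (y \<alpha> i) v = (a # b \<alpha> i) ! v"
      using that by (auto simp: env_def y_def nth_Cons split: nat.split)
  qed
  show ?thesis
  proof (rule finpatI[where \<phi> = \<phi>])
    show "wf_fm L (\<phi> \<alpha>)" if "\<alpha> \<in> Field \<kappa>" for \<alpha>
      using \<phi>[OF that] by (simp add: fm_in_def)
  next
    fix F k
    assume F: "finite F" "F \<subseteq> Field \<kappa>"
    have "pattern M 1 \<phi> F k y"
      unfolding pattern_def
    proof
      fix h
      obtain a where "a \<in> carrier M" "\<forall>\<alpha>\<in>Field \<kappa>. \<forall>i. holds M (\<phi> \<alpha>) (a # b \<alpha> i) \<longleftrightarrow> h \<alpha> < i"
        using spec[OF g, of h] by blast
      with eq F show "\<exists>x. range x \<subseteq> carrier M \<and>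
          (\<forall>\<alpha>\<in>F. \<forall>i<k. sat M (env 1 x (y \<alpha> i)) (\<phi> \<alpha>) \<longleftrightarrow> h \<alpha> < i)"
        by (intro exI[of _ "\<lambda>_. a"]) auto
    qed
    with y show "\<exists>y. (\<forall>\<alpha> i. range (y \<alpha> i) \<subseteq> carrier M) \<and> pattern M 1 \<phi> F k y" by blast
  qed
qed

text \<open>The finite parts of the array in the extension are finite patterns, and these descend to
  \<open>M\<close> because the two structures are elementarily equivalent.\<close>

lemma opd_ge_imp_finpat:
  fixes M :: "('a, 'f, 'r) fo_struct" and \<kappa> :: "'k rel"
  assumes "opd_ge L M \<kappa>" "is_struct L M"
  shows "finpat L M 1 (Field \<kappa>)"
proof -
  obtain M' :: "(('a + 'f + 'r + 'k + nat) set, 'f, 'r) fo_struct" and h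
    where M': "is_struct L M'" "elementary_embedding L M M' h" "ird_array L M' \<kappa>"
    using assms(1) unfolding opd_ge_def by blast
  have "finpat L M' 1 (Field \<kappa>)" using M' by (rule_tac ird_array_imp_finpat)
  moreover have "el_equiv L M' M"
    using M'(2) elementary_embedding_imp_el_equiv el_equiv_sym by blast
  ultimately show ?thesis
    using finpat_el_equiv[of L M' M "Field \<kappa>"] M'(1) assms(2) unfolding is_struct_def by blast
qed

section \<open>Transport of patterns along a trace definition\<close>

lemma nth_concat_map:
  assumes "\<And>a. a \<in> set as \<Longrightarrow> length (\<tau> a) = n" "v < length as * n"
  shows "concat (map \<tau> as) ! v = \<tau> (as ! (v div n)) ! (v mod n)"
  using assms
proof (induction as arbitrary: v)
  case (Cons a as)
  have n: "n > 0" using Cons.prems(2) by (cases n) auto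
  show ?case
  proof (cases "v < n")
    case True
    then show ?thesis using Cons.prems(1) by (simp add: nth_append)
  next
    case False
    then obtain w where w: "v = n + w" using le_iff_add not_less by blast
    then show ?thesis
      using Cons.IH[of w] Cons.prems n by (simp add: nth_append)
  qed
qed simp

lemma length_concat_map:
  assumes "\<And>a. a \<in> set as \<Longrightarrow> length (\<tau> a) = n"
  shows "length (concat (map \<tau> as)) = length as * n"
  using assms by (induction as) auto

text \<open>The set defined by \<open>\<phi> \<alpha>\<close> in \<open>M\<close> is the preimage
  under \<tau> of an \<open>N\<close>-definable set, so the same array works after replacing every
  element by its image. The parameters of the \<open>N\<close>-definition become parameters of the
  pattern.\<close>

lemma trace_definition_finpat:
  fixes M :: "('a, 'g, 's) fo_struct" and N :: "('b, 'f, 'r) fo_struct" and A :: "'k set"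
  assumes "trace_definition L' M L N n \<tau>" "is_struct L N" "finpat L' M 1 A"
  shows "finpat L N n A"
proof -
  have n: "n \<ge> 1" and \<tau>: "\<And>a. a \<in> carrier M \<Longrightarrow> \<tau> a \<in> tuples (carrier N) n"
    and tr: "\<And>m X. m \<ge> 1 \<Longrightarrow> definable L' M m X \<Longrightarrow>
        \<exists>Y. definable L N (m * n) Y \<and> X = {as \<in> tuples (carrier M) m. concat (map \<tau> as) \<in> Y}"
    using assms(1) unfolding trace_definition_def by blast+
  obtain d where d: "d \<in> carrier N" using assms(2) by (auto simp: is_struct_def)
  obtain \<phi> where wf: "\<forall>\<alpha>\<in>A. wf_fm L' (\<phi> \<alpha>)"
    and pat: "\<forall>F k. finite F \<and> F \<subseteq> A \<longrightarrow>
      (\<exists>y. (\<forall>\<alpha> i. range (y \<alpha> i) \<subseteq> carrier M) \<and> pattern M 1 \<phi> F k y)"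
    by (rule finpatE[OF assms(3)])
  have "\<exists>m. fv (\<phi> \<alpha>) \<subseteq> {..<1 + m}" for \<alpha>
  proof -
    obtain k where "fv (\<phi> \<alpha>) \<subseteq> {..<k}" by (rule fv_bound)
    then show ?thesis by (intro exI[of _ k]) auto
  qed
  then obtain m where m: "\<And>\<alpha>. fv (\<phi> \<alpha>) \<subseteq> {..<1 + m \<alpha>}" by metis
  have "\<exists>\<psi> bs. set bs \<subseteq> carrier N \<and> wf_fm L \<psi> \<and> fv \<psi> \<subseteq> {..<(1 + m \<alpha>) * n + length bs} \<and>
      (\<forall>as\<in>tuples (carrier M) (1 + m \<alpha>). holds M (\<phi> \<alpha>) as \<longleftrightarrow> holds N \<psi> (concat (map \<tau> as) @ bs))"
    if "\<alpha> \<in> A" for \<alpha>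
  proof -
    have "definable L' M (1 + m \<alpha>) {as \<in> tuples (carrier M) (1 + m \<alpha>). holds M (\<phi> \<alpha>) as}"
      unfolding definable_def
      by (rule exI[of _ "\<phi> \<alpha>"], rule exI[of _ "[]"]) (use bspec[OF wf that] m in \<open>auto simp: fm_in_def\<close>)
    from tr[OF _ this] obtain Y where Y: "definable L N ((1 + m \<alpha>) * n) Y"
      "{as \<in> tuples (carrier M) (1 + m \<alpha>). holds M (\<phi> \<alpha>) as} =
       {as \<in> tuples (carrier M) (1 + m \<alpha>). concat (map \<tau> as) \<in> Y}" by auto
    obtain \<psi> bs where \<psi>: "set bs \<subseteq> carrier N" "fm_in L ((1 + m \<alpha>) * n + length bs) \<psi>"
      "Y = {as \<in> tuples (carrier N) ((1 + m \<alpha>) * n). holds N \<psi> (as @ bs)}"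
      using Y(1) unfolding definable_def by blast
    have "holds M (\<phi> \<alpha>) as \<longleftrightarrow> holds N \<psi> (concat (map \<tau> as) @ bs)"
      if as: "as \<in> tuples (carrier M) (1 + m \<alpha>)" for as
    proof -
      have "length (\<tau> a) = n" "set (\<tau> a) \<subseteq> carrier N" if "a \<in> set as" for a
        using as \<tau>[of a] that by (auto simp: tuples_def)
      then have "concat (map \<tau> as) \<in> tuples (carrier N) ((1 + m \<alpha>) * n)"
        using as length_concat_map[of as \<tau> n] by (auto simp: tuples_def)
      then show ?thesis using Y(2) \<psi>(3) as by blast
    qed
    then show ?thesis using \<psi>(1,2) unfolding fm_in_def by blast
  qed
  then obtain \<psi> bs where bs: "\<And>\<alpha>. \<alpha> \<in> A \<Longrightarrow> set (bs \<alpha>) \<subseteq> carrier N"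
    and wf\<psi>: "\<And>\<alpha>. \<alpha> \<in> A \<Longrightarrow> wf_fm L (\<psi> \<alpha>)"
    and fv\<psi>: "\<And>\<alpha>. \<alpha> \<in> A \<Longrightarrow> fv (\<psi> \<alpha>) \<subseteq> {..<(1 + m \<alpha>) * n + length (bs \<alpha>)}"
    and \<psi>: "\<And>\<alpha> as. \<alpha> \<in> A \<Longrightarrow> as \<in> tuples (carrier M) (1 + m \<alpha>) \<Longrightarrow>
      holds M (\<phi> \<alpha>) as \<longleftrightarrow> holds N (\<psi> \<alpha>) (concat (map \<tau> as) @ bs \<alpha>)"
    by metis
  show ?thesis
  proof (rule finpatI[where \<phi> = \<psi>])
    fix F k
    assume F: "finite F" "F \<subseteq> A"
    obtain y where y: "\<forall>\<alpha> i. range (y \<alpha> i) \<subseteq> carrier M" "pattern M 1 \<phi> F k y"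
      using pat[THEN spec[of _ F], THEN spec[of _ k], THEN mp, OF conjI[OF F]] by (elim exE conjE)
    \<comment> \<open>The images of the \<open>m \<alpha>\<close> parameters are laid end to end,
      followed by the constants \<open>bs \<alpha>\<close>; this is the list read by
      \<open>\<psi> \<alpha>\<close> without its first \<open>n\<close> entries, which belong to the
      realization.\<close>
    define z where "z \<alpha> i l = (if \<alpha> \<in> A then if l < m \<alpha> * n then \<tau> (y \<alpha> i (l div n)) ! (l mod n)
        else if l < m \<alpha> * n + length (bs \<alpha>) then bs \<alpha> ! (l - m \<alpha> * n) else d else d)" for \<alpha> i l
    have \<tau>n: "\<tau> a ! (l mod n) \<in> carrier N" if "a \<in> carrier M" for a l
    proof -
      have "l mod n < length (\<tau> a)" "set (\<tau> a) \<subseteq> carrier N"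
        using \<tau>[OF that] n by (simp_all add: tuples_def)
      then show ?thesis by (meson nth_mem subsetD)
    qed
    have z: "range (z \<alpha> i) \<subseteq> carrier N" for \<alpha> i
    proof -
      have "\<tau> (y \<alpha> i (l div n)) ! (l mod n) \<in> carrier N" for l
        using y(1) by (intro \<tau>n) blast
      moreover have "bs \<alpha> ! (l - m \<alpha> * n) \<in> carrier N"
        if "\<alpha> \<in> A" "\<not> l < m \<alpha> * n" "l < m \<alpha> * n + length (bs \<alpha>)" for l
      proof -
        have "l - m \<alpha> * n < length (bs \<alpha>)" using that by linarith
        then show ?thesis using bs[OF that(1)] by (meson nth_mem subsetD)
      qed
      ultimately show ?thesis using d by (auto simp: z_def)
    qed
    have "pattern N n \<psi> F k z"
      unfolding pattern_def
    proof
      fix g :: "'k \<Rightarrow> nat"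
      obtain x where x: "range x \<subseteq> carrier M"
        "\<forall>\<alpha>\<in>F. \<forall>i<k. sat M (env 1 x (y \<alpha> i)) (\<phi> \<alpha>) \<longleftrightarrow> g \<alpha> < i"
        using patternD[OF y(2), of g] by (elim exE conjE)
      have "x 0 \<in> carrier M" using x(1) by auto
      \<comment> \<open>Reducing modulo \<open>n\<close> turns the tuple \<open>\<tau> (x 0)\<close>
        into a total sequence in the carrier.\<close>
      have "sat N (env n (\<lambda>j. \<tau> (x 0) ! (j mod n)) (z \<alpha> i)) (\<psi> \<alpha>) \<longleftrightarrow> g \<alpha> < i"
        if "\<alpha> \<in> F" "i < k" for \<alpha> i
      proof -
        define as where "as = x 0 # map (y \<alpha> i) [0..<m \<alpha>]"
        have \<alpha>: "\<alpha> \<in> A" using that F by auto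
        have as: "as \<in> tuples (carrier M) (1 + m \<alpha>)"
          using x(1) spec[OF spec[OF y(1)], of \<alpha> i] by (auto simp: as_def tuples_def)
        have len: "length (\<tau> a) = n" if "a \<in> set as" for a
          using as \<tau>[of a] that by (auto simp: tuples_def)
        have "sat M (env 1 x (y \<alpha> i)) (\<phi> \<alpha>) \<longleftrightarrow> holds M (\<phi> \<alpha>) as"
          unfolding holds_def
        proof (rule sat_cong)
          fix v assume "v \<in> fv (\<phi> \<alpha>)"
          then have "v < 1 + m \<alpha>" using m by auto
          then show "env 1 x (y \<alpha> i) v = as ! v"
            by (auto simp: env_def as_def nth_Cons split: nat.split)
        qed
        moreover have "sat N (env n (\<lambda>j. \<tau> (x 0) ! (j mod n)) (z \<alpha> i)) (\<psi> \<alpha>) \<longleftrightarrow>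
            holds N (\<psi> \<alpha>) (concat (map \<tau> as) @ bs \<alpha>)"
          unfolding holds_def
        proof (rule sat_cong)
          fix v assume "v \<in> fv (\<psi> \<alpha>)"
          then have v: "v < (1 + m \<alpha>) * n + length (bs \<alpha>)" using fv\<psi>[OF \<alpha>] by auto
          have la: "length as = 1 + m \<alpha>" by (simp add: as_def)
          have lc: "length (concat (map \<tau> as)) = (1 + m \<alpha>) * n"
            using length_concat_map[of as \<tau> n, OF len] la by simp
          consider (a) "v < n" | (b) "n \<le> v" "v < (1 + m \<alpha>) * n" | (c) "(1 + m \<alpha>) * n \<le> v" by linarith
          then show "env n (\<lambda>j. \<tau> (x 0) ! (j mod n)) (z \<alpha> i) v = (concat (map \<tau> as) @ bs \<alpha>) ! v"
          proof cases
            case a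
            have "\<tau> (as ! (v div n)) ! (v mod n) = concat (map \<tau> as) ! v"
              by (rule nth_concat_map[symmetric, OF len]) (use a la in auto)
            moreover have "v < length (concat (map \<tau> as))" using a unfolding lc by simp
            moreover have "as ! (v div n) = x 0" using a by (simp add: as_def)
            ultimately show ?thesis using a by (simp only: env_def nth_append if_True mod_less)
          next
            case b
            have eq: "\<tau> (as ! (v div n)) ! (v mod n) = concat (map \<tau> as) ! v"
              by (rule nth_concat_map[symmetric, OF len]) (use b la in auto)
            obtain w where w: "v = n + w" using b le_iff_add by blast
            then have wm: "w < m \<alpha> * n" using b by simp
            then have "w div n < m \<alpha>" by (simp add: less_mult_imp_div_less)
            then have "as ! (v div n) = y \<alpha> i (w div n)" using w n by (simp add: as_def)
            then have "z \<alpha> i w = concat (map \<tau> as) ! v"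
              using wm eq \<alpha> w by (simp add: z_def)
            moreover have "v < length (concat (map \<tau> as))" using b unfolding lc by simp
            moreover have "\<not> v < n" "v - n = w" using w by auto
            ultimately show ?thesis by (simp only: env_def nth_append if_True if_False)
          next
            case c
            have "\<not> v < length (concat (map \<tau> as))" "\<not> v < n" using c unfolding lc by auto
            moreover have "z \<alpha> i (v - n) = bs \<alpha> ! (v - length (concat (map \<tau> as)))"
              unfolding lc using c v \<alpha> by (auto simp: z_def)
            ultimately show ?thesis by (simp only: env_def nth_append if_False)
          qed
        qed
        ultimately show ?thesis using \<psi>[OF \<alpha> as] x(2) that by simp
      qed
      then show "\<exists>x. range x \<subseteq> carrier N \<and>
          (\<forall>\<alpha>\<in>F. \<forall>i<k. sat N (env n x (z \<alpha> i)) (\<psi> \<alpha>) \<longleftrightarrow> g \<alpha> < i)"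
        using \<tau>n[OF \<open>x 0 \<in> carrier M\<close>] by (intro exI[of _ "\<lambda>j. \<tau> (x 0) ! (j mod n)"]) auto
    qed
    then show "\<exists>y. (\<forall>\<alpha> i. range (y \<alpha> i) \<subseteq> carrier N) \<and> pattern N n \<psi> F k y"
      using z by blast
  qed (use wf\<psi> in blast)
qed

section \<open>Ultrafilters\<close>

definition fip :: "'e set set \<Rightarrow> bool" where
  "fip G \<longleftrightarrow> (\<forall>F. finite F \<and> F \<subseteq> G \<longrightarrow> \<Inter>F \<noteq> {})"

definition ultra :: "'e set set \<Rightarrow> bool" where
  "ultra U \<longleftrightarrow> {} \<notin> U \<and> (\<forall>A B. A \<in> U \<longrightarrow> A \<subseteq> B \<longrightarrow> B \<in> U) \<and>
     (\<forall>A B. A \<in> U \<longrightarrow> B \<in> U \<longrightarrow> A \<inter> B \<in> U) \<and> (\<forall>A. A \<in> U \<or> - A \<in> U)"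

lemma ultra_mono: "ultra U \<Longrightarrow> A \<in> U \<Longrightarrow> A \<subseteq> B \<Longrightarrow> B \<in> U"
  by (auto simp: ultra_def)

lemma ultra_Int: "ultra U \<Longrightarrow> A \<in> U \<Longrightarrow> B \<in> U \<Longrightarrow> A \<inter> B \<in> U"
  by (auto simp: ultra_def)

lemma ultra_Compl: "ultra U \<Longrightarrow> - A \<in> U \<longleftrightarrow> A \<notin> U"
  unfolding ultra_def by (metis Compl_disjoint)

lemma ultra_UNIV: "ultra U \<Longrightarrow> UNIV \<in> U"
  unfolding ultra_def by (metis top_greatest)

lemma ultra_Inter: "finite F \<Longrightarrow> ultra U \<Longrightarrow> F \<subseteq> U \<Longrightarrow> \<Inter>F \<in> U"
  by (induction F rule: finite_induct) (simp_all add: ultra_UNIV ultra_Int)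

lemma ultra_INT: "ultra U \<Longrightarrow> finite I \<Longrightarrow> (\<And>i. i \<in> I \<Longrightarrow> A i \<in> U) \<Longrightarrow> (\<Inter>i\<in>I. A i) \<in> U"
  by (rule ultra_Inter) (simp_all add: image_subset_iff)

lemma ultra_nonempty: "ultra U \<Longrightarrow> A \<in> U \<Longrightarrow> \<exists>x. x \<in> A"
  unfolding ultra_def by (metis equals0I)

lemma ultra_cong:
  assumes "ultra U" "D \<in> U" "\<And>e. e \<in> D \<Longrightarrow> e \<in> A \<longleftrightarrow> e \<in> B"
  shows "A \<in> U \<longleftrightarrow> B \<in> U"
proof
  assume "A \<in> U"
  then have "A \<inter> D \<in> U" using assms by (simp add: ultra_Int)
  then show "B \<in> U" using assms(3) by (auto intro: ultra_mono[OF assms(1)])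
next
  assume "B \<in> U"
  then have "B \<inter> D \<in> U" using assms by (simp add: ultra_Int)
  then show "A \<in> U" using assms(3) by (auto intro: ultra_mono[OF assms(1)])
qed

lemma fip_imp_ultra:
  assumes "fip G"
  obtains U where "ultra U" "G \<subseteq> U"
proof -
  define \<A> where "\<A> = {H. G \<subseteq> H \<and> fip H}"
  have "\<exists>M\<in>\<A>. \<forall>X\<in>\<A>. M \<subseteq> X \<longrightarrow> X = M"
  proof (rule subset_Zorn)
    fix C assume C: "subset.chain \<A> C"
    show "\<exists>U\<in>\<A>. \<forall>X\<in>C. X \<subseteq> U"
    proof (cases "C = {}")
      case True
      then show ?thesis using assms by (auto simp: \<A>_def)
    next
      case False
      have "fip (\<Union>C)"
        unfolding fip_def
      proof (intro allI impI)
        fix F assume "finite F \<and> F \<subseteq> \<Union>C"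
        then obtain H where "H \<in> C" "F \<subseteq> H"
          using finite_subset_Union_chain[of F C \<A>] C False by metis
        then show "\<Inter>F \<noteq> {}"
          using C \<open>finite F \<and> F \<subseteq> \<Union>C\<close> unfolding subset.chain_def \<A>_def fip_def by blast
      qed
      moreover have "G \<subseteq> \<Union>C"
        using C False unfolding subset.chain_def \<A>_def by blast
      ultimately show ?thesis by (auto simp: \<A>_def)
    qed
  qed
  then obtain U where "U \<in> \<A>" and U_max: "\<forall>X\<in>\<A>. U \<subseteq> X \<longrightarrow> X = U" by (rule bexE)
  then have U: "G \<subseteq> U" "fip U" by (simp_all add: \<A>_def)
  have max: "H = U" if "U \<subseteq> H" "fip H" for H
    using bspec[OF U_max, of H] that U(1) by (auto simp: \<A>_def)
  \<comment> \<open>By maximality every set that meets all finite intersections already belongs to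
    \<open>U\<close>. All the closure properties of an ultrafilter follow from this
    criterion.\<close>
  have mem: "A \<in> U" if "\<And>F. finite F \<Longrightarrow> F \<subseteq> U \<Longrightarrow> \<Inter>F \<inter> A \<noteq> {}" for A
  proof -
    have "fip (insert A U)"
      unfolding fip_def
    proof (intro allI impI)
      fix F assume F: "finite F \<and> F \<subseteq> insert A U"
      then have "\<Inter>(F - {A}) \<inter> A \<noteq> {}" by (intro that) auto
      then show "\<Inter>F \<noteq> {}" by auto
    qed
    then show ?thesis using max[of "insert A U"] by blast
  qed
  have "ultra U"
    unfolding ultra_def
  proof (intro conjI allI impI)
    have "finite {{}}" by simp
    then show "{} \<notin> U" using U(2) unfolding fip_def
      by (metis Inter_empty Inter_insert empty_subsetI inf_bot_left insert_subset)
  next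
    fix A B assume A: "A \<in> U" "A \<subseteq> B"
    show "B \<in> U"
    proof (rule mem)
      fix F assume "finite F" "F \<subseteq> U"
      then have "\<Inter>(insert A F) \<noteq> {}" using U(2) A(1) unfolding fip_def by (metis finite_insert insert_subset)
      then show "\<Inter>F \<inter> B \<noteq> {}" using A(2) by auto
    qed
  next
    fix A B assume A: "A \<in> U" "B \<in> U"
    show "A \<inter> B \<in> U"
    proof (rule mem)
      fix F assume "finite F" "F \<subseteq> U"
      then have "\<Inter>(insert A (insert B F)) \<noteq> {}"
        using U(2) A unfolding fip_def by (metis finite_insert insert_subset)
      then show "\<Inter>F \<inter> (A \<inter> B) \<noteq> {}" by auto
    qed
  next
    fix A
    show "A \<in> U \<or> - A \<in> U"
    proof (rule ccontr)
      assume "\<not> (A \<in> U \<or> - A \<in> U)"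
      then obtain F F' where F: "finite F" "F \<subseteq> U" "\<Inter>F \<inter> A = {}"
        and F': "finite F'" "F' \<subseteq> U" "\<Inter>F' \<inter> - A = {}" using mem by metis
      then have "\<Inter>(F \<union> F') \<noteq> {}" using U(2) unfolding fip_def by (metis finite_UnI Un_least)
      then show False using F(3) F'(3) by auto
    qed
  qed
  then show ?thesis using U(1) that by blast
qed

section \<open>Saturated models\<close>

text \<open>The elements of the saturated model are named by terms: \<open>Wit \<phi> s\<close> names a realization of the
  partial type consisting of the formulas \<open>\<phi> j\<close> with parameters \<open>s j\<close>, provided that it is
  finitely satisfiable.\<close>

datatype ('v, 'x, 'f, 'r) nm =
    V 'v
  | Wit "'x \<Rightarrow> ('f, 'r) fm" "'x \<Rightarrow> ('v, 'x, 'f, 'r) nm list"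

definition assigns :: "('b, 'f, 'r) fo_struct \<Rightarrow> ('n \<Rightarrow> 'b) set" where
  "assigns N = {e. range e \<subseteq> carrier N}"

definition dep :: "('n \<Rightarrow> 'b) set \<Rightarrow> 'n set \<Rightarrow> ('n \<Rightarrow> 'b) set \<Rightarrow> bool" where
  "dep E S D \<longleftrightarrow> (\<forall>e\<in>E. \<forall>e'\<in>E. (\<forall>c\<in>S. e c = e' c) \<longrightarrow> (e \<in> D \<longleftrightarrow> e' \<in> D))"

text \<open>Both finite satisfiability and realization are meant for \<open>U\<close>-almost all
  assignments. The condition is void for names of the form \<open>V v\<close>.\<close>

definition real_type :: "('b, 'f, 'r) fo_struct \<Rightarrow> (('v, 'x, 'f, 'r) nm \<Rightarrow> 'b) set set
    \<Rightarrow> ('v, 'x, 'f, 'r) nm \<Rightarrow> bool" where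
  "real_type N U w \<longleftrightarrow> (\<forall>\<phi> s. w = Wit \<phi> s \<longrightarrow>
     (\<forall>J. finite J \<longrightarrow> {e. \<exists>x\<in>carrier N. \<forall>j\<in>J. holds N (\<phi> j) (x # map e (s j))} \<in> U) \<longrightarrow>
     (\<forall>j. {e. holds N (\<phi> j) (map e (w # s j))} \<in> U))"

definition subs_closed :: "('v, 'x, 'f, 'r) nm set \<Rightarrow> bool" where
  "subs_closed S \<longleftrightarrow> (\<forall>\<phi> s j. Wit \<phi> s \<in> S \<longrightarrow> set (s j) \<subseteq> S)"

lemma dep_mono: "dep E S D \<Longrightarrow> S \<subseteq> S' \<Longrightarrow> dep E S' D"
  unfolding dep_def by (meson subsetD)

lemma dep_Compl: "dep E S D \<Longrightarrow> dep E S (- D)"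
  unfolding dep_def by blast

text \<open>The ultrafilter is found by Zorn's lemma among the pairs of a set \<open>S\<close> of names closed under
  subterms and the trace on the \<open>S\<close>-dependent sets of an ultrafilter that is good for the names in
  \<open>S\<close>. The extension step is possible because a finitely satisfiable type over \<open>S\<close> can be realized by
  changing the value of a single new name.\<close>

lemma realizing_ultra:
  fixes N :: "('b, 'f, 'r) fo_struct" and \<P> :: "(('v, 'x, 'f, 'r) nm \<Rightarrow> 'b) set set"
  assumes P: "fip (insert (assigns N) \<P>)"
    and P_dep: "\<And>D. D \<in> \<P> \<Longrightarrow> dep (assigns N) (range V) D"
  obtains U where "ultra U" "assigns N \<in> U" "\<P> \<subseteq> U" "\<And>w. real_type N U w"
proof -
  let ?E = "assigns N :: (('v, 'x, 'f, 'r) nm \<Rightarrow> 'b) set"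
  define tr where "tr S U = {D \<in> U. dep ?E S D}" for S U
  define ok where "ok S U \<longleftrightarrow> ultra U \<and> ?E \<in> U \<and> \<P> \<subseteq> U \<and> range V \<subseteq> S \<and> subs_closed S \<and>
      (\<forall>w\<in>S. real_type N U w)" for S U
  define \<Z> where "\<Z> = {(S, tr S U) | S U. ok S U}"
  define R where "R z z' \<longleftrightarrow> fst z \<subseteq> fst z' \<and> snd z \<subseteq> snd z'"
    for z z' :: "('v, 'x, 'f, 'r) nm set \<times> (('v, 'x, 'f, 'r) nm \<Rightarrow> 'b) set set"
  \<comment> \<open>Inclusion in one direction suffices: if a dependent set is missing from
    \<open>U\<close>, its complement is dependent as well and lies in the trace.\<close>
  have tr_iff: "D \<in> U \<longleftrightarrow> D \<in> U'"
    if "ultra U" "ultra U'" "tr S U \<subseteq> U'" "dep ?E S D" for S U U' D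
  proof
    assume "D \<in> U" then show "D \<in> U'" using that by (auto simp: tr_def)
  next
    assume "D \<in> U'"
    then have "- D \<notin> U'" using ultra_Compl that(2) by blast
    then have "- D \<notin> U" using that dep_Compl[OF that(4)] by (auto simp: tr_def)
    then show "D \<in> U" using ultra_Compl that(1) by blast
  qed
  have dep_ex: "dep ?E S {e. \<exists>x\<in>carrier N. \<forall>j\<in>J. holds N (\<phi> j) (x # map e (s j))}"
    if "\<And>j. set (s j) \<subseteq> S" for S J \<phi> s
    unfolding dep_def
  proof (intro ballI impI)
    fix e e' :: "('v, 'x, 'f, 'r) nm \<Rightarrow> 'b" assume "\<forall>c\<in>S. e c = e' c"
    then have "map e (s j) = map e' (s j)" for j using that by auto
    then show "e \<in> {e. \<exists>x\<in>carrier N. \<forall>j\<in>J. holds N (\<phi> j) (x # map e (s j))} \<longleftrightarrow>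
      e' \<in> {e. \<exists>x\<in>carrier N. \<forall>j\<in>J. holds N (\<phi> j) (x # map e (s j))}"
      by (simp del: map_eq_conv)
  qed
  have dep_holds: "dep ?E S {e. holds N \<phi> (map e cs)}" if "set cs \<subseteq> S" for S \<phi> cs
    unfolding dep_def
  proof (intro ballI impI)
    fix e e' :: "('v, 'x, 'f, 'r) nm \<Rightarrow> 'b" assume "\<forall>c\<in>S. e c = e' c"
    then have "map e cs = map e' cs" using that by auto
    then show "e \<in> {e. holds N \<phi> (map e cs)} \<longleftrightarrow> e' \<in> {e. holds N \<phi> (map e cs)}"
      by (simp del: map_eq_conv)
  qed
  \<comment> \<open>Since \<open>S\<close> is closed under subterms, all sets in the condition on a
    name in \<open>S\<close> depend on \<open>S\<close> only, so the condition survives in every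
    ultrafilter containing the trace.\<close>
  have real_tr: "real_type N U' w"
    if "ok S U" "ultra U'" "tr S U \<subseteq> U'" "w \<in> S" for S U U' w
  proof -
    have rt: "real_type N U w" and uU: "ultra U" and cl: "subs_closed S"
      using that unfolding ok_def by auto
    show ?thesis
      unfolding real_type_def
    proof (intro allI impI)
      fix \<phi> s j
      assume w: "w = Wit \<phi> s"
        and pre: "\<forall>J. finite J \<longrightarrow>
          {e. \<exists>x\<in>carrier N. \<forall>j\<in>J. holds N (\<phi> j) (x # map e (s j))} \<in> U'"
      have s: "set (s j) \<subseteq> S" for j
        using cl that(4) w unfolding subs_closed_def by blast
      have "{e. \<exists>x\<in>carrier N. \<forall>j\<in>J. holds N (\<phi> j) (x # map e (s j))} \<in> U" if "finite J" for J
        using pre[rule_format, OF that] tr_iff[OF uU \<open>ultra U'\<close> \<open>tr S U \<subseteq> U'\<close> dep_ex[of s S J \<phi>, OF s]]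
        by (rule_tac iffD2)
      then have "{e. holds N (\<phi> j) (map e (w # s j))} \<in> U"
        using rt w unfolding real_type_def by (elim allE impE) auto
      moreover have "set (w # s j) \<subseteq> S" using s that(4) by simp
      ultimately show "{e. holds N (\<phi> j) (map e (w # s j))} \<in> U'"
        using tr_iff[OF uU that(2,3) dep_holds[of "w # s j" S "\<phi> j"]] by (rule_tac iffD1)
    qed
  qed
  have "\<exists>m\<in>\<Z>. \<forall>a\<in>\<Z>. R m a \<longrightarrow> a = m"
  proof -
    have "partial_order_on \<Z> (relation_of R \<Z>)"
      by (auto simp: partial_order_on_def preorder_on_def refl_on_def trans_def antisym_def
          relation_of_def R_def prod_eq_iff)
    moreover have "\<exists>u\<in>\<Z>. \<forall>a\<in>C. R a u" if "C \<in> Chains (relation_of R \<Z>)" for C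
    proof (cases "C = {}")
      case True
      obtain U where U: "ultra U" "insert ?E \<P> \<subseteq> U" using fip_imp_ultra[OF P] by blast
      then have "ok (range V) U" by (auto simp: ok_def subs_closed_def real_type_def)
      then have "(range V, tr (range V) U) \<in> \<Z>" by (auto simp: \<Z>_def)
      then show ?thesis using True by blast
    next
      case False
      have C: "C \<subseteq> \<Z>" "\<And>a b. a \<in> C \<Longrightarrow> b \<in> C \<Longrightarrow> R a b \<or> R b a"
        using that unfolding Chains_def relation_of_def by auto
      define G where "G = (\<Union>z\<in>C. snd z)"
      define S where "S = (\<Union>z\<in>C. fst z)"
      have G: "\<exists>S U. (S, tr S U) \<in> C \<and> ok S U \<and> F \<subseteq> tr S U" if "finite F" "F \<subseteq> G" for F
        using that
      proof (induction F rule: finite_induct)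
        case empty
        then show ?case using False C(1) unfolding \<Z>_def by blast
      next
        case (insert D F)
        obtain S U where 1: "(S, tr S U) \<in> C" "ok S U" "F \<subseteq> tr S U" using insert by auto
        obtain z where z: "z \<in> C" "D \<in> snd z" using insert.prems unfolding G_def by auto
        then obtain S' U' where 2: "z = (S', tr S' U')" "ok S' U'" using C(1) unfolding \<Z>_def by blast
        show ?case
        proof (cases "R (S, tr S U) z")
          case True
          then show ?thesis using 1 2 z unfolding R_def by (intro exI[of _ S'] exI[of _ U']) auto
        next
          case False
          then have "R z (S, tr S U)" using C(2) 1(1) z(1) by blast
          then show ?thesis using 1 z unfolding R_def by (intro exI[of _ S] exI[of _ U]) auto
        qed
      qed
      have "fip (insert ?E (\<P> \<union> G))"
        unfolding fip_def
      proof (intro allI impI)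
        fix F assume F: "finite F \<and> F \<subseteq> insert ?E (\<P> \<union> G)"
        then have "finite (F \<inter> G)" "F \<inter> G \<subseteq> G" by auto
        from G[OF this] obtain S U where "ok S U" "F \<inter> G \<subseteq> tr S U" by blast
        then have "F \<subseteq> U" "ultra U" using F unfolding ok_def tr_def by auto
        then show "\<Inter>F \<noteq> {}" using F ultra_Inter[of F U] unfolding ultra_def by metis
      qed
      then obtain U where U: "ultra U" "insert ?E (\<P> \<union> G) \<subseteq> U" using fip_imp_ultra by blast
      have zC: "\<exists>T W. z = (T, tr T W) \<and> ok T W \<and> T \<subseteq> S \<and> tr T W \<subseteq> U" if zin: "z \<in> C" for z
      proof -
        obtain T W where TW: "z = (T, tr T W)" "ok T W" using zin C(1) unfolding \<Z>_def by blast
        have "T \<subseteq> S" using zin TW(1) unfolding S_def by force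
        moreover have "tr T W \<subseteq> G" using zin TW(1) unfolding G_def by force
        ultimately show ?thesis using TW U(2) by blast
      qed
      have "ok S U"
        unfolding ok_def
      proof (intro conjI ballI)
        obtain z where "z \<in> C" using False by blast
        then show "range V \<subseteq> S" using zC unfolding ok_def by blast
        show "subs_closed S"
          unfolding subs_closed_def
        proof (intro allI impI)
          fix \<phi> s j assume "Wit \<phi> s \<in> S"
          then obtain z where z: "z \<in> C" "Wit \<phi> s \<in> fst z" unfolding S_def by blast
          obtain T W where "z = (T, tr T W)" "ok T W" "T \<subseteq> S" using zC[OF z(1)] by blast
          then show "set (s j) \<subseteq> S" using z(2) unfolding ok_def subs_closed_def by fastforce
        qed
        fix w assume "w \<in> S"
        then obtain z where z: "z \<in> C" "w \<in> fst z" unfolding S_def by blast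
        obtain T W where "z = (T, tr T W)" "ok T W" "tr T W \<subseteq> U" using zC[OF z(1)] by blast
        then show "real_type N U w" using real_tr[of T W U w] U(1) z(2) by simp
      qed (use U in auto)
      then have "(S, tr S U) \<in> \<Z>" unfolding \<Z>_def by blast
      moreover have "R z (S, tr S U)" if "z \<in> C" for z
        using zC[OF that] unfolding R_def tr_def by (auto intro: dep_mono)
      ultimately show ?thesis by blast
    qed
    ultimately show ?thesis by (rule predicate_Zorn)
  qed
  then obtain S U where ok: "ok S U" and max: "\<And>a. a \<in> \<Z> \<Longrightarrow> R (S, tr S U) a \<Longrightarrow> a = (S, tr S U)"
    unfolding \<Z>_def by blast
  \<comment> \<open>Induction on names: if all names occurring in \<open>w\<close> are in
    \<open>S\<close> but \<open>w\<close> is not, then the maximal pair can be enlarged by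
    \<open>w\<close>.\<close>
  have "w \<in> S" for w
  proof (induction w)
    case (V v)
    then show ?case using ok by (auto simp: ok_def)
  next
    case (Wit \<phi> s)
    have s: "set (s j) \<subseteq> S" for j using Wit by blast
    let ?w = "Wit \<phi> s"
    show ?case
    proof (rule ccontr)
      assume w: "?w \<notin> S"
      have closed: "subs_closed (insert ?w S)"
        using ok s unfolding ok_def subs_closed_def by blast
      have "\<exists>U'. ultra U' \<and> ?E \<in> U' \<and> \<P> \<subseteq> U' \<and> tr S U \<subseteq> U' \<and> real_type N U' ?w"
      proof (cases "\<forall>J. finite J \<longrightarrow>
          {e. \<exists>x\<in>carrier N. \<forall>j\<in>J. holds N (\<phi> j) (x # map e (s j))} \<in> U")
        case True
        define B where "B j = {e. holds N (\<phi> j) (map e (?w # s j))}" for j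
        have "fip (insert ?E (tr S U \<union> range B))"
          unfolding fip_def
        proof (intro allI impI)
          fix F assume F: "finite F \<and> F \<subseteq> insert ?E (tr S U \<union> range B)"
          obtain J where J: "finite J" "F \<inter> range B = B ` J"
            using F by (metis finite_Int finite_subset_image inf_le2)
          have uU: "ultra U" and EU: "?E \<in> U" using ok by (auto simp: ok_def)
          let ?X = "{e. \<exists>x\<in>carrier N. \<forall>j\<in>J. holds N (\<phi> j) (x # map e (s j))}"
          have "insert ?E (insert ?X (F \<inter> tr S U)) \<subseteq> U" "finite (insert ?E (insert ?X (F \<inter> tr S U)))"
            using EU True J(1) F by (auto simp: tr_def)
          then have "\<Inter>(insert ?E (insert ?X (F \<inter> tr S U))) \<in> U" using ultra_Inter[OF _ uU] by blast
          from ultra_nonempty[OF uU this] obtain e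
            where "e \<in> \<Inter>(insert ?E (insert ?X (F \<inter> tr S U)))" ..
          then have e: "e \<in> ?E" "e \<in> ?X" "e \<in> \<Inter>(F \<inter> tr S U)" by simp_all
          from e(2) obtain x where x: "x \<in> carrier N" "\<forall>j\<in>J. holds N (\<phi> j) (x # map e (s j))" by blast
          \<comment> \<open>Giving \<open>?w\<close> the value \<open>x\<close> affects neither the
            sets of the trace nor the parameters \<open>s j\<close>, because \<open>?w\<close> is
            not in \<open>S\<close>.\<close>
          let ?e = "e(?w := x)"
          have eE: "?e \<in> ?E" using e(1) x(1) by (auto simp: assigns_def)
          have "?e \<in> D" if "D \<in> F" for D
          proof -
            consider "D = ?E" | "D \<in> F \<inter> tr S U" | "D \<in> B ` J" using \<open>D \<in> F\<close> F J(2) by blast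
            then show ?thesis
            proof cases
              case 1 then show ?thesis using eE by simp
            next
              case 2
              then have "dep ?E S D" "e \<in> D" using e(3) by (auto simp: tr_def)
              moreover have "\<forall>c\<in>S. e c = ?e c" using w by auto
              ultimately show ?thesis using e(1) eE unfolding dep_def by blast
            next
              case 3
              then obtain j where j: "j \<in> J" "D = B j" by blast
              have "map ?e (s j) = map e (s j)" using s[of j] w by auto
              then show ?thesis using bspec[OF x(2) j(1)] j(2) by (simp add: B_def del: map_eq_conv)
            qed
          qed
          then show "\<Inter>F \<noteq> {}" by blast
        qed
        then obtain U' where U': "ultra U'" "insert ?E (tr S U \<union> range B) \<subseteq> U'"
          using fip_imp_ultra by blast
        have "\<P> \<subseteq> tr S U" using ok P_dep unfolding ok_def tr_def by (auto intro: dep_mono)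
        then show ?thesis using U' unfolding real_type_def B_def by (intro exI[of _ U']) blast
      next
        \<comment> \<open>If the type is not finitely satisfiable, nothing is required of its name
          and \<open>U\<close> can be kept.\<close>
        case False
        then show ?thesis using ok unfolding real_type_def ok_def tr_def
          by (intro exI[of _ U]) blast
      qed
      then obtain U' where U': "ultra U'" "?E \<in> U'" "\<P> \<subseteq> U'" "tr S U \<subseteq> U'" "real_type N U' ?w" by blast
      have "ok (insert ?w S) U'"
        using U' closed ok real_tr[OF ok U'(1,4)] unfolding ok_def by blast
      then have "(insert ?w S, tr (insert ?w S) U') \<in> \<Z>" unfolding \<Z>_def by blast
      moreover have "R (S, tr S U) (insert ?w S, tr (insert ?w S) U')"
        using U'(4) unfolding R_def tr_def by (auto intro: dep_mono)
      ultimately show False using max w by blast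
    qed
  qed
  with ok show ?thesis by (intro that[of U]) (simp_all add: ok_def)
qed

section \<open>The structure of names modulo an ultrafilter\<close>

definition nm_model :: "('b, 'f, 'r) fo_struct \<Rightarrow> ('n \<Rightarrow> 'b) set set \<Rightarrow> ('n \<Rightarrow> 'z)
    \<Rightarrow> ('z, 'f, 'r) fo_struct" where
  "nm_model N U q = \<lparr>carrier = range q,
     fint = (\<lambda>f as. q (SOME d. \<exists>cs. as = map q cs \<and> {e. e d = fint N f (map e cs)} \<in> U)),
     rint = (\<lambda>r as. \<exists>cs. as = map q cs \<and> {e. rint N r (map e cs)} \<in> U)\<rparr>"

text \<open>Names are identified when their values agree almost everywhere. Any map \<open>q\<close>
  with these fibres is allowed, so that the carrier can be placed in a prescribed type.\<close>

locale nm_structure =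
  fixes L :: "('f, 'r) lang" and N :: "('b, 'f, 'r) fo_struct"
    and U :: "(('v, 'x, 'f, 'r) nm \<Rightarrow> 'b) set set" and q :: "('v, 'x, 'f, 'r) nm \<Rightarrow> 'z"
  assumes N: "is_struct L N" and U: "ultra U" and assigns_U: "assigns N \<in> U"
    and real_type_U: "real_type N U w"
    and q: "q c = q d \<longleftrightarrow> {e. e c = e d} \<in> U"
begin

abbreviation "K \<equiv> nm_model N U q"

lemma carrier_K: "carrier K = range q"
  by (simp add: nm_model_def)

lemma realize:
  fixes s :: "'x \<Rightarrow> ('v, 'x, 'f, 'r) nm list"
  assumes "\<And>J. finite J \<Longrightarrow> {e. \<exists>x\<in>carrier N. \<forall>j\<in>J. holds N (\<phi> j) (x # map e (s j))} \<in> U"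
  shows "\<exists>w. \<forall>j. {e. holds N (\<phi> j) (map e (w # s j))} \<in> U"
  using real_type_U[of "Wit \<phi> s"] assms unfolding real_type_def by blast

lemma realize_one:
  assumes "{e. \<exists>x\<in>carrier N. holds N \<phi> (x # map e cs)} \<in> U"
  shows "\<exists>w. {e. holds N \<phi> (map e (w # cs))} \<in> U"
proof -
  have "\<exists>w. \<forall>j :: 'x. {e. holds N \<phi> (map e (w # cs))} \<in> U"
    by (rule realize) (rule ultra_mono[OF U assms], auto)
  then show ?thesis by blast
qed

lemma map_q_eq:
  assumes "map q cs = map q ds"
  shows "{e. map e cs = map e ds} \<in> U"
proof -
  have len: "length cs = length ds" using assms map_eq_imp_length_eq by blast
  have "(\<Inter>i\<in>{..<length cs}. {e. e (cs ! i) = e (ds ! i)}) \<in> U"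
  proof (rule ultra_INT[OF U])
    fix i assume "i \<in> {..<length cs}"
    then have "q (cs ! i) = q (ds ! i)" using assms len by (metis lessThan_iff nth_map)
    then show "{e. e (cs ! i) = e (ds ! i)} \<in> U" using q by simp
  qed simp
  then show ?thesis
    by (rule ultra_mono[OF U]) (auto intro!: nth_equalityI simp: len)
qed

text \<open>Elements are values of names only, so a function value needs a name; the type consisting
  of the single formula \<open>x = f(cs)\<close> provides one. The choice in \<open>nm_model\<close>
  may use other names for the same arguments, but these agree with \<open>cs\<close> almost
  everywhere.\<close>

lemma fint_K:
  assumes "f \<in> funs L" "length cs = farity L f"
  shows "\<exists>d. fint K f (map q cs) = q d \<and> {e. e d = fint N f (map e cs)} \<in> U"
proof -
  define \<phi> :: "('f, 'r) fm" where
    "\<phi> = Eq (Var 0) (Fn f (map (\<lambda>i. Var (Suc i)) [0..<length cs]))"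
  have \<phi>: "holds N \<phi> (x # as) \<longleftrightarrow> x = fint N f as" if "length as = length cs" for x as
  proof -
    have "map (eval N ((!) (x # as)) \<circ> (\<lambda>i. Var (Suc i))) [0..<length cs] = as"
      by (simp add: comp_def map_nth flip: that)
    then show ?thesis by (simp add: holds_def \<phi>_def del: map_eq_conv)
  qed
  have "{e. \<exists>x\<in>carrier N. holds N \<phi> (x # map e cs)} \<in> U"
  proof (rule ultra_mono[OF U assigns_U], rule subsetI)
    fix e :: "('v, 'x, 'f, 'r) nm \<Rightarrow> 'b" assume "e \<in> assigns N"
    then have "map e cs \<in> tuples (carrier N) (farity L f)"
      using assms(2) by (auto simp: assigns_def tuples_def)
    then have "fint N f (map e cs) \<in> carrier N" using N assms(1) by (auto simp: is_struct_def)
    then show "e \<in> {e. \<exists>x\<in>carrier N. holds N \<phi> (x # map e cs)}" by (auto simp: \<phi>)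
  qed
  from realize_one[OF this] obtain w where "{e. holds N \<phi> (map e (w # cs))} \<in> U" by blast
  then have w: "{e. e w = fint N f (map e cs)} \<in> U" by (simp add: \<phi>)
  define P where "P d \<longleftrightarrow> (\<exists>ds. map q cs = map q ds \<and> {e. e d = fint N f (map e ds)} \<in> U)" for d
  have "P w" using w unfolding P_def by blast
  then have "P (SOME d. P d)" by (rule someI)
  then obtain ds where ds: "map q cs = map q ds" "{e. e (SOME d. P d) = fint N f (map e ds)} \<in> U"
    unfolding P_def by blast
  have "{e. e (SOME d. P d) = fint N f (map e cs)} \<in> U"
    by (rule ultra_mono[OF U ultra_Int[OF U ds(2) map_q_eq[OF ds(1)]]]) auto
  moreover have "fint K f (map q cs) = q (SOME d. P d)"
    unfolding nm_model_def P_def by simp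
  ultimately show ?thesis by blast
qed

lemma is_struct_K: "is_struct L K"
  unfolding is_struct_def
proof (intro conjI ballI)
  show "carrier K \<noteq> {}" by (simp add: carrier_K)
  fix f as assume f: "f \<in> funs L" and as: "as \<in> tuples (carrier K) (farity L f)"
  have "\<exists>cs. as = map q cs"
    using as by (auto simp: tuples_def carrier_K ex_map_conv subset_iff image_iff) 
  then obtain cs where cs: "as = map q cs" by blast
  then have "length cs = farity L f" using as by (simp add: tuples_def)
  from fint_K[OF f this] show "fint K f as \<in> carrier K" using cs by (auto simp: carrier_K)
qed

lemma rint_K: "rint K r (map q cs) \<longleftrightarrow> {e. rint N r (map e cs)} \<in> U"
proof
  assume "rint K r (map q cs)"
  then obtain ds where ds: "map q cs = map q ds" "{e. rint N r (map e ds)} \<in> U"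
    by (auto simp: nm_model_def)
  show "{e. rint N r (map e cs)} \<in> U"
    by (rule ultra_mono[OF U ultra_Int[OF U ds(2) map_q_eq[OF ds(1)]]]) auto
next
  assume "{e. rint N r (map e cs)} \<in> U"
  then show "rint K r (map q cs)" by (auto simp: nm_model_def)
qed

lemma eval_K:
  assumes "wf_tm L t"
  shows "\<exists>d. eval K (q \<circ> \<sigma>) t = q d \<and> {e. e d = eval N (e \<circ> \<sigma>) t} \<in> U"
  using assms
proof (induction t)
  case (Var x)
  then show ?case using ultra_UNIV[OF U] by (intro exI[of _ "\<sigma> x"]) simp
next
  case (Fn f ts)
  then have "\<forall>t\<in>set ts. \<exists>d. eval K (q \<circ> \<sigma>) t = q d \<and> {e. e d = eval N (e \<circ> \<sigma>) t} \<in> U"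
    unfolding wf_tm.simps by blast
  from bchoice[OF this] obtain D where
    D': "\<forall>t\<in>set ts. eval K (q \<circ> \<sigma>) t = q (D t) \<and> {e. e (D t) = eval N (e \<circ> \<sigma>) t} \<in> U" ..
  then have D: "eval K (q \<circ> \<sigma>) t = q (D t)" "{e. e (D t) = eval N (e \<circ> \<sigma>) t} \<in> U"
    if "t \<in> set ts" for t using that by blast+
  have ev: "map (eval K (q \<circ> \<sigma>)) ts = map q (map D ts)" using D(1) by simp
  obtain d where d: "fint K f (map q (map D ts)) = q d" "{e. e d = fint N f (map e (map D ts))} \<in> U"
    using fint_K[of f "map D ts"] Fn.prems by auto
  have "(\<Inter>t\<in>set ts. {e. e (D t) = eval N (e \<circ> \<sigma>) t}) \<in> U"
    by (rule ultra_INT[OF U]) (simp_all add: D)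
  from ultra_Int[OF U this d(2)] have "{e. e d = eval N (e \<circ> \<sigma>) (Fn f ts)} \<in> U"
  proof (rule ultra_mono[OF U], intro subsetI)
    fix e assume e: "e \<in> (\<Inter>t\<in>set ts. {e. e (D t) = eval N (e \<circ> \<sigma>) t}) \<inter>
      {e. e d = fint N f (map e (map D ts))}"
    then have "map e (map D ts) = map (eval N (e \<circ> \<sigma>)) ts" by simp
    then show "e \<in> {e. e d = eval N (e \<circ> \<sigma>) (Fn f ts)}" using e by (simp del: map_map)
  qed
  moreover have "eval K (q \<circ> \<sigma>) (Fn f ts) = q d" using d(1) ev by (simp del: map_map map_eq_conv)
  ultimately show ?case by blast
qed

text \<open>This is the theorem of Los for names. In the existential case \<open>realize_one\<close>
  supplies one name for the witness, where an ultrapower would use a pointwise choice.\<close>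

lemma sat_K:
  assumes "wf_fm L \<phi>"
  shows "sat K (q \<circ> \<sigma>) \<phi> \<longleftrightarrow> {e. sat N (e \<circ> \<sigma>) \<phi>} \<in> U"
  using assms
proof (induction \<phi> arbitrary: \<sigma>)
  case (Eq s t)
  have wf: "wf_tm L s" "wf_tm L t" using Eq.prems by simp_all
  obtain d where d: "eval K (q \<circ> \<sigma>) s = q d" "{e. e d = eval N (e \<circ> \<sigma>) s} \<in> U"
    using eval_K[OF wf(1), of \<sigma>] by (elim exE conjE)
  obtain d' where d': "eval K (q \<circ> \<sigma>) t = q d'" "{e. e d' = eval N (e \<circ> \<sigma>) t} \<in> U"
    using eval_K[OF wf(2), of \<sigma>] by (elim exE conjE)
  have "{e. e d = e d'} \<in> U \<longleftrightarrow> {e. sat N (e \<circ> \<sigma>) (Eq s t)} \<in> U"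
    by (rule ultra_cong[OF U ultra_Int[OF U d(2) d'(2)]]) auto
  then show ?case using q[of d d'] d(1) d'(1) by (simp only: sat.simps)
next
  case (Rel r ts)
  have "\<forall>t\<in>set ts. \<exists>d. eval K (q \<circ> \<sigma>) t = q d \<and> {e. e d = eval N (e \<circ> \<sigma>) t} \<in> U"
    using eval_K Rel.prems by simp
  from bchoice[OF this] obtain D where
    D': "\<forall>t\<in>set ts. eval K (q \<circ> \<sigma>) t = q (D t) \<and> {e. e (D t) = eval N (e \<circ> \<sigma>) t} \<in> U" ..
  then have D: "eval K (q \<circ> \<sigma>) t = q (D t)" "{e. e (D t) = eval N (e \<circ> \<sigma>) t} \<in> U"
    if "t \<in> set ts" for t using that by blast+
  have ev: "map (eval K (q \<circ> \<sigma>)) ts = map q (map D ts)" using D(1) by simp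
  have "(\<Inter>t\<in>set ts. {e. e (D t) = eval N (e \<circ> \<sigma>) t}) \<in> U"
    by (rule ultra_INT[OF U]) (simp_all add: D)
  then have "{e. rint N r (map e (map D ts))} \<in> U \<longleftrightarrow> {e. sat N (e \<circ> \<sigma>) (Rel r ts)} \<in> U"
  proof (rule ultra_cong[OF U])
    fix e assume "e \<in> (\<Inter>t\<in>set ts. {e. e (D t) = eval N (e \<circ> \<sigma>) t})"
    then have "map e (map D ts) = map (eval N (e \<circ> \<sigma>)) ts" by simp
    then show "e \<in> {e. rint N r (map e (map D ts))} \<longleftrightarrow> e \<in> {e. sat N (e \<circ> \<sigma>) (Rel r ts)}"
      by (simp del: map_map map_eq_conv)
  qed
  then show ?case by (simp only: sat.simps ev rint_K)
next
  case (Neg \<phi>)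
  have eq: "{e. \<not> sat N (e \<circ> \<sigma>) \<phi>} = - {e. sat N (e \<circ> \<sigma>) \<phi>}" by blast
  have wf: "wf_fm L \<phi>" using Neg.prems by simp
  show ?case unfolding sat.simps eq ultra_Compl[OF U] Neg.IH[OF wf] ..
next
  case (Conj \<phi> \<psi>)
  have Int_iff: "A \<inter> B \<in> U \<longleftrightarrow> A \<in> U \<and> B \<in> U" for A B
    using ultra_Int[OF U] ultra_mono[OF U] by (meson inf_le1 inf_le2)
  have wf: "wf_fm L \<phi>" "wf_fm L \<psi>" using Conj.prems by simp_all
  show ?case
    unfolding sat.simps Collect_conj_eq Int_iff Conj.IH(1)[OF wf(1)] Conj.IH(2)[OF wf(2)] ..
next
  case (Ex x \<phi>)
  have upd: "(q \<circ> \<sigma>)(x := q c) = q \<circ> \<sigma>(x := c)" for c by auto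
  have "sat K (q \<circ> \<sigma>) (Ex x \<phi>) \<longleftrightarrow> (\<exists>c. {e. sat N (e \<circ> \<sigma>(x := c)) \<phi>} \<in> U)"
  proof -
    have wf: "wf_fm L \<phi>" using Ex.prems by simp
    show ?thesis unfolding sat.simps carrier_K bex_simps(7) upd Ex.IH[OF wf] by blast
  qed
  also have "\<dots> \<longleftrightarrow> {e. sat N (e \<circ> \<sigma>) (Ex x \<phi>)} \<in> U"
  proof
    assume "\<exists>c. {e. sat N (e \<circ> \<sigma>(x := c)) \<phi>} \<in> U"
    then obtain c where c: "{e. sat N (e \<circ> \<sigma>(x := c)) \<phi>} \<in> U" by blast
    show "{e. sat N (e \<circ> \<sigma>) (Ex x \<phi>)} \<in> U"
    proof (rule ultra_mono[OF U ultra_Int[OF U c assigns_U]], intro subsetI)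
      fix e assume e: "e \<in> {e. sat N (e \<circ> \<sigma>(x := c)) \<phi>} \<inter> assigns N"
      have "e \<circ> \<sigma>(x := c) = (e \<circ> \<sigma>)(x := e c)" by auto
      then show "e \<in> {e. sat N (e \<circ> \<sigma>) (Ex x \<phi>)}"
        using e by (auto simp: assigns_def simp del: fun_upd_apply)
    qed
  next
    assume ex: "{e. sat N (e \<circ> \<sigma>) (Ex x \<phi>)} \<in> U"
    obtain k where k: "fv \<phi> \<subseteq> {..<k}" by (rule fv_bound)
    \<comment> \<open>The quantified variable becomes the variable 0 of a one-formula type, whose
      parameters are the names given by \<sigma> to the first \<open>k\<close> variables.\<close>
    define \<rho> where "\<rho> v = (if v = x then 0 else Suc v)" for v
    define cs where "cs = map \<sigma> [0..<k]"
    have eq: "holds N (ren \<phi> \<rho>) (a # map e cs) \<longleftrightarrow> sat N ((e \<circ> \<sigma>)(x := a)) \<phi>" for a e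
      unfolding holds_def sat_ren by (rule sat_cong) (use k in \<open>auto simp: \<rho>_def cs_def\<close>)
    have "{e. \<exists>a\<in>carrier N. holds N (ren \<phi> \<rho>) (a # map e cs)} \<in> U"
      using ex unfolding eq by simp
    from realize_one[OF this] obtain w where w: "{e. holds N (ren \<phi> \<rho>) (map e (w # cs))} \<in> U" by blast
    have upd: "(e \<circ> \<sigma>)(x := e w) = e \<circ> \<sigma>(x := w)" for e :: "('v, 'x, 'f, 'r) nm \<Rightarrow> 'b" by auto
    have "{e. sat N (e \<circ> \<sigma>(x := w)) \<phi>} \<in> U"
      using w unfolding list.map eq upd .
    then show "\<exists>c. {e. sat N (e \<circ> \<sigma>(x := c)) \<phi>} \<in> U" by blast
  qed
  finally show ?case .
qed

lemma holds_K:
  assumes "fm_in L (length cs) \<phi>"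
  shows "holds K \<phi> (map q cs) \<longleftrightarrow> {e. holds N \<phi> (map e cs)} \<in> U"
proof -
  define \<sigma> where "\<sigma> i = (if i < length cs then cs ! i else V undefined)" for i
  have eq: "holds S \<phi> (map e cs) \<longleftrightarrow> sat S (e \<circ> \<sigma>) \<phi>" for S :: "('y, 'f, 'r) fo_struct" and e
    unfolding holds_def by (rule sat_cong) (use assms in \<open>auto simp: fm_in_def \<sigma>_def\<close>)
  show ?thesis unfolding eq by (rule sat_K) (use assms in \<open>simp add: fm_in_def\<close>)
qed

lemma const_U: "{e. P} \<in> U \<longleftrightarrow> P"
  using ultra_UNIV[OF U] U by (cases P) (simp_all add: ultra_def)

lemma el_equiv_K: "el_equiv L N K"
  unfolding el_equiv_def
proof
  fix \<phi> assume "\<phi> \<in> sentences L"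
  then have "holds K \<phi> [] \<longleftrightarrow> {e. holds N \<phi> []} \<in> U"
    using holds_K[of "[]" \<phi>] by (simp add: sentences_def)
  also have "\<dots> \<longleftrightarrow> holds N \<phi> []" by (rule const_U)
  finally show "holds N \<phi> [] \<longleftrightarrow> holds K \<phi> []" ..
qed

lemma realize_K:
  fixes s :: "'x \<Rightarrow> ('v, 'x, 'f, 'r) nm list"
  assumes fm: "\<And>j. fm_in L (1 + length (s j)) (\<phi> j)"
    and fin: "\<And>J. finite J \<Longrightarrow> {e. \<exists>x\<in>carrier N. \<forall>j\<in>J. holds N (\<phi> j) (x # map e (s j))} \<in> U"
  shows "\<exists>a\<in>carrier K. \<forall>j. holds K (\<phi> j) (a # map q (s j))"
proof -
  obtain w where "\<And>j. {e. holds N (\<phi> j) (map e (w # s j))} \<in> U" using realize[OF fin] by blast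
  then have "\<forall>j. holds K (\<phi> j) (map q (w # s j))"
    using holds_K[of "w # s _"] fm by (metis One_nat_def length_Cons plus_1_eq_Suc)
  then show ?thesis by (auto simp: carrier_K)
qed

text \<open>A type over a small set is enumerated, possibly with repetitions, by the index type of
  \<open>Wit\<close>, so a single name is responsible for it. By \<open>holds_K\<close> its finite
  satisfiability in \<open>K\<close> is finite satisfiability almost everywhere in
  \<open>N\<close>.\<close>

lemma saturated_K:
  fixes \<theta> :: "'t rel"
  assumes small: "\<And>A p. A \<subseteq> carrier K \<Longrightarrow> |A| <o \<theta> \<Longrightarrow> p \<subseteq> {(\<phi>, bs). set bs \<subseteq> A} \<Longrightarrow>
     p \<noteq> {} \<Longrightarrow> \<exists>h :: 'x \<Rightarrow> ('f, 'r) fm \<times> 'z list. range h = p"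
  shows "saturated L K \<theta>"
  unfolding saturated_def
proof (intro allI impI, elim conjE)
  fix A p
  assume A: "A \<subseteq> carrier K" "|A| <o \<theta>"
    and p: "\<forall>(\<phi>, bs)\<in>p. set bs \<subseteq> A \<and> fm_in L (1 + length bs) \<phi>"
    and fin: "\<forall>r. finite r \<and> r \<subseteq> p \<longrightarrow> (\<exists>a\<in>carrier K. \<forall>(\<phi>, bs)\<in>r. holds K \<phi> (a # bs))"
  show "\<exists>a\<in>carrier K. \<forall>(\<phi>, bs)\<in>p. holds K \<phi> (a # bs)"
  proof (cases "p = {}")
    case True
    then show ?thesis by (auto simp: carrier_K)
  next
    case False
    then obtain h :: "'x \<Rightarrow> ('f, 'r) fm \<times> 'z list" where h: "range h = p"
      using small[OF A, of p] p by blast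
    define \<phi> where "\<phi> j = fst (h j)" for j
    have h\<phi>: "(\<phi> j, snd (h j)) \<in> p" for j using h by (auto simp: \<phi>_def)
    have "\<exists>cs. snd (h j) = map q cs" for j
    proof -
      have "set (snd (h j)) \<subseteq> range q" using h\<phi>[of j] p A(1) carrier_K by fastforce
      then show ?thesis by (simp add: ex_map_conv subset_iff image_iff)
    qed
    then obtain s where s: "\<And>j. snd (h j) = map q (s j)" by metis
    have fm: "fm_in L (1 + length (s j)) (\<phi> j)" for j using h\<phi>[of j] p s[of j] by auto
    have "\<exists>a\<in>carrier K. \<forall>j. holds K (\<phi> j) (a # map q (s j))"
    proof (rule realize_K[OF fm])
      fix J :: "'x set" assume J: "finite J"
      then have "finite (h ` J) \<and> h ` J \<subseteq> p" using h by auto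
      from fin[THEN spec, THEN mp, OF this] obtain a
        where "a \<in> carrier K" and a: "\<forall>(\<phi>, bs)\<in>h ` J. holds K \<phi> (a # bs)" ..
      then obtain c where "a = q c" by (auto simp: carrier_K)
      with a have c: "\<forall>(\<phi>, bs)\<in>h ` J. holds K \<phi> (q c # bs)" by simp
      have "(\<Inter>j\<in>J. {e. holds N (\<phi> j) (map e (c # s j))}) \<in> U"
      proof (rule ultra_INT[OF U J])
        fix j assume "j \<in> J"
        then have "holds K (\<phi> j) (map q (c # s j))"
          using bspec[OF c, of "h j"] by (simp add: \<phi>_def case_prod_unfold flip: s)
        then show "{e. holds N (\<phi> j) (map e (c # s j))} \<in> U"
          using holds_K[of "c # s j" "\<phi> j"] fm[of j] by simp
      qed
      from ultra_Int[OF U this assigns_U]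
      show "{e. \<exists>x\<in>carrier N. \<forall>j\<in>J. holds N (\<phi> j) (x # map e (s j))} \<in> U"
      proof (rule ultra_mono[OF U], intro subsetI)
        fix e assume e: "e \<in> (\<Inter>j\<in>J. {e. holds N (\<phi> j) (map e (c # s j))}) \<inter> assigns N"
        then have "e c \<in> carrier N" by (auto simp: assigns_def)
        then show "e \<in> {e. \<exists>x\<in>carrier N. \<forall>j\<in>J. holds N (\<phi> j) (x # map e (s j))}" using e by auto
      qed
    qed
    then obtain a where a: "a \<in> carrier K" "\<And>j. holds K (\<phi> j) (a # map q (s j))" by blast
    have "holds K \<psi> (a # bs)" if p_mem: "(\<psi>, bs) \<in> p" for \<psi> bs
    proof -
      obtain j where "h j = (\<psi>, bs)" using p_mem unfolding h[symmetric] by (metis rangeE)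
      then show ?thesis using a(2)[of j] s[of j] by (simp add: \<phi>_def)
    qed
    then show ?thesis using a(1) by blast
  qed
qed

end

text \<open>The set \<Q> prescribes properties of the values of the free names \<open>V v\<close>.
  The injection \<iota> is what fits the structure into the type \<open>'z\<close>.\<close>

lemma nm_structure_exists:
  fixes N :: "('b, 'f, 'r) fo_struct" and \<iota> :: "('v, 'x, 'f, 'r) nm \<Rightarrow> 'z"
    and \<Q> :: "(('v \<Rightarrow> 'b) \<Rightarrow> bool) set"
  assumes "is_struct L N" "inj \<iota>"
    and fin: "\<And>F. finite F \<Longrightarrow> F \<subseteq> \<Q> \<Longrightarrow> \<exists>c. range c \<subseteq> carrier N \<and> (\<forall>Q\<in>F. Q c)"
  obtains U and q :: "('v, 'x, 'f, 'r) nm \<Rightarrow> 'z"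
  where "nm_structure L N U q" "\<forall>Q\<in>\<Q>. {e. Q (e \<circ> V)} \<in> U"
proof -
  obtain d where d: "d \<in> carrier N" using assms(1) by (auto simp: is_struct_def)
  define \<P> :: "(('v, 'x, 'f, 'r) nm \<Rightarrow> 'b) set set" where "\<P> = (\<lambda>Q. {e. Q (e \<circ> V)}) ` \<Q>"
  have "fip (insert (assigns N) \<P>)"
    unfolding fip_def
  proof (intro allI impI)
    fix F assume F: "finite F \<and> F \<subseteq> insert (assigns N) \<P>"
    obtain F' where F': "finite F'" "F' \<subseteq> \<Q>" "F \<inter> \<P> = (\<lambda>Q. {e. Q (e \<circ> V)}) ` F'"
      using F unfolding \<P>_def by (metis (no_types, lifting) finite_Int finite_subset_image inf_le2)
    obtain c where c: "range c \<subseteq> carrier N" "\<forall>Q\<in>F'. Q c" using fin[OF F'(1,2)] by blast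
    \<comment> \<open>The conditions read only the names \<open>V v\<close>, so all other names may
      get the default value \<open>d\<close>.\<close>
    define e :: "('v, 'x, 'f, 'r) nm \<Rightarrow> 'b" where "e w = (case w of V v \<Rightarrow> c v | Wit _ _ \<Rightarrow> d)" for w
    have "e \<circ> V = c" by (auto simp: e_def)
    moreover have "e \<in> assigns N" using c(1) d by (auto simp: e_def assigns_def split: nm.splits dest: range_subsetD)
    ultimately have "e \<in> D" if "D \<in> F" for D
      using that F F'(3) c(2) by (cases "D \<in> \<P>") auto
    then show "\<Inter>F \<noteq> {}" by blast
  qed
  moreover have "dep (assigns N) (range V) D" if "D \<in> \<P>" for D
  proof -
    from that obtain Q where Q: "D = {e. Q (e \<circ> V)}" unfolding \<P>_def by (rule imageE)
    have "e \<circ> V = e' \<circ> V" if "\<forall>c\<in>range V. e c = e' c" for e e' :: "('v, 'x, 'f, 'r) nm \<Rightarrow> 'b"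
      using that by auto
    then show ?thesis unfolding dep_def Q by (metis mem_Collect_eq)
  qed
  ultimately obtain U where U: "ultra U" "assigns N \<in> U" "\<P> \<subseteq> U" "\<And>w. real_type N U w"
    by (rule realizing_ultra) blast+
  define E where "E = {(c, d). {e :: ('v, 'x, 'f, 'r) nm \<Rightarrow> 'b. e c = e d} \<in> U}"
  \<comment> \<open>Equivalent names have the same class and therefore the same chosen
    representative, which \<iota> then codes.\<close>
  define q where "q c = \<iota> (SOME d. (c, d) \<in> E)" for c
  have E: "(c, c) \<in> E" "(c, d) \<in> E \<Longrightarrow> (d, c) \<in> E" "(c, d) \<in> E \<Longrightarrow> (d, w) \<in> E \<Longrightarrow> (c, w) \<in> E" for c d w
  proof -
    show "(c, c) \<in> E" using ultra_UNIV[OF U(1)] by (simp add: E_def)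
    show "(d, c) \<in> E" if "(c, d) \<in> E" using that by (simp add: E_def eq_commute)
    assume "(c, d) \<in> E" "(d, w) \<in> E"
    then have "{e. e c = e d} \<inter> {e. e d = e w} \<in> U" using ultra_Int[OF U(1)] by (simp add: E_def)
    then have "{e. e c = e w} \<in> U" by (rule ultra_mono[OF U(1)]) auto
    then show "(c, w) \<in> E" by (simp add: E_def)
  qed
  have some: "(c, SOME d. (c, d) \<in> E) \<in> E" for c by (rule someI) (rule E(1))
  have "q c = q d \<longleftrightarrow> {e. e c = e d} \<in> U" for c d
  proof
    assume "q c = q d"
    then have "(SOME w. (c, w) \<in> E) = (SOME w. (d, w) \<in> E)"
      unfolding q_def using injD[OF assms(2)] by blast
    then have "(c, d) \<in> E" using some[of c] some[of d] E(2,3) by metis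
    then show "{e. e c = e d} \<in> U" by (simp add: E_def)
  next
    assume "{e. e c = e d} \<in> U"
    then have "(c, d) \<in> E" by (simp add: E_def)
    then have "(c, w) \<in> E \<longleftrightarrow> (d, w) \<in> E" for w using E(2,3) by blast
    then show "q c = q d" by (simp add: q_def)
  qed
  then have "nm_structure L N U q" using assms(1) U by unfold_locales
  then show ?thesis using that U(3) unfolding \<P>_def by blast
qed

section \<open>Codes of formulas and names\<close>

lemma card_of_UNIV_inj: "|UNIV :: 'a set| \<le>o |UNIV :: 'b set| \<longleftrightarrow> (\<exists>f :: 'a \<Rightarrow> 'b. inj f)"
  using card_of_ordLeq[of "UNIV :: 'a set" "UNIV :: 'b set"] by simp

lemma map_inj_eq:
  assumes "\<And>a b. a \<in> set as \<Longrightarrow> f a = f b \<longleftrightarrow> a = b"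
  shows "map f as = map f bs \<longleftrightarrow> as = bs"
  using assms
proof (induction as arbitrary: bs)
  case (Cons a as)
  then show ?case by (cases bs) auto
qed auto

locale coding =
  fixes pr :: "'x \<Rightarrow> 'x \<Rightarrow> 'x" and nt :: "nat \<Rightarrow> 'x"
    and cf :: "'f \<Rightarrow> 'x" and cr :: "'r \<Rightarrow> 'x"
  assumes pr [simp]: "pr a b = pr c d \<longleftrightarrow> a = c \<and> b = d"
    and nt [simp]: "nt i = nt j \<longleftrightarrow> i = j"
    and cf [simp]: "cf f = cf g \<longleftrightarrow> f = g"
    and cr [simp]: "cr r = cr s \<longleftrightarrow> r = s"
begin

primrec lcode :: "'x list \<Rightarrow> 'x" where
  "lcode [] = pr (nt 0) (nt 0)"
| "lcode (a # as) = pr (nt 1) (pr a (lcode as))"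

lemma lcode [simp]: "lcode as = lcode bs \<longleftrightarrow> as = bs"
proof (induction as arbitrary: bs)
  case Nil
  then show ?case by (cases bs) auto
next
  case (Cons a as)
  then show ?case by (cases bs) auto
qed

primrec tcode :: "'f tm \<Rightarrow> 'x" where
  "tcode (Var v) = pr (nt 0) (nt v)"
| "tcode (Fn f ts) = pr (nt 1) (pr (cf f) (lcode (map tcode ts)))"

lemma tcode [simp]: "tcode s = tcode t \<longleftrightarrow> s = t"
proof (induction s arbitrary: t)
  case (Var v)
  then show ?case by (cases t) auto
next
  case (Fn f ts)
  show ?case
  proof (cases t)
    case (Fn g us)
    then show ?thesis using map_inj_eq[of ts tcode us] Fn.IH by auto
  qed auto
qed

primrec fcode :: "('f, 'r) fm \<Rightarrow> 'x" where
  "fcode (Eq s t) = pr (nt 0) (pr (tcode s) (tcode t))"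
| "fcode (Rel r ts) = pr (nt 1) (pr (cr r) (lcode (map tcode ts)))"
| "fcode (Neg \<phi>) = pr (nt 2) (fcode \<phi>)"
| "fcode (Conj \<phi> \<psi>) = pr (nt 3) (pr (fcode \<phi>) (fcode \<psi>))"
| "fcode (Ex v \<phi>) = pr (nt 4) (pr (nt v) (fcode \<phi>))"

lemma fcode [simp]: "fcode \<phi> = fcode \<psi> \<longleftrightarrow> \<phi> = \<psi>"
proof (induction \<phi> arbitrary: \<psi>)
  case (Rel r ts)
  then show ?case using map_inj_eq[of ts tcode] by (cases \<psi>) auto
qed (case_tac \<psi>; auto)+

text \<open>A name carries a formula and a list of names for each element of \<open>'x\<close>;
  given codes in \<open>'x set\<close> for these names, all the data are joined into one subset of
  \<open>'x\<close>. Elements tagged 1 record the formula and the length of the list at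
  \<open>j\<close>, elements tagged 2 the members of its entries.\<close>

definition wcode :: "('x \<Rightarrow> ('f, 'r) fm) \<Rightarrow> ('x \<Rightarrow> 'x set list) \<Rightarrow> 'x set" where
  "wcode \<phi> S = {pr (nt 1) (pr j (pr (fcode (\<phi> j)) (nt (length (S j))))) | j. True} \<union>
     {pr (nt 2) (pr j (pr (nt l) y)) | j l y. l < length (S j) \<and> y \<in> S j ! l}"

lemma wcode:
  assumes "wcode \<phi> S = wcode \<phi>' S'"
  shows "\<phi> = \<phi>' \<and> S = S'"
proof -
  have 1: "pr (nt 1) (pr j (pr a b)) \<in> wcode \<phi> S \<longleftrightarrow> a = fcode (\<phi> j) \<and> b = nt (length (S j))"
    and 2: "pr (nt 2) (pr j (pr (nt l) y)) \<in> wcode \<phi> S \<longleftrightarrow> l < length (S j) \<and> y \<in> S j ! l"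
    for \<phi> S j a b l y unfolding wcode_def by auto
  have *: "\<phi> j = \<phi>' j \<and> length (S j) = length (S' j)" for j
    using 1[of j "fcode (\<phi> j)" "nt (length (S j))" \<phi> S] 1[of j "fcode (\<phi> j)" "nt (length (S j))" \<phi>' S']
      assms by simp
  have "S j ! l = S' j ! l" if "l < length (S j)" for j l
    using 2[of j l _ \<phi> S] 2[of j l _ \<phi>' S'] assms * that by auto
  with * show ?thesis by (auto intro!: ext nth_equalityI)
qed

primrec ncode :: "('v \<Rightarrow> 'x) \<Rightarrow> ('v, 'x, 'f, 'r) nm \<Rightarrow> 'x set" where
  "ncode cv (V v) = {pr (nt 0) (cv v)}"
| "ncode cv (Wit \<phi> s) = wcode \<phi> (map (ncode cv) \<circ> s)"

lemma inj_ncode: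
  assumes "inj cv"
  shows "inj (ncode cv)"
proof (rule injI)
  have wit: "pr (nt 1) (pr j (pr (fcode (\<phi> j)) (nt (length (S j))))) \<in> wcode \<phi> S" for \<phi> S j
    unfolding wcode_def by blast
  \<comment> \<open>The tag 1 always occurs in a code of a witness, while a free name has only the
    tag 0.\<close>
  then have VW: "{pr (nt 0) y} \<noteq> wcode \<phi> S" for y \<phi> S
    using pr nt by (metis singletonD zero_neq_one)
  fix w w'
  show "ncode cv w = ncode cv w' \<Longrightarrow> w = w'"
  proof (induction w arbitrary: w')
    case (V v)
    then show ?case using VW assms by (cases w') (auto dest: injD)
  next
    case (Wit \<phi> s)
    show ?case
    proof (cases w')
      case (V v)
      then show ?thesis using Wit.prems VW by (metis ncode.simps)
    next
      case (Wit \<phi>' s')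
      then have eq: "\<phi> = \<phi>'" "map (ncode cv) \<circ> s = map (ncode cv) \<circ> s'"
        using wcode[of \<phi> "map (ncode cv) \<circ> s" \<phi>' "map (ncode cv) \<circ> s'"] Wit.prems by auto
      have "s j = s' j" for j
      proof (rule map_inj_eq[THEN iffD1])
        show "map (ncode cv) (s j) = map (ncode cv) (s' j)" using fun_cong[OF eq(2), of j] by simp
        show "ncode cv a = ncode cv b \<longleftrightarrow> a = b" if "a \<in> set (s j)" for a b
          using Wit.IH[of "s j" a b] that by auto
      qed
      then show ?thesis using Wit eq(1) by auto
    qed
  qed
qed

end

lemma infinite_pairing:
  assumes "infinite (UNIV :: 'x set)"
  shows "\<exists>pr :: 'x \<Rightarrow> 'x \<Rightarrow> 'x. \<forall>a b c d. pr a b = pr c d \<longleftrightarrow> a = c \<and> b = d"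
proof -
  have "|UNIV :: ('x \<times> 'x) set| \<le>o |UNIV :: 'x set|"
    using card_of_Times_same_infinite[OF assms] ordIso_imp_ordLeq by (simp add: UNIV_Times_UNIV)
  then obtain p :: "'x \<times> 'x \<Rightarrow> 'x" where "inj p" unfolding card_of_UNIV_inj by blast
  then show ?thesis by (intro exI[of _ "\<lambda>a b. p (a, b)"]) (auto dest: injD)
qed

text \<open>With only one formula per type, names are finitely branching trees and can be coded by
  formulas, so that the same construction gives the downward Loewenheim-Skolem theorem.\<close>

primrec nm_fm :: "(unit, unit, 'f, 'r) nm \<Rightarrow> ('f, 'r) fm" where
  "nm_fm (V v) = Eq (Var 0) (Var 0)"
| "nm_fm (Wit \<phi> s) = Conj (\<phi> ()) (foldr Conj ((map nm_fm \<circ> s) ()) (Eq (Var 0) (Var 0)))"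

lemma inj_nm_fm: "inj (nm_fm :: (unit, unit, 'f, 'r) nm \<Rightarrow> ('f, 'r) fm)"
proof (rule injI)
  let ?E = "Eq (Var 0) (Var 0) :: ('f, 'r) fm"
  fix w w' :: "(unit, unit, 'f, 'r) nm"
  show "nm_fm w = nm_fm w' \<Longrightarrow> w = w'"
  proof (induction w arbitrary: w')
    case (V v)
    then show ?case by (cases w') auto
  next
    case (Wit \<phi> s)
    show ?case
    proof (cases w')
      case (V v)
      then show ?thesis using Wit.prems by simp
    next
      case (Wit \<phi>' s')
      have IH: "a = b" if "a \<in> set (s ())" "nm_fm a = nm_fm b" for a b
        using Wit.IH[of "s ()" a b] that by auto
      have "foldr Conj (map nm_fm as) ?E = foldr Conj (map nm_fm bs) ?E \<Longrightarrow> as = bs"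
        if "set as \<subseteq> set (s ())" for as bs
        using that
      proof (induction as arbitrary: bs)
        case Nil
        then show ?case by (cases bs) auto
      next
        case (Cons a as)
        then show ?case using IH by (cases bs) auto
      qed
      then have "s () = s' ()" "\<phi> () = \<phi>' ()" using Wit.prems Wit by auto
      then show ?thesis using Wit by (auto intro!: ext)
    qed
  qed
qed

lemma downward_LS:
  fixes M :: "('a, 'f, 'r) fo_struct"
  assumes "is_struct L M"
  obtains M' :: "(('f, 'r) fm, 'f, 'r) fo_struct" where "is_struct L M'" "el_equiv L M M'"
proof -
  obtain d where "d \<in> carrier M" using assms by (auto simp: is_struct_def)
  then have "\<exists>c :: unit \<Rightarrow> 'a. range c \<subseteq> carrier M \<and> (\<forall>Q\<in>F. Q c)" if "F \<subseteq> {}" for F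
    using that by (intro exI[of _ "\<lambda>_. d"]) auto
  then obtain U and q :: "(unit, unit, 'f, 'r) nm \<Rightarrow> ('f, 'r) fm" where "nm_structure L M U q"
    using nm_structure_exists[OF assms inj_nm_fm, of "{}"] by metis
  then show ?thesis
    using that nm_structure.is_struct_K nm_structure.el_equiv_K by blast
qed

text \<open>The relation \<open>entails\<close> sees only models on the type of formulas. A model on
  another type is first replaced by an elementarily equivalent one there.\<close>

lemma complete_theory_el_equiv:
  fixes M :: "('a, 'f, 'r) fo_struct" and N :: "('b, 'f, 'r) fo_struct"
  assumes T: "complete_theory L T" and M: "is_model L T M" and N: "is_model L T N"
  shows "el_equiv L M N"
proof -
  have holds: "holds K \<phi> []" if "is_model L T K" "entails L T \<phi>" "\<phi> \<in> sentences L"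
    for K :: "('c, 'f, 'r) fo_struct" and \<phi>
  proof -
    have "is_struct L K" using that(1) by (simp add: is_model_def)
    then obtain K' :: "(('f, 'r) fm, 'f, 'r) fo_struct"
      where K': "is_struct L K'" "el_equiv L K K'" by (rule downward_LS)
    have "T \<subseteq> sentences L" using T by (simp add: complete_theory_def)
    then have "is_model L T K'"
      using that(1) K' by (auto simp: is_model_def el_equiv_def subset_iff)
    then have "holds K' \<phi> []" using that(2) by (simp add: entails_def)
    then show ?thesis using K'(2) that(3) by (simp add: el_equiv_def)
  qed
  show ?thesis
    unfolding el_equiv_def
  proof
    fix \<phi> assume \<phi>: "\<phi> \<in> sentences L"
    then have neg: "Neg \<phi> \<in> sentences L" by (simp add: sentences_def fm_in_def)
    have "entails L T \<phi> \<or> entails L T (Neg \<phi>)" using T \<phi> by (simp add: complete_theory_def)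
    then show "holds M \<phi> [] \<longleftrightarrow> holds N \<phi> []"
    proof
      assume "entails L T \<phi>"
      then show ?thesis using holds[OF M _ \<phi>] holds[OF N _ \<phi>] by simp
    next
      assume "entails L T (Neg \<phi>)"
      then show ?thesis using holds[OF M _ neg] holds[OF N _ neg] by (simp add: holds_def)
    qed
  qed
qed

text \<open>The free names are the elements of \<open>N\<close> together with the entries of the
  future parameters. Requiring each element to keep its value yields the elementary embedding;
  requiring all finite patterns makes the array type finitely satisfiable. The index type of
  \<open>Wit\<close> is the sum type itself, so that names are coded by its subsets.\<close>

lemma finpat_imp_opd_ge:
  fixes N :: "('b, 'f, 'r) fo_struct" and \<kappa> :: "'k rel"
  assumes N: "is_struct L N" and fp: "finpat L N 1 (Field \<kappa>)"
  shows "opd_ge L N \<kappa>"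
proof -
  let ?k = "Inr \<circ> Inr \<circ> Inr \<circ> Inl :: 'k \<Rightarrow> 'b + 'f + 'r + 'k + nat"
  let ?n = "Inr \<circ> Inr \<circ> Inr \<circ> Inr :: nat \<Rightarrow> 'b + 'f + 'r + 'k + nat"
  have inf: "infinite (UNIV :: ('b + 'f + 'r + 'k + nat) set)" by simp
  obtain pr :: "'b + 'f + 'r + 'k + nat \<Rightarrow> 'b + 'f + 'r + 'k + nat \<Rightarrow> 'b + 'f + 'r + 'k + nat"
    where pr: "\<forall>a b c d. pr a b = pr c d \<longleftrightarrow> a = c \<and> b = d"
    using infinite_pairing[OF inf] ..
  interpret cd: coding pr ?n "Inr \<circ> Inl" "Inr \<circ> Inr \<circ> Inl"
    by unfold_locales (auto simp: pr)
  obtain \<phi> where wf: "\<forall>\<alpha>\<in>Field \<kappa>. wf_fm L (\<phi> \<alpha>)"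
    and pat: "\<forall>F k. finite F \<and> F \<subseteq> Field \<kappa> \<longrightarrow>
      (\<exists>y. (\<forall>\<alpha> i. range (y \<alpha> i) \<subseteq> carrier N) \<and> pattern N 1 \<phi> F k y)"
    by (rule finpatE[OF fp])
  have "\<exists>m. fv (\<phi> \<alpha>) \<subseteq> {..<1 + m}" for \<alpha>
  proof -
    obtain k where "fv (\<phi> \<alpha>) \<subseteq> {..<k}" by (rule fv_bound)
    then show ?thesis by (intro exI[of _ k]) auto
  qed
  then obtain m where m: "\<And>\<alpha>. fv (\<phi> \<alpha>) \<subseteq> {..<1 + m \<alpha>}" by metis
  define cv :: "'b + 'k \<times> nat \<times> nat \<Rightarrow> 'b + 'f + 'r + 'k + nat" where
    "cv v = (case v of Inl b \<Rightarrow> pr (?n 0) (Inl b)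
       | Inr (\<alpha>, i, l) \<Rightarrow> pr (?n 1) (pr (?k \<alpha>) (pr (?n i) (?n l))))" for v
  have "inj cv" by (auto intro!: injI simp: cv_def pr split: sum.splits)
  then have inj: "inj (cd.ncode cv)" by (rule cd.inj_ncode)
  define QB :: "'b \<Rightarrow> ('b + 'k \<times> nat \<times> nat \<Rightarrow> 'b) \<Rightarrow> bool" where "QB b c \<longleftrightarrow> c (Inl b) = b" for b c
  define QP :: "'k set \<times> nat \<Rightarrow> ('b + 'k \<times> nat \<times> nat \<Rightarrow> 'b) \<Rightarrow> bool" where
    "QP Fk c \<longleftrightarrow> pattern N 1 \<phi> (fst Fk) (snd Fk) (\<lambda>\<alpha> i l. c (Inr (\<alpha>, i, l)))" for Fk c
  define I where "I = {(F, k :: nat). finite F \<and> F \<subseteq> Field \<kappa>}"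
  have "\<exists>c. range c \<subseteq> carrier N \<and> (\<forall>Q\<in>F. Q c)"
    if F_fin: "finite F" and F_sub: "F \<subseteq> QB ` carrier N \<union> QP ` I" for F
  proof -
    obtain J where J: "finite J" "J \<subseteq> I" "F \<inter> QP ` I = QP ` J"
      using F_fin by (metis finite_Int finite_subset_image inf_le2)
    \<comment> \<open>Finitely many pattern conditions follow from a single one on the union of the
      index sets with the largest length.\<close>
    define G where "G = \<Union>(fst ` J)"
    define k where "k = Max (insert 0 (snd ` J))"
    have "finite (fst z) \<and> fst z \<subseteq> Field \<kappa>" if "z \<in> J" for z
      using subsetD[OF J(2) that] by (auto simp: I_def)
    then have "finite G \<and> G \<subseteq> Field \<kappa>" using J(1) by (auto simp: G_def)
    from pat[THEN spec, THEN spec, THEN mp, OF this, of k] obtain y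
      where y: "\<forall>\<alpha> i. range (y \<alpha> i) \<subseteq> carrier N" "pattern N 1 \<phi> G k y" by (elim exE conjE)
    obtain d where d: "d \<in> carrier N" using N by (auto simp: is_struct_def)
    define c where "c v = (case v of Inl b \<Rightarrow> if b \<in> carrier N then b else d
      | Inr (\<alpha>, i, l) \<Rightarrow> y \<alpha> i l)" for v
    have "range c \<subseteq> carrier N" using y(1) d by (auto simp: c_def image_subset_iff split: sum.splits)
    moreover have "Q c" if QF: "Q \<in> F" for Q
    proof (cases "Q \<in> QP ` I")
      case True
      then have "Q \<in> QP ` J" using J(3) QF by blast
      then obtain H l where H: "(H, l) \<in> J" "Q = QP (H, l)" by auto
      have "pattern N 1 \<phi> H l y"
      proof (rule pattern_antimono[OF y(2)])
        show "H \<subseteq> G" using H(1) unfolding G_def by force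
        show "l \<le> k" unfolding k_def by (rule Max_ge) (use J(1) H(1) in force)+
      qed
      then show ?thesis by (simp add: H(2) QP_def c_def)
    next
      case False
      then obtain b where "b \<in> carrier N" "Q = QB b" using F_sub QF by blast
      then show ?thesis by (simp add: QB_def c_def)
    qed
    ultimately show ?thesis by blast
  qed
  then obtain U and q :: "('b + 'k \<times> nat \<times> nat, 'b + 'f + 'r + 'k + nat, 'f, 'r) nm
      \<Rightarrow> ('b + 'f + 'r + 'k + nat) set" where nm: "nm_structure L N U q"
    and Q: "\<forall>Q\<in>QB ` carrier N \<union> QP ` I. {e. Q (e \<circ> V)} \<in> U"
    by (rule nm_structure_exists[OF N inj])
  interpret nm_structure L N U q by (rule nm)
  have QB: "{e. e (V (Inl b)) = b} \<in> U" if "b \<in> carrier N" for b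
    using bspec[OF Q, of "QB b"] that by (simp add: QB_def)
  have QP: "{e. pattern N 1 \<phi> F k (\<lambda>\<alpha> i l. e (V (Inr (\<alpha>, i, l))))} \<in> U"
    if "finite F" "F \<subseteq> Field \<kappa>" for F k
    using bspec[OF Q, of "QP (F, k)"] that by (simp add: QP_def I_def)
  have "elementary_embedding L N K (\<lambda>b. q (V (Inl b)))"
    unfolding elementary_embedding_def
  proof (intro conjI allI impI)
    show "(\<lambda>b. q (V (Inl b))) ` carrier N \<subseteq> carrier K" by (auto simp: carrier_K)
    fix m \<psi> as assume "fm_in L m \<psi> \<and> as \<in> tuples (carrier N) m"
    then have \<psi>: "fm_in L m \<psi>" and as: "as \<in> tuples (carrier N) m" by auto
    have "map (\<lambda>b. q (V (Inl b))) as = map q (map (\<lambda>b. V (Inl b)) as)" by simp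
    then have "holds K \<psi> (map (\<lambda>b. q (V (Inl b))) as) \<longleftrightarrow>
        {e. holds N \<psi> (map e (map (\<lambda>b. V (Inl b)) as))} \<in> U"
      using holds_K[of "map (\<lambda>b. V (Inl b)) as" \<psi>] \<psi> as by (simp add: tuples_def comp_def)
    also have "\<dots> \<longleftrightarrow> {e. holds N \<psi> as} \<in> U"
    proof (rule ultra_cong[OF U])
      show "(\<Inter>b\<in>set as. {e. e (V (Inl b)) = b}) \<in> U"
        by (rule ultra_INT[OF U]) (use as QB in \<open>auto simp: tuples_def\<close>)
      fix e assume "e \<in> (\<Inter>b\<in>set as. {e. e (V (Inl b)) = b})"
      then have "map e (map (\<lambda>b. V (Inl b)) as) = as" by (auto intro: map_idI)
      then show "e \<in> {e. holds N \<psi> (map e (map (\<lambda>b. V (Inl b)) as))} \<longleftrightarrow> e \<in> {e. holds N \<psi> as}"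
        by (simp del: map_map)
    qed
    also have "\<dots> \<longleftrightarrow> holds N \<psi> as" by (rule const_U)
    finally show "holds N \<psi> as \<longleftrightarrow> holds K \<psi> (map (\<lambda>b. q (V (Inl b))) as)" ..
  qed
  moreover have "saturated L K (cardSuc (\<kappa> +c natLeq))"
  proof (rule saturated_K)
    fix A and p :: "(('f, 'r) fm \<times> ('b + 'f + 'r + 'k + nat) set list) set"
    assume A: "|A| <o cardSuc (\<kappa> +c natLeq)" and p: "p \<subseteq> {(\<phi>, bs). set bs \<subseteq> A}" "p \<noteq> {}"
    have "|A| \<le>o \<kappa> +c natLeq"
      using A cardSuc_ordLeq_ordLess[OF Card_order_csum card_of_Card_order] by blast
    also have "\<kappa> +c natLeq \<le>o |UNIV :: ('b + 'f + 'r + 'k + nat) set|"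
    proof -
      have "inj_on (\<lambda>z. case z of Inl \<alpha> \<Rightarrow> ?k \<alpha> | Inr i \<Rightarrow> ?n i) (Field \<kappa> <+> Field natLeq)"
        by (auto intro!: inj_onI split: sum.splits)
      then show ?thesis unfolding csum_def using card_of_ordLeq by blast
    qed
    finally have le: "|A| \<le>o |UNIV :: ('b + 'f + 'r + 'k + nat) set|" .
    from card_of_ordLeq[THEN iffD2, OF le]
    obtain ia :: "_ \<Rightarrow> 'b + 'f + 'r + 'k + nat" where ia: "inj_on ia A" by blast
    \<comment> \<open>As \<open>A\<close> embeds into the sum type, so does the set of formulas with
      parameters in \<open>A\<close>; hence the sum type enumerates \<open>p\<close>.\<close>
    have "inj_on (\<lambda>(\<psi>, bs). pr (cd.fcode \<psi>) (cd.lcode (map ia bs))) p"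
    proof (rule inj_onI, clarify)
      fix \<psi> bs \<psi>' bs'
      assume mem: "(\<psi>, bs) \<in> p" "(\<psi>', bs') \<in> p"
        and eq: "pr (cd.fcode \<psi>) (cd.lcode (map ia bs)) = pr (cd.fcode \<psi>') (cd.lcode (map ia bs'))"
      then have "inj_on ia (set bs \<union> set bs')" using p(1) ia by (auto intro: inj_on_subset)
      then show "\<psi> = \<psi>' \<and> bs = bs'" using eq by (simp add: inj_on_map_eq_map)
    qed
    then have "|p| \<le>o |UNIV :: ('b + 'f + 'r + 'k + nat) set|" by (rule card_of_ordLeqI) simp
    then show "\<exists>h :: 'b + 'f + 'r + 'k + nat \<Rightarrow> _. range h = p"
      by (rule card_of_ordLeq2[OF p(2), THEN iffD2])
  qed
  moreover have "ird_array L K \<kappa>"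
    unfolding ird_array_def
  proof (intro exI conjI ballI allI)
    let ?b = "\<lambda>\<alpha> i. map q (map (\<lambda>l. V (Inr (\<alpha>, i, l))) [0..<m \<alpha>])"
    fix \<alpha> assume "\<alpha> \<in> Field \<kappa>"
    then show "fm_in L (1 + m \<alpha>) (\<phi> \<alpha>)" using wf m by (simp add: fm_in_def)
    show "?b \<alpha> i \<in> tuples (carrier K) (m \<alpha>)" for i by (auto simp: tuples_def carrier_K)
  next
    let ?b = "\<lambda>\<alpha> i. map q (map (\<lambda>l. V (Inr (\<alpha>, i, l))) [0..<m \<alpha>])"
    fix g :: "'k \<Rightarrow> nat"
    have "inj (\<lambda>(\<alpha>, i). pr (?k \<alpha>) (?n i))" by (auto intro!: injI simp: pr)
    then obtain dec :: "'b + 'f + 'r + 'k + nat \<Rightarrow> 'k \<times> nat" where dec: "surj dec"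
      using inj_imp_surj_inv by blast
    \<comment> \<open>Decoding \<open>j\<close> as a pair (\<alpha>, i) makes all conditions on the
      element for \<open>g\<close> into one type with the index type of \<open>Wit\<close>. Pairs
      outside the field of \<kappa> contribute a trivial formula.\<close>
    define al ix where "al j = fst (dec j)" and "ix j = snd (dec j)" for j
    define \<psi> where "\<psi> j = (if al j \<in> Field \<kappa> then if g (al j) < ix j then \<phi> (al j) else Neg (\<phi> (al j))
      else Eq (Var 0) (Var 0))" for j
    define s where "s j = map (\<lambda>l. V (Inr (al j, ix j, l)) ::
        ('b + 'k \<times> nat \<times> nat, 'b + 'f + 'r + 'k + nat, 'f, 'r) nm) [0..<m (al j)]" for j
    have "\<exists>a\<in>carrier K. \<forall>j. holds K (\<psi> j) (a # map q (s j))"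
    proof (rule realize_K)
      show "fm_in L (1 + length (s j)) (\<psi> j)" for j
        using wf m[of "al j"] by (auto simp: \<psi>_def s_def fm_in_def)
    next
      fix J :: "('b + 'f + 'r + 'k + nat) set" assume J: "finite J"
      define F where "F = al ` J \<inter> Field \<kappa>"
      define k where "k = Suc (Max (insert 0 (ix ` J)))"
      have k: "ix j < k" if "j \<in> J" for j using J that by (simp add: k_def less_Suc_eq_le)
      have "finite F" "F \<subseteq> Field \<kappa>" using J by (auto simp: F_def)
      from QP[OF this, of k]
      show "{e. \<exists>x\<in>carrier N. \<forall>j\<in>J. holds N (\<psi> j) (x # map e (s j))} \<in> U"
      proof (rule ultra_mono[OF U], intro subsetI)
        fix e :: "('b + 'k \<times> nat \<times> nat, 'b + 'f + 'r + 'k + nat, 'f, 'r) nm \<Rightarrow> 'b"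
        assume "e \<in> {e. pattern N 1 \<phi> F k (\<lambda>\<alpha> i l. e (V (Inr (\<alpha>, i, l))))}"
        then have pe: "pattern N 1 \<phi> F k (\<lambda>\<alpha> i l. e (V (Inr (\<alpha>, i, l))))" by simp
        from patternD[OF pe, of g] obtain x where x: "range x \<subseteq> carrier N"
          "\<forall>\<alpha>\<in>F. \<forall>i<k. sat N (env 1 x (\<lambda>l. e (V (Inr (\<alpha>, i, l))))) (\<phi> \<alpha>) \<longleftrightarrow> g \<alpha> < i"
          by (elim exE conjE)
        have "holds N (\<psi> j) (x 0 # map e (s j))" if "j \<in> J" for j
        proof (cases "al j \<in> Field \<kappa>")
          case True
          have "holds N (\<phi> (al j)) (x 0 # map e (s j)) \<longleftrightarrow>
              sat N (env 1 x (\<lambda>l. e (V (Inr (al j, ix j, l))))) (\<phi> (al j))"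
            unfolding holds_def
          proof (rule sat_cong)
            fix v assume "v \<in> fv (\<phi> (al j))"
            then have "v < 1 + m (al j)" using m by auto
            then show "(x 0 # map e (s j)) ! v = env 1 x (\<lambda>l. e (V (Inr (al j, ix j, l)))) v"
              by (cases v) (auto simp: env_def s_def)
          qed
          also have "\<dots> \<longleftrightarrow> g (al j) < ix j" using x(2) k[OF that] True that by (auto simp: F_def)
          finally show ?thesis using True by (auto simp: \<psi>_def holds_def)
        qed (simp add: \<psi>_def holds_def)
        then show "e \<in> {e. \<exists>x\<in>carrier N. \<forall>j\<in>J. holds N (\<psi> j) (x # map e (s j))}"
          using x(1) by blast
      qed
    qed
    then obtain a where a: "a \<in> carrier K" "\<And>j. holds K (\<psi> j) (a # map q (s j))" by blast
    have "holds K (\<phi> \<alpha>) (a # ?b \<alpha> i) \<longleftrightarrow> g \<alpha> < i" if "\<alpha> \<in> Field \<kappa>" for \<alpha> i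
    proof -
      obtain j where "dec j = (\<alpha>, i)" using dec by (metis surjD)
      then have "al j = \<alpha>" "ix j = i" by (simp_all add: al_def ix_def)
      then show ?thesis using a(2)[of j] that by (auto simp: \<psi>_def s_def holds_def split: if_splits)
    qed
    then show "\<exists>a\<in>carrier K. \<forall>\<alpha>\<in>Field \<kappa>. \<forall>i. holds K (\<phi> \<alpha>) (a # ?b \<alpha> i) \<longleftrightarrow> g \<alpha> < i"
      using a(1) by blast
  qed
  ultimately show ?thesis unfolding opd_ge_def using is_struct_K by blast
qed

section \<open>Indiscernible patterns\<close>

text \<open>A configuration consists of a tuple \<open>X\<close> and, for each index \<open>\<alpha>\<close>, a sequence of parameter tuples
  \<open>Y \<alpha> i\<close> indexed by the integers, with the negative ones to the left of the cut made by \<open>X\<close>.\<close>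

datatype 'k cvar = X nat | Y 'k int nat

primrec rv :: "('k \<Rightarrow> int \<Rightarrow> int) \<Rightarrow> 'k cvar \<Rightarrow> 'k cvar" where
  "rv \<sigma> (X j) = X j"
| "rv \<sigma> (Y \<alpha> i l) = Y \<alpha> (\<sigma> \<alpha> i) l"

definition cut_preserving :: "('k \<Rightarrow> int \<Rightarrow> int) \<Rightarrow> bool" where
  "cut_preserving \<sigma> \<longleftrightarrow> (\<forall>\<alpha> i. \<sigma> \<alpha> i < 0 \<longleftrightarrow> i < 0)"

definition sup_on :: "'b set \<Rightarrow> (('k cvar \<Rightarrow> 'b) \<Rightarrow> bool) \<Rightarrow> 'k set \<Rightarrow> nat \<Rightarrow> bool" where
  "sup_on B \<rho> F m \<longleftrightarrow> (\<forall>c c'. range c \<subseteq> B \<longrightarrow> range c' \<subseteq> B \<longrightarrow> (\<forall>j. c (X j) = c' (X j)) \<longrightarrow>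
     (\<forall>\<alpha>\<in>F. \<forall>i l. - int m \<le> i \<longrightarrow> i < int m \<longrightarrow> c (Y \<alpha> i l) = c' (Y \<alpha> i l)) \<longrightarrow> (\<rho> c \<longleftrightarrow> \<rho> c'))"

text \<open>For properties without the tuple, every increasing reindexing will be allowed, which is
  mutual indiscernibility of the sequences. Properties of the tuple are only required to be
  invariant under reindexings that respect the cuts.\<close>

definition X_free :: "'b set \<Rightarrow> (('k cvar \<Rightarrow> 'b) \<Rightarrow> bool) \<Rightarrow> bool" where
  "X_free B \<rho> \<longleftrightarrow> (\<forall>c c'. range c \<subseteq> B \<longrightarrow> range c' \<subseteq> B \<longrightarrow>
     (\<forall>\<alpha> i l. c (Y \<alpha> i l) = c' (Y \<alpha> i l)) \<longrightarrow> (\<rho> c \<longleftrightarrow> \<rho> c'))"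

lemma sup_on_mono: "sup_on B \<rho> F m \<Longrightarrow> F \<subseteq> F' \<Longrightarrow> m \<le> m' \<Longrightarrow> sup_on B \<rho> F' m'"
  unfolding sup_on_def
proof (intro allI impI)
  fix c c' :: "'b cvar \<Rightarrow> 'a"
  assume 1: "\<forall>c c'. range c \<subseteq> B \<longrightarrow> range c' \<subseteq> B \<longrightarrow> (\<forall>j. c (X j) = c' (X j)) \<longrightarrow>
     (\<forall>\<alpha>\<in>F. \<forall>i l. - int m \<le> i \<longrightarrow> i < int m \<longrightarrow> c (Y \<alpha> i l) = c' (Y \<alpha> i l)) \<longrightarrow> \<rho> c = \<rho> c'"
    and 2: "F \<subseteq> F'" "m \<le> m'" "range c \<subseteq> B" "range c' \<subseteq> B" "\<forall>j. c (X j) = c' (X j)"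
    and 3: "\<forall>\<alpha>\<in>F'. \<forall>i l. - int m' \<le> i \<longrightarrow> i < int m' \<longrightarrow> c (Y \<alpha> i l) = c' (Y \<alpha> i l)"
  have "\<forall>\<alpha>\<in>F. \<forall>i l. - int m \<le> i \<longrightarrow> i < int m \<longrightarrow> c (Y \<alpha> i l) = c' (Y \<alpha> i l)"
    using 2(1,2) 3 by auto
  from 1[rule_format, OF 2(3,4) 2(5)[rule_format] this[rule_format]] show "\<rho> c = \<rho> c'" .
qed

lemma sorted_list_of_strict_mono_image:
  fixes f :: "nat \<Rightarrow> nat"
  assumes "strict_mono_on {..<r} f"
  shows "sorted_list_of_set (f ` {..<r}) = map f [0..<r]"
proof -
  have "sorted_wrt (<) (map f [0..<r])"
    using assms by (auto simp: sorted_wrt_iff_nth_less strict_mono_on_def)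
  moreover have "length (map f [0..<r]) = card (f ` {..<r})"
    using strict_mono_on_imp_inj_on[OF assms] by (simp add: card_image)
  moreover have "set (map f [0..<r]) = f ` {..<r}" by auto
  ultimately show ?thesis using sorted_list_of_set_unique[of "f ` {..<r}" "map f [0..<r]"] by simp
qed

text \<open>The product Ramsey theorem needed here follows from the usual one: a homogeneous set of size
  \<open>d * W\<close> is cut into \<open>d\<close> consecutive blocks of length \<open>W\<close>. In block \<open>a\<close>, the number \<open>pos a u\<close> is the
  place of the \<open>u\<close>-th selected element.\<close>

lemma block_strict_mono:
  fixes pos :: "nat \<Rightarrow> nat \<Rightarrow> nat"
  assumes mono: "\<And>a u u'. a < d \<Longrightarrow> u < u' \<Longrightarrow> u' < w \<Longrightarrow> pos a u < pos a u'"
    and bound: "\<And>a u. a < d \<Longrightarrow> u < w \<Longrightarrow> pos a u < W"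
  shows "strict_mono_on {..<d * w} (\<lambda>p. (p div w) * W + pos (p div w) (p mod w))"
    and "\<And>p. p < d * w \<Longrightarrow> (p div w) * W + pos (p div w) (p mod w) < d * W"
proof -
  have lt: "p div w < d" "p mod w < w" if "p < d * w" for p
  proof -
    have "w > 0" using that by (cases w) auto
    then show "p div w < d" "p mod w < w" using that by (simp_all add: less_mult_imp_div_less)
  qed
  have blk: "a * W + pos a u < b * W" if "a < b" "a < d" "u < w" for a b u
  proof -
    have "a * W + pos a u < Suc a * W" using bound[OF that(2,3)] by simp
    also have "\<dots> \<le> b * W" using that(1) by (intro mult_le_mono1) simp
    finally show ?thesis .
  qed
  show "(p div w) * W + pos (p div w) (p mod w) < d * W" if "p < d * w" for p
    using blk lt[OF that] by blast
  show "strict_mono_on {..<d * w} (\<lambda>p. (p div w) * W + pos (p div w) (p mod w))"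
  proof (rule strict_mono_onI)
    fix p p' assume p: "p \<in> {..<d * w}" "p' \<in> {..<d * w}" "p < p'"
    show "(p div w) * W + pos (p div w) (p mod w) < (p' div w) * W + pos (p' div w) (p' mod w)"
    proof (cases "p div w = p' div w")
      case True
      then have "p mod w < p' mod w" using p(3) by (metis div_mult_mod_eq nat_add_left_cancel_less)
      then show ?thesis using mono[of "p div w" "p mod w" "p' mod w"] lt p True by simp
    next
      case False
      then have "p div w < p' div w" using p(3) div_le_mono[of p p' w] by linarith
      then show ?thesis using blk[of "p div w" "p' div w" "p mod w"] lt p by fastforce
    qed
  qed
qed

text \<open>The colours are subsets of \<open>D\<close>, which treats finitely many properties at
  once. The bound \<open>k\<close> precedes the colouring because the colouring will be defined from
  a pattern of length \<open>k\<close>.\<close>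

lemma homogeneous_set:
  fixes D :: "'c set" and r s :: nat
  assumes "finite D"
  shows "\<exists>k. \<forall>C. (\<forall>S. C S \<subseteq> D) \<longrightarrow> (\<exists>h :: nat \<Rightarrow> nat. strict_mono_on {..<s} h \<and> h ` {..<s} \<subseteq> {..<k} \<and>
    (\<forall>P P'. strict_mono_on {..<r} P \<longrightarrow> P ` {..<r} \<subseteq> {..<s} \<longrightarrow>
      strict_mono_on {..<r} P' \<longrightarrow> P' ` {..<r} \<subseteq> {..<s} \<longrightarrow>
      C ((h \<circ> P) ` {..<r}) = C ((h \<circ> P') ` {..<r})))"
proof -
  obtain e where e: "bij_betw e (Pow D) {0..<card (Pow D)}"
    using ex_bij_betw_finite_nat[of "Pow D"] assms by auto
  let ?qs = "replicate (card (Pow D)) s"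
  from ramsey_full[of ?qs r] obtain k :: nat where k: "partn_lst {..<k} ?qs r" ..
  show ?thesis
  proof (intro exI[of _ k] allI impI)
    fix C :: "nat set \<Rightarrow> 'c set"
    assume C: "\<forall>S. C S \<subseteq> D"
    have "(e \<circ> C) \<in> nsets {..<k} r \<rightarrow> {..<length ?qs}"
      using C bij_betwE[OF e] by auto
    then obtain i where "i < length ?qs" "monochromatic {..<k} (?qs ! i) r (e \<circ> C) i"
      using k unfolding partn_lst_def by blast
    then obtain H where H: "H \<in> nsets {..<k} s" "(e \<circ> C) ` nsets H r \<subseteq> {i}"
      unfolding monochromatic_def by auto
    define h where "h q = sorted_list_of_set H ! q" for q
    have Hf: "finite H" "card H = s" "H \<subseteq> {..<k}" using H(1) by (auto simp: nsets_def)
    have mono: "strict_mono_on {..<s} h"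
      unfolding h_def
      by (rule strict_mono_onI) (use Hf in \<open>simp add: sorted_wrt_nth_less[OF strict_sorted_list_of_set]\<close>)
    have hH: "h q \<in> H" if "q < s" for q
      using that Hf nth_mem[of q "sorted_list_of_set H"] by (simp add: h_def)
    have col: "e (C ((h \<circ> P) ` {..<r})) = i"
      if P: "strict_mono_on {..<r} P" "P ` {..<r} \<subseteq> {..<s}" for P
    proof -
      have "inj_on (h \<circ> P) {..<r}"
        using strict_mono_on_imp_inj_on[OF mono] strict_mono_on_imp_inj_on[OF P(1)] P(2)
        by (meson comp_inj_on inj_on_subset)
      then have "(h \<circ> P) ` {..<r} \<in> nsets H r"
        using P(2) hH card_image[of "h \<circ> P" "{..<r}"] by (auto simp: nsets_def)
      then show ?thesis using H(2) by auto
    qed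
    have "C ((h \<circ> P) ` {..<r}) = C ((h \<circ> P') ` {..<r})"
      if "strict_mono_on {..<r} P" "P ` {..<r} \<subseteq> {..<s}" "strict_mono_on {..<r} P'" "P' ` {..<r} \<subseteq> {..<s}"
      for P P'
    proof -
      have "e (C ((h \<circ> P) ` {..<r})) = e (C ((h \<circ> P') ` {..<r}))" using col that by simp
      then show ?thesis using bij_betw_imp_inj_on[OF e] C by (meson PowI inj_onD)
    qed
    moreover have "h ` {..<s} \<subseteq> {..<k}" using hH Hf(3) by auto
    ultimately show "\<exists>h. strict_mono_on {..<s} h \<and> h ` {..<s} \<subseteq> {..<k} \<and>
      (\<forall>P P'. strict_mono_on {..<r} P \<longrightarrow> P ` {..<r} \<subseteq> {..<s} \<longrightarrow>
        strict_mono_on {..<r} P' \<longrightarrow> P' ` {..<r} \<subseteq> {..<s} \<longrightarrow>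
        C ((h \<circ> P) ` {..<r}) = C ((h \<circ> P') ` {..<r}))" using mono by blast
  qed
qed

definition base :: "('b, 'f, 'r) fo_struct \<Rightarrow> nat \<Rightarrow> ('k \<Rightarrow> ('f, 'r) fm) \<Rightarrow> 'k \<Rightarrow> int \<Rightarrow> ('k cvar \<Rightarrow> 'b) \<Rightarrow> bool" where
  "base N n \<phi> \<alpha> i c \<longleftrightarrow> sat N (env n (\<lambda>j. c (X j)) (\<lambda>l. c (Y \<alpha> i l))) (\<phi> \<alpha>)"

text \<open>A set of \<open>r\<close> places in a long pattern determines a window of each sequence,
  a cut in each, and through the cuts also a tuple. It is coloured by the properties in \<Delta>
  that hold there. A reindexing selects other places of the homogeneous set, so it preserves these
  properties.\<close>

lemma indiscernible_config:
  fixes N :: "('b, 'f, 'r) fo_struct" and F :: "'k set"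
  assumes pat: "\<forall>k. \<exists>y. (\<forall>\<alpha> i. range (y \<alpha> i) \<subseteq> carrier N) \<and> pattern N n \<phi> F k y"
    and F: "finite F" and \<Delta>: "finite \<Delta>"
    and adm: "\<And>\<rho> \<sigma>. (\<rho>, \<sigma>) \<in> \<Delta> \<Longrightarrow> sup_on (carrier N) \<rho> F m \<and> (\<forall>\<alpha>. strict_mono (\<sigma> \<alpha>)) \<and>
      (cut_preserving \<sigma> \<or> X_free (carrier N) \<rho>)"
    and d0: "d0 \<in> carrier N"
  shows "\<exists>c. range c \<subseteq> carrier N \<and>
    (\<forall>\<alpha>\<in>F. \<forall>i. - int m \<le> i \<longrightarrow> i < int m \<longrightarrow> (base N n \<phi> \<alpha> i c \<longleftrightarrow> 0 \<le> i)) \<and>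
    (\<forall>(\<rho>, \<sigma>)\<in>\<Delta>. \<rho> c \<longleftrightarrow> \<rho> (c \<circ> rv \<sigma>))"
proof -
  let ?B = "carrier N"
  define d where "d = card F"
  obtain el where el: "bij_betw el {0..<d} F" using ex_bij_betw_nat_finite[OF F] unfolding d_def by blast
  define idx where "idx = inv_into {0..<d} el"
  have idx: "idx \<alpha> < d" "el (idx \<alpha>) = \<alpha>" if "\<alpha> \<in> F" for \<alpha>
    using that el unfolding idx_def
    by (metis atLeastLessThan_iff bij_betw_imp_surj_on inv_into_into, metis bij_betw_inv_into_right)
  have el_F: "el a \<in> F" if "a < d" for a using bij_betwE[OF el] that by auto
  \<comment> \<open>In each block, \<open>2 * m\<close> places for the window and one for the
    cut.\<close>
  define w where "w = 2 * m + 1"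
  define r where "r = d * w"
  have "finite ((\<lambda>((\<rho>, \<sigma>), \<alpha>, i). nat \<bar>\<sigma> \<alpha> i\<bar>) ` (\<Delta> \<times> F \<times> {- int m - 1..int m}))"
    using F \<Delta> by simp
  then obtain M0 where M0: "\<forall>z\<in>(\<lambda>((\<rho>, \<sigma>), \<alpha>, i). nat \<bar>\<sigma> \<alpha> i\<bar>) ` (\<Delta> \<times> F \<times> {- int m - 1..int m}). z \<le> M0"
    using finite_nat_set_iff_bounded_le by blast
  \<comment> \<open>A strict bound for all reindexed positions. The range from
    \<open>- m - 1\<close> to \<open>m\<close> contains -1 and 0 even when \<open>m\<close> is
    0.\<close>
  define M where "M = int (M0 + m + 2)"
  define W where "W = 2 * nat (2 * M)"
  have M: "M \<ge> int m + 2" by (simp add: M_def)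
  have M\<Delta>: "\<bar>\<sigma> \<alpha> i\<bar> < M" if "(\<rho>, \<sigma>) \<in> \<Delta>" "\<alpha> \<in> F" "- int m - 1 \<le> i" "i \<le> int m" for \<rho> \<sigma> \<alpha> i
  proof -
    have "nat \<bar>\<sigma> \<alpha> i\<bar> \<in> (\<lambda>((\<rho>, \<sigma>), \<alpha>, i). nat \<bar>\<sigma> \<alpha> i\<bar>) ` (\<Delta> \<times> F \<times> {- int m - 1..int m})"
      using that by force
    then have "nat \<bar>\<sigma> \<alpha> i\<bar> \<le> M0" using M0 by blast
    then show ?thesis by (simp add: M_def)
  qed
  \<comment> \<open>Index \<open>i\<close> sits at the even place \<open>2 * (i + M)\<close> of its
    block. A cut just before index \<open>t\<close> takes the odd place preceding that of
    \<open>t\<close>, so it never collides with an element. The middle value \<open>u = m\<close>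
    belongs to the cut.\<close>
  define Pos where "Pos \<sigma> t a u =
    (if u < m then 2 * nat (\<sigma> (el a) (int u - int m) + M)
     else if u = m then 2 * nat (t (el a) + M) - 1
     else 2 * nat (\<sigma> (el a) (int u - 1 - int m) + M))" for \<sigma> :: "'k \<Rightarrow> int \<Rightarrow> int" and t a u
  define ok where "ok \<sigma> t \<longleftrightarrow> (\<forall>\<alpha>\<in>F. strict_mono (\<sigma> \<alpha>) \<and> \<sigma> \<alpha> (- 1) < t \<alpha> \<and> t \<alpha> \<le> \<sigma> \<alpha> 0 \<and>
    (\<forall>i. - int m - 1 \<le> i \<longrightarrow> i \<le> int m \<longrightarrow> \<bar>\<sigma> \<alpha> i\<bar> < M))" for \<sigma> :: "'k \<Rightarrow> int \<Rightarrow> int" and t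
  define P where "P \<sigma> t p = (p div w) * W + Pos \<sigma> t (p div w) (p mod w)" for \<sigma> t p
  have P: "strict_mono_on {..<r} (P \<sigma> t)" "P \<sigma> t ` {..<r} \<subseteq> {..<d * W}" if "ok \<sigma> t" for \<sigma> t
  proof -
    have mono: "Pos \<sigma> t a u < Pos \<sigma> t a u'" if "a < d" "u < u'" "u' < w" for a u u'
    proof -
      let ?s = "\<sigma> (el a)" and ?t = "t (el a)"
      have s0: "strict_mono ?s" "?s (- 1) < ?t" "?t \<le> ?s 0"
        and bnd: "\<And>i. - int m - 1 \<le> i \<Longrightarrow> i \<le> int m \<Longrightarrow> \<bar>?s i\<bar> < M"
        using \<open>ok \<sigma> t\<close> el_F[OF that(1)] unfolding ok_def by auto
      have s: "strict_mono ?s" "?s (- 1) < ?t" "?t \<le> ?s 0" "- M < ?s (- 1)"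
        and lo: "- M < ?s (int u - int m)"
        using s0 bnd[of "- 1"] bnd[of "int u - int m"] that(2,3) by (auto simp: w_def)
      consider "u' < m" | "u < m" "u' = m" | "u < m" "m < u'" | "u = m" "m < u'" | "m < u"
        using \<open>u < u'\<close> by linarith
      then show ?thesis
      proof cases
        case 1
        then have "?s (int u - int m) < ?s (int u' - int m)" using that by (intro strict_monoD[OF s(1)]) simp
        then show ?thesis using 1 that lo by (simp add: Pos_def)
      next
        case 2
        then have "?s (int u - int m) \<le> ?s (- 1)" using strict_mono_less_eq[OF s(1)] by simp
        then show ?thesis using 2 s lo by (simp add: Pos_def)
      next
        case 3
        then have "?s (int u - int m) < ?s (int u' - 1 - int m)" by (intro strict_monoD[OF s(1)]) simp
        then show ?thesis using 3 that lo by (simp add: Pos_def)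
      next
        case 4
        then have "?s 0 \<le> ?s (int u' - 1 - int m)" using strict_mono_less_eq[OF s(1)] by simp
        then show ?thesis using 4 s by (simp add: Pos_def)
      next
        case 5
        then have "?s (int u - 1 - int m) < ?s (int u' - 1 - int m)"
          using that by (intro strict_monoD[OF s(1)]) simp
        moreover have "?s (- 1) < ?s (int u - 1 - int m)" using 5 by (intro strict_monoD[OF s(1)]) simp
        ultimately show ?thesis using 5 that s by (simp add: Pos_def)
      qed
    qed
    have bound: "Pos \<sigma> t a u < W" if "a < d" "u < w" for a u
    proof -
      let ?s = "\<sigma> (el a)" and ?t = "t (el a)"
      have *: "?t \<le> ?s 0" "?s 0 < M" "\<forall>i. - int m - 1 \<le> i \<longrightarrow> i \<le> int m \<longrightarrow> ?s i < M"
        using \<open>ok \<sigma> t\<close> el_F[OF that(1)] unfolding ok_def by (auto simp: abs_less_iff)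
      have "?t < M" using * by linarith
      moreover have "u < m \<Longrightarrow> ?s (int u - int m) < M" "m < u \<Longrightarrow> ?s (int u - 1 - int m) < M"
        using *(3) that(2) by (auto simp: w_def)
      moreover have "2 * nat (x + M) < W" if "x < M" for x
        using that M unfolding W_def by (simp add: nat_less_eq_zless)
      ultimately show ?thesis
        unfolding Pos_def by (cases u m rule: linorder_cases) (auto intro: le_less_trans[OF diff_le_self])
    qed
    show "strict_mono_on {..<r} (P \<sigma> t)"
      unfolding P_def r_def by (rule block_strict_mono(1)[where d = d and W = W]) (use mono bound in auto)
    show "P \<sigma> t ` {..<r} \<subseteq> {..<d * W}"
      unfolding P_def r_def using block_strict_mono(2)[where d = d and W = W and w = w and pos = "Pos \<sigma> t"] mono bound
      by auto
  qed
  have P_at: "P \<sigma> t (idx \<alpha> * w + u) = idx \<alpha> * W + Pos \<sigma> t (idx \<alpha>) u" if "u < w" for \<sigma> t \<alpha> u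
    using that by (simp add: P_def)
  have at_r: "idx \<alpha> * w + u < r" if "\<alpha> \<in> F" "u < w" for \<alpha> u
  proof -
    have "idx \<alpha> * w + u < Suc (idx \<alpha>) * w" using that by simp
    also have "\<dots> \<le> d * w" using idx(1)[OF that(1)] by (intro mult_le_mono1) simp
    finally show ?thesis by (simp add: r_def)
  qed
  define gq where "gq p \<alpha> = (if \<alpha> \<in> F then p (idx \<alpha> * w + m) else 0)" for p :: "nat \<Rightarrow> nat" and \<alpha>
  \<comment> \<open>From index 0 on, the place of the cut is skipped.\<close>
  define up where "up i = nat (i + int m) + (if i \<ge> 0 then 1 else 0)" for i
  have up: "up i < w" if "- int m \<le> i" "i < int m" for i using that by (auto simp: up_def w_def)
  define cf where "cf a y p v = (case v of X j \<Rightarrow> a (gq p) j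
     | Y \<alpha> i l \<Rightarrow> if \<alpha> \<in> F \<and> - int m \<le> i \<and> i < int m then y \<alpha> (p (idx \<alpha> * w + up i)) l else d0)"
    for a :: "('k \<Rightarrow> nat) \<Rightarrow> nat \<Rightarrow> 'b" and y :: "'k \<Rightarrow> nat \<Rightarrow> nat \<Rightarrow> 'b" and p v
  have cf_cong: "cf a y p = cf a y p'" if "\<And>q. q < r \<Longrightarrow> p q = p' q" for a y p p'
  proof -
    have gq: "gq p = gq p'" using that at_r by (auto simp: gq_def w_def)
    have "cf a y p v = cf a y p' v" for v
      unfolding cf_def gq using that at_r up by (auto split: cvar.splits)
    then show ?thesis by blast
  qed
  have "finite (fst ` \<Delta>)" using \<Delta> by simp
  from homogeneous_set[OF this, of "d * W" r] obtain k where k: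
    "\<forall>C. (\<forall>S. C S \<subseteq> fst ` \<Delta>) \<longrightarrow> (\<exists>h :: nat \<Rightarrow> nat. strict_mono_on {..<d * W} h \<and>
      h ` {..<d * W} \<subseteq> {..<k} \<and>
      (\<forall>P P'. strict_mono_on {..<r} P \<longrightarrow> P ` {..<r} \<subseteq> {..<d * W} \<longrightarrow>
        strict_mono_on {..<r} P' \<longrightarrow> P' ` {..<r} \<subseteq> {..<d * W} \<longrightarrow>
        C ((h \<circ> P) ` {..<r}) = C ((h \<circ> P') ` {..<r})))" ..
  from spec[OF pat, of k] obtain y where y: "\<forall>\<alpha> i. range (y \<alpha> i) \<subseteq> ?B" "pattern N n \<phi> F k y"
    by (elim exE conjE)
  from y(2) have "\<forall>g. \<exists>x. range x \<subseteq> ?B \<and>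
     (\<forall>\<alpha>\<in>F. \<forall>i<k. sat N (env n x (y \<alpha> i)) (\<phi> \<alpha>) \<longleftrightarrow> g \<alpha> < i)" unfolding pattern_def .
  \<comment> \<open>Choosing one realization per cut function makes the tuple, too, a function of
    the selected places, so that it takes part in the colouring.\<close>
  from choice[OF this] obtain a where a: "\<forall>g. range (a g) \<subseteq> ?B \<and>
     (\<forall>\<alpha>\<in>F. \<forall>i<k. sat N (env n (a g) (y \<alpha> i)) (\<phi> \<alpha>) \<longleftrightarrow> g \<alpha> < i)" ..
  define C where "C S = {\<rho> \<in> fst ` \<Delta>. \<rho> (cf a y (\<lambda>q. sorted_list_of_set S ! q))}" for S
  have "\<forall>S. C S \<subseteq> fst ` \<Delta>" by (auto simp: C_def)
  from k[THEN spec, THEN mp, OF this] obtain h where h: "strict_mono_on {..<d * W} h"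
    "h ` {..<d * W} \<subseteq> {..<k}" and hom: "\<forall>P P'. strict_mono_on {..<r} P \<longrightarrow> P ` {..<r} \<subseteq> {..<d * W} \<longrightarrow>
        strict_mono_on {..<r} P' \<longrightarrow> P' ` {..<r} \<subseteq> {..<d * W} \<longrightarrow>
        C ((h \<circ> P) ` {..<r}) = C ((h \<circ> P') ` {..<r})" by (elim exE conjE)
  have C_h: "C ((h \<circ> P \<sigma> t) ` {..<r}) = {\<rho> \<in> fst ` \<Delta>. \<rho> (cf a y (h \<circ> P \<sigma> t))}" if "ok \<sigma> t" for \<sigma> t
  proof -
    have "strict_mono_on {..<r} (h \<circ> P \<sigma> t)"
    proof (rule strict_mono_onI)
      fix q q' assume q: "q \<in> {..<r}" "q' \<in> {..<r}" "q < q'"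
      have "P \<sigma> t q < P \<sigma> t q'" using strict_mono_onD[OF P(1)[OF that] q] .
      moreover have "P \<sigma> t q \<in> {..<d * W}" "P \<sigma> t q' \<in> {..<d * W}"
        using P(2)[OF that] q by blast+
      ultimately show "(h \<circ> P \<sigma> t) q < (h \<circ> P \<sigma> t) q'" using strict_mono_onD[OF h(1)] by simp
    qed
    from sorted_list_of_strict_mono_image[OF this]
    have "cf a y (\<lambda>q. sorted_list_of_set ((h \<circ> P \<sigma> t) ` {..<r}) ! q) = cf a y (h \<circ> P \<sigma> t)"
      by (intro cf_cong) simp
    then show ?thesis unfolding C_def by simp
  qed
  \<comment> \<open>The odd place just before the place \<open>2 * M\<close> of index 0, so that the
    cuts of \<open>c\<close> lie between -1 and 0.\<close>
  define g0 where "g0 \<alpha> = (if \<alpha> \<in> F then h (idx \<alpha> * W + (2 * nat M - 1)) else 0)" for \<alpha>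
  define c where "c v = (case v of X j \<Rightarrow> a g0 j
     | Y \<alpha> i l \<Rightarrow> if \<alpha> \<in> F \<and> - M \<le> i \<and> i < M then y \<alpha> (h (idx \<alpha> * W + 2 * nat (i + M))) l else d0)" for v
  have cB: "range c \<subseteq> ?B"
    using a y(1) d0 by (auto simp: c_def image_subset_iff split: cvar.splits)
  have cfB: "range (cf a y p) \<subseteq> ?B" for p
    using a y(1) d0 by (auto simp: cf_def image_subset_iff split: cvar.splits)
  have cf_Y: "cf a y (h \<circ> P \<sigma> t) (Y \<alpha> i l) = (c \<circ> rv \<sigma>) (Y \<alpha> i l)"
    if "ok \<sigma> t" "\<alpha> \<in> F" "- int m \<le> i" "i < int m" for \<sigma> t \<alpha> i l
  proof -
    have "Pos \<sigma> t (idx \<alpha>) (up i) = 2 * nat (\<sigma> \<alpha> i + M)"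
      using that(3,4) idx[OF that(2)] by (auto simp: Pos_def up_def)
    moreover have "\<bar>\<sigma> \<alpha> i\<bar> < M" using that unfolding ok_def by auto
    ultimately show ?thesis using that P_at[OF up[OF that(3,4)]] by (auto simp: cf_def c_def abs_less_iff)
  qed
  have cf_X: "cf a y (h \<circ> P \<sigma> t) (X j) = c (X j)" if "\<And>\<alpha>. \<alpha> \<in> F \<Longrightarrow> t \<alpha> = 0" for \<sigma> t j
  proof -
    have "gq (h \<circ> P \<sigma> t) = g0"
    proof
      fix \<alpha>
      show "gq (h \<circ> P \<sigma> t) \<alpha> = g0 \<alpha>"
        using P_at[of m \<sigma> t \<alpha>] idx[of \<alpha>] that[of \<alpha>] by (auto simp: gq_def g0_def Pos_def w_def)
    qed
    then show ?thesis by (simp add: cf_def c_def)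
  qed
  have ok_id: "ok (\<lambda>_ i. i) (\<lambda>_. 0)" using M by (auto simp: ok_def strict_mono_def)
  have base: "base N n \<phi> \<alpha> i c \<longleftrightarrow> 0 \<le> i" if "\<alpha> \<in> F" "- int m \<le> i" "i < int m" for \<alpha> i
  proof -
    have i: "- M \<le> i" "i < M" using that M by auto
    have lt: "idx \<alpha> * W + u < d * W" if "u < W" for u
    proof -
      have "idx \<alpha> * W + u < Suc (idx \<alpha>) * W" using that by simp
      also have "\<dots> \<le> d * W" using idx(1)[OF \<open>\<alpha> \<in> F\<close>] by (intro mult_le_mono1) simp
      finally show ?thesis .
    qed
    have b: "2 * nat M - 1 < W" "2 * nat (i + M) < W" using i M by (auto simp: W_def)
    have "base N n \<phi> \<alpha> i c \<longleftrightarrow> sat N (env n (a g0) (y \<alpha> (h (idx \<alpha> * W + 2 * nat (i + M))))) (\<phi> \<alpha>)"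
      using that(1) i by (simp add: base_def c_def)
    also have "\<dots> \<longleftrightarrow> g0 \<alpha> < h (idx \<alpha> * W + 2 * nat (i + M))"
      using a that(1) h(2) lt[OF b(2)] by auto
    also have "\<dots> \<longleftrightarrow> idx \<alpha> * W + (2 * nat M - 1) < idx \<alpha> * W + 2 * nat (i + M)"
      using that(1) strict_mono_on_less[OF h(1)] lt[OF b(1)] lt[OF b(2)] by (simp add: g0_def)
    also have "\<dots> \<longleftrightarrow> 0 \<le> i" using i M by auto
    finally show ?thesis .
  qed
  have hom_\<Delta>: "\<rho> c \<longleftrightarrow> \<rho> (c \<circ> rv \<sigma>)" if mem: "(\<rho>, \<sigma>) \<in> \<Delta>" for \<rho> \<sigma>
  proof -
    have sup: "sup_on ?B \<rho> F m" and mono: "\<And>\<alpha>. strict_mono (\<sigma> \<alpha>)"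
      and or: "cut_preserving \<sigma> \<or> X_free ?B \<rho>" using adm[OF mem] by auto
    have \<rho>: "\<rho> \<in> fst ` \<Delta>" using mem by force
    have cr: "range (c \<circ> rv \<sigma>) \<subseteq> ?B" using cB by auto
    \<comment> \<open>If \<sigma> respects the cuts they stay where they are, and so does the tuple.
      Otherwise they move along to just before \<open>\<sigma> \<alpha> 0\<close>; the tuple
      changes, but then \<rho> ignores it.\<close>
    define t where "t \<alpha> = (if cut_preserving \<sigma> then 0 else \<sigma> \<alpha> 0)" for \<alpha>
    have ok: "ok \<sigma> t"
      unfolding ok_def
    proof (intro ballI conjI allI impI)
      fix \<alpha> assume "\<alpha> \<in> F"
      show "strict_mono (\<sigma> \<alpha>)" by (rule mono)
      have cp: "\<sigma> \<alpha> (- 1) < 0 \<and> 0 \<le> \<sigma> \<alpha> 0" if "cut_preserving \<sigma>"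
      proof -
        have "\<sigma> \<alpha> (- 1) < 0 \<longleftrightarrow> (- 1 :: int) < 0" "\<sigma> \<alpha> 0 < 0 \<longleftrightarrow> (0 :: int) < 0"
          using that unfolding cut_preserving_def by blast+
        then show ?thesis by auto
      qed
      show "\<sigma> \<alpha> (- 1) < t \<alpha>" using cp strict_monoD[OF mono, of "- 1" 0 \<alpha>] by (auto simp: t_def)
      show "t \<alpha> \<le> \<sigma> \<alpha> 0" using cp by (auto simp: t_def)
      show "\<bar>\<sigma> \<alpha> i\<bar> < M" if "- int m - 1 \<le> i" "i \<le> int m" for i
        using M\<Delta>[OF mem \<open>\<alpha> \<in> F\<close> that] .
    qed
    have "\<rho> c \<longleftrightarrow> \<rho> (cf a y (h \<circ> P (\<lambda>_ i. i) (\<lambda>_. 0)))"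
    proof -
      have "c \<circ> rv (\<lambda>_ i. i) = c"
      proof
        fix v show "(c \<circ> rv (\<lambda>_ i. i)) v = c v" by (cases v) auto
      qed
      then have "cf a y (h \<circ> P (\<lambda>_ i. i) (\<lambda>_. 0)) (Y \<alpha> i l) = c (Y \<alpha> i l)"
        if "\<alpha> \<in> F" "- int m \<le> i" "i < int m" for \<alpha> i l
        using cf_Y[OF ok_id that] by metis
      then show ?thesis
        using sup[unfolded sup_on_def, THEN spec, THEN spec, of c "cf a y (h \<circ> P (\<lambda>_ i. i) (\<lambda>_. 0))"]
          cB cfB cf_X[of "\<lambda>_. 0"] by simp
    qed
    also have "\<dots> \<longleftrightarrow> \<rho> (cf a y (h \<circ> P \<sigma> t))"
    proof -
      have "C ((h \<circ> P (\<lambda>_ i. i) (\<lambda>_. 0)) ` {..<r}) = C ((h \<circ> P \<sigma> t) ` {..<r})"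
        using hom P[OF ok] P[OF ok_id] by blast
      then show ?thesis using \<rho> unfolding C_h[OF ok] C_h[OF ok_id] by blast
    qed
    also have "\<dots> \<longleftrightarrow> \<rho> (c \<circ> rv \<sigma>)"
    proof (cases "cut_preserving \<sigma>")
      case True
      then have "cf a y (h \<circ> P \<sigma> t) (X j) = (c \<circ> rv \<sigma>) (X j)" for j
        using cf_X[of t \<sigma> j] by (simp add: t_def)
      then show ?thesis
        using sup[unfolded sup_on_def, THEN spec, THEN spec, of "cf a y (h \<circ> P \<sigma> t)" "c \<circ> rv \<sigma>"]
          cfB cr cf_Y[OF ok] by simp
    next
      case False
      then have free: "X_free ?B \<rho>" using or by simp
      define c1 where "c1 v = (case v of X j \<Rightarrow> c (X j) | Y \<alpha> i l \<Rightarrow> cf a y (h \<circ> P \<sigma> t) v)" for v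
      have c1B: "range c1 \<subseteq> ?B" using cB cfB by (auto simp: c1_def image_subset_iff split: cvar.splits)
      have "\<rho> (cf a y (h \<circ> P \<sigma> t)) \<longleftrightarrow> \<rho> c1"
        using free[unfolded X_free_def, THEN spec, THEN spec, of "cf a y (h \<circ> P \<sigma> t)" c1] cfB c1B
        by (simp add: c1_def)
      also have "\<dots> \<longleftrightarrow> \<rho> (c \<circ> rv \<sigma>)"
        using sup[unfolded sup_on_def, THEN spec, THEN spec, of c1 "c \<circ> rv \<sigma>"]
          c1B cr cf_Y[OF ok] by (simp add: c1_def)
      finally show ?thesis .
    qed
    finally show ?thesis .
  qed
  show ?thesis using cB base hom_\<Delta> by blast
qed

text \<open>Compactness without an extension: finitely many of the required invariances hold in one
  configuration, so an ultrafilter contains all of them.\<close>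

lemma indiscernible_ultra:
  fixes N :: "('b, 'f, 'r) fo_struct" and A :: "'k set"
  assumes pat: "\<forall>F k. finite F \<and> F \<subseteq> A \<longrightarrow>
      (\<exists>y. (\<forall>\<alpha> i. range (y \<alpha> i) \<subseteq> carrier N) \<and> pattern N n \<phi> F k y)"
    and d0: "d0 \<in> carrier N"
  obtains U :: "('k cvar \<Rightarrow> 'b) set set" where "ultra U" "{c. range c \<subseteq> carrier N} \<in> U"
    "\<forall>\<alpha>\<in>A. \<forall>i. {c. base N n \<phi> \<alpha> i c \<longleftrightarrow> 0 \<le> i} \<in> U"
    "\<forall>\<rho> \<sigma> F m. finite F \<and> F \<subseteq> A \<and> sup_on (carrier N) \<rho> F m \<and> (\<forall>\<alpha>. strict_mono (\<sigma> \<alpha>)) \<and>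
      (cut_preserving \<sigma> \<or> X_free (carrier N) \<rho>) \<longrightarrow> {c. \<rho> c \<longleftrightarrow> \<rho> (c \<circ> rv \<sigma>)} \<in> U"
proof -
  let ?B = "carrier N"
  define G where "G F m \<Delta> = {c. range c \<subseteq> ?B \<and>
    (\<forall>\<alpha>\<in>F. \<forall>i. - int m \<le> i \<longrightarrow> i < int m \<longrightarrow> (base N n \<phi> \<alpha> i c \<longleftrightarrow> 0 \<le> i)) \<and>
    (\<forall>(\<rho>, \<sigma>)\<in>\<Delta>. \<rho> c \<longleftrightarrow> \<rho> (c \<circ> rv \<sigma>))}"
    for F :: "'k set" and m :: nat and \<Delta> :: "((('k cvar \<Rightarrow> 'b) \<Rightarrow> bool) \<times> ('k \<Rightarrow> int \<Rightarrow> int)) set"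
  define ok where "ok F m \<Delta> \<longleftrightarrow> finite F \<and> F \<subseteq> A \<and> finite \<Delta> \<and> (\<forall>(\<rho>, \<sigma>)\<in>\<Delta>. sup_on ?B \<rho> F m \<and>
      (\<forall>\<alpha>. strict_mono (\<sigma> \<alpha>)) \<and> (cut_preserving \<sigma> \<or> X_free ?B \<rho>))"
    for F :: "'k set" and m :: nat and \<Delta> :: "((('k cvar \<Rightarrow> 'b) \<Rightarrow> bool) \<times> ('k \<Rightarrow> int \<Rightarrow> int)) set"
  have ok_Un: "ok (F \<union> F') (max m m') (\<Delta> \<union> \<Delta>')" if "ok F m \<Delta>" "ok F' m' \<Delta>'" for F F' m m' \<Delta> \<Delta>'
  proof -
    have "sup_on ?B \<rho> F m \<Longrightarrow> sup_on ?B \<rho> (F \<union> F') (max m m')"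
      "sup_on ?B \<rho> F' m' \<Longrightarrow> sup_on ?B \<rho> (F \<union> F') (max m m')" for \<rho>
      by (erule sup_on_mono; simp)+
    then show ?thesis using that unfolding ok_def by fast
  qed
  have G_Un: "G (F \<union> F') (max m m') (\<Delta> \<union> \<Delta>') \<subseteq> G F m \<Delta> \<inter> G F' m' \<Delta>'" for F F' m m' \<Delta> \<Delta>'
    unfolding G_def by auto
  have "fip {G F m \<Delta> | F m \<Delta>. ok F m \<Delta>}"
    unfolding fip_def
  proof (intro allI impI, elim conjE)
    fix H assume "finite H" "H \<subseteq> {G F m \<Delta> | F m \<Delta>. ok F m \<Delta>}"
    then have "\<exists>F m \<Delta>. ok F m \<Delta> \<and> G F m \<Delta> \<subseteq> \<Inter>H"
    proof (induction H rule: finite_induct)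
      case empty
      have "ok {} 0 {}" by (simp add: ok_def)
      then show ?case by auto
    next
      case (insert S H)
      obtain F m \<Delta> where 1: "ok F m \<Delta>" "G F m \<Delta> \<subseteq> \<Inter>H" using insert by blast
      obtain F' m' \<Delta>' where 2: "S = G F' m' \<Delta>'" "ok F' m' \<Delta>'" using insert.prems by blast
      have "G (F \<union> F') (max m m') (\<Delta> \<union> \<Delta>') \<subseteq> \<Inter>(insert S H)"
        using G_Un[of F F' m m' \<Delta> \<Delta>'] 1(2) 2(1) by auto
      then show ?case using ok_Un[OF 1(1) 2(2)] by blast
    qed
    then obtain F m \<Delta> where ok: "ok F m \<Delta>" and sub: "G F m \<Delta> \<subseteq> \<Inter>H" by blast
    have "\<exists>c. range c \<subseteq> ?B \<and>
      (\<forall>\<alpha>\<in>F. \<forall>i. - int m \<le> i \<longrightarrow> i < int m \<longrightarrow> (base N n \<phi> \<alpha> i c \<longleftrightarrow> 0 \<le> i)) \<and>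
      (\<forall>(\<rho>, \<sigma>)\<in>\<Delta>. \<rho> c \<longleftrightarrow> \<rho> (c \<circ> rv \<sigma>))"
      by (rule indiscernible_config[OF _ _ _ _ d0]) (use ok pat in \<open>auto simp: ok_def\<close>)
    then have "G F m \<Delta> \<noteq> {}" unfolding G_def by blast
    then show "\<Inter>H \<noteq> {}" using sub by blast
  qed
  then obtain U where U: "ultra U" "{G F m \<Delta> | F m \<Delta>. ok F m \<Delta>} \<subseteq> U" by (rule fip_imp_ultra)
  have GU: "S \<in> U" if "ok F m \<Delta>" "G F m \<Delta> \<subseteq> S" for F m \<Delta> S
    using U(2) that by (blast intro: ultra_mono[OF U(1)])
  show ?thesis
  proof (rule that[OF U(1)])
    show "{c. range c \<subseteq> ?B} \<in> U"
      by (rule GU[of "{}" 0 "{}"]) (auto simp: ok_def G_def)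
    show "\<forall>\<alpha>\<in>A. \<forall>i. {c. base N n \<phi> \<alpha> i c \<longleftrightarrow> 0 \<le> i} \<in> U"
    proof (intro ballI allI)
      fix \<alpha> i assume "\<alpha> \<in> A"
      then show "{c. base N n \<phi> \<alpha> i c \<longleftrightarrow> 0 \<le> i} \<in> U"
        \<comment> \<open>The upper end of a window is excluded, so its size has to exceed the
          absolute value of \<open>i\<close>.\<close>
        by (intro GU[of "{\<alpha>}" "Suc (nat \<bar>i\<bar>)" "{}"]) (auto simp: ok_def G_def)
    qed
    show "\<forall>\<rho> \<sigma> F m. finite F \<and> F \<subseteq> A \<and> sup_on ?B \<rho> F m \<and> (\<forall>\<alpha>. strict_mono (\<sigma> \<alpha>)) \<and>
      (cut_preserving \<sigma> \<or> X_free ?B \<rho>) \<longrightarrow> {c. \<rho> c \<longleftrightarrow> \<rho> (c \<circ> rv \<sigma>)} \<in> U"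
    proof (intro allI impI)
      fix \<rho> :: "('k cvar \<Rightarrow> 'b) \<Rightarrow> bool" and \<sigma> :: "'k \<Rightarrow> int \<Rightarrow> int" and F m
      assume *: "finite F \<and> F \<subseteq> A \<and> sup_on ?B \<rho> F m \<and> (\<forall>\<alpha>. strict_mono (\<sigma> \<alpha>)) \<and>
        (cut_preserving \<sigma> \<or> X_free ?B \<rho>)"
      show "{c. \<rho> c \<longleftrightarrow> \<rho> (c \<circ> rv \<sigma>)} \<in> U"
        by (rule GU[of F m "{(\<rho>, \<sigma>)}"]) (use * in \<open>auto simp: ok_def G_def\<close>)
    qed
  qed
qed

section \<open>Subadditivity\<close>

lemma rv_rv: "rv \<sigma> \<circ> rv \<tau> = rv (\<lambda>\<alpha>. \<sigma> \<alpha> \<circ> \<tau> \<alpha>)"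
proof
  fix v show "(rv \<sigma> \<circ> rv \<tau>) v = rv (\<lambda>\<alpha>. \<sigma> \<alpha> \<circ> \<tau> \<alpha>) v" by (cases v) auto
qed

lemma rv_comp: "c \<circ> rv \<sigma> \<circ> rv \<tau> = c \<circ> rv (\<lambda>\<alpha>. \<sigma> \<alpha> \<circ> \<tau> \<alpha>)"
  by (simp only: comp_assoc rv_rv)

lemma rv_id: "c \<circ> rv (\<lambda>\<alpha> i. i) = c"
proof
  fix v show "(c \<circ> rv (\<lambda>\<alpha> i. i)) v = c v" by (cases v) auto
qed

text \<open>Only the index -1 of \<alpha> crosses the cut, landing on 0.\<close>

definition shift :: "'k \<Rightarrow> 'k \<Rightarrow> int \<Rightarrow> int" where
  "shift \<alpha> \<beta> i = (if \<beta> = \<alpha> then i + 1 else i)"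

text \<open>The index -1 of \<alpha>, the one by which \<open>shift\<close> detects the cut, is put
  at \<open>t\<close>; everything else moves out of the way by \<open>a\<close> or \<open>b\<close>,
  on its own side.\<close>

definition place :: "int \<Rightarrow> int \<Rightarrow> int \<Rightarrow> 'k \<Rightarrow> 'k \<Rightarrow> int \<Rightarrow> int" where
  "place a b t \<alpha> \<beta> i = (if \<beta> = \<alpha> \<and> i = - 1 then t else if i < 0 then i - a else i + b)"

locale indiscernible =
  fixes L :: "('f, 'r) lang" and N :: "('b, 'f, 'r) fo_struct" and n :: nat
    and \<phi> :: "'k \<Rightarrow> ('f, 'r) fm" and A :: "'k set" and U :: "('k cvar \<Rightarrow> 'b) set set"
  assumes wf: "\<alpha> \<in> A \<Longrightarrow> wf_fm L (\<phi> \<alpha>)" and U: "ultra U"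
    and config_U: "{c. range c \<subseteq> carrier N} \<in> U"
    and base_U: "\<alpha> \<in> A \<Longrightarrow> {c. base N n \<phi> \<alpha> i c \<longleftrightarrow> 0 \<le> i} \<in> U"
    and inv_U: "finite F \<Longrightarrow> F \<subseteq> A \<Longrightarrow> sup_on (carrier N) \<rho> F m \<Longrightarrow> (\<And>\<alpha>. strict_mono (\<sigma> \<alpha>)) \<Longrightarrow>
      cut_preserving \<sigma> \<or> X_free (carrier N) \<rho> \<Longrightarrow> {c. \<rho> c \<longleftrightarrow> \<rho> (c \<circ> rv \<sigma>)} \<in> U"
begin

definition vars :: "nat \<Rightarrow> 'k cvar set" where
  "vars j = {X i | i. i < j} \<union> {Y \<alpha> i l | \<alpha> i l. \<alpha> \<in> A}"

abbreviation D :: "nat \<Rightarrow> (('k cvar \<Rightarrow> 'b) \<Rightarrow> bool) \<Rightarrow> bool" where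
  "D j \<rho> \<equiv> dfn L N N (vars j) \<rho> \<rho>"

text \<open>Truth in the ideal indiscernible configuration that \<open>U\<close> represents.\<close>

definition T :: "(('k cvar \<Rightarrow> 'b) \<Rightarrow> bool) \<Rightarrow> bool" where
  "T \<rho> \<longleftrightarrow> {c. \<rho> c} \<in> U"

text \<open>The first \<open>j\<close> coordinates detect the cut of \<alpha>, possibly with the
  help of parameters from all the sequences in \<open>A\<close>.\<close>

definition sensed :: "nat \<Rightarrow> 'k \<Rightarrow> bool" where
  "sensed j \<alpha> \<longleftrightarrow> (\<exists>\<rho>. D j \<rho> \<and> (T \<rho> \<longleftrightarrow> \<not> T (\<lambda>c. \<rho> (c \<circ> rv (shift \<alpha>)))))"

lemma T_cong: "(\<And>c. range c \<subseteq> carrier N \<Longrightarrow> \<rho> c \<longleftrightarrow> \<rho>' c) \<Longrightarrow> T \<rho> \<longleftrightarrow> T \<rho>'"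
  unfolding T_def by (rule ultra_cong[OF U config_U]) auto

lemma T_not: "T (\<lambda>c. \<not> \<rho> c) \<longleftrightarrow> \<not> T \<rho>"
proof -
  have "{c. \<not> \<rho> c} = - {c. \<rho> c}" by blast
  then show ?thesis unfolding T_def using ultra_Compl[OF U] by metis
qed

lemma D_sup:
  assumes "D j \<rho>"
  obtains F m where "finite F" "F \<subseteq> A" "sup_on (carrier N) \<rho> F m"
proof -
  obtain W where W: "finite W" "W \<subseteq> vars j" "dfn L N N W \<rho> \<rho>"
    using dfn_finite_support[OF assms] by metis
  define F where "F = (\<lambda>v. case v of Y \<alpha> i l \<Rightarrow> \<alpha>) ` (W \<inter> {Y \<alpha> i l | \<alpha> i l. True})"
  have "finite ((\<lambda>v. case v of Y \<alpha> i l \<Rightarrow> nat \<bar>i\<bar>) ` (W \<inter> {Y \<alpha> i l | \<alpha> i l. True}))" using W(1) by simp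
  then obtain m where m: "\<forall>z\<in>(\<lambda>v. case v of Y \<alpha> i l \<Rightarrow> nat \<bar>i\<bar>) ` (W \<inter> {Y \<alpha> i l | \<alpha> i l. True}). z < m"
    using finite_nat_set_iff_bounded by blast
  have FY: "\<alpha> \<in> F" "nat \<bar>i\<bar> < m" if "Y \<alpha> i l \<in> W" for \<alpha> i l
    using that m unfolding F_def by force+
  have "sup_on (carrier N) \<rho> F m"
    unfolding sup_on_def
  proof (intro allI impI)
    fix c c' :: "'k cvar \<Rightarrow> 'b"
    assume c: "range c \<subseteq> carrier N" "range c' \<subseteq> carrier N" "\<forall>j. c (X j) = c' (X j)"
      "\<forall>\<alpha>\<in>F. \<forall>i l. - int m \<le> i \<longrightarrow> i < int m \<longrightarrow> c (Y \<alpha> i l) = c' (Y \<alpha> i l)"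
    show "\<rho> c \<longleftrightarrow> \<rho> c'"
    proof (rule dfn_agree[OF W(3) c(1,2)])
      fix v assume v: "v \<in> W"
      show "c v = c' v"
      proof (cases v)
        case (Y \<alpha> i l)
        then show ?thesis using c(4) FY[of \<alpha> i l] v by auto
      qed (use c(3) in simp)
    qed
  qed
  moreover have "F \<subseteq> A" using W(2) unfolding F_def vars_def by auto
  moreover have "finite F" using W(1) unfolding F_def by simp
  ultimately show ?thesis by (intro that[of F m])
qed

lemma T_inv:
  assumes "D j \<rho>" "\<And>\<alpha>. strict_mono (\<sigma> \<alpha>)" "cut_preserving \<sigma> \<or> X_free (carrier N) \<rho>"
  shows "T (\<lambda>c. \<rho> (c \<circ> rv \<sigma>)) \<longleftrightarrow> T \<rho>"
proof -
  obtain F m where "finite F" "F \<subseteq> A" "sup_on (carrier N) \<rho> F m" by (rule D_sup[OF assms(1)])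
  from inv_U[OF this assms(2,3)] have "{c. \<rho> c \<longleftrightarrow> \<rho> (c \<circ> rv \<sigma>)} \<in> U" .
  then show ?thesis unfolding T_def by (rule ultra_cong[OF U]) auto
qed

lemma D_compose: "D j \<rho> \<Longrightarrow> D j (\<lambda>c. \<rho> (c \<circ> rv \<sigma>))"
  by (rule dfn_mono[OF dfn_compose]) (auto simp: vars_def)

lemma D_sat: "wf_fm L \<chi> \<Longrightarrow> s ` fv \<chi> \<subseteq> vars j \<Longrightarrow> D j (\<lambda>c. sat N (c \<circ> s) \<chi>)"
  by (rule dfnI) auto

text \<open>Without coordinates of the tuple a property is \<open>X_free\<close>, hence invariant
  under every increasing reindexing, in particular under \<open>shift \<alpha>\<close>.\<close>

lemma not_sensed_0: "\<not> sensed 0 \<alpha>"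
proof
  assume "sensed 0 \<alpha>"
  then obtain \<rho> where \<rho>: "D 0 \<rho>" "T \<rho> \<longleftrightarrow> \<not> T (\<lambda>c. \<rho> (c \<circ> rv (shift \<alpha>)))" unfolding sensed_def by blast
  have "X_free (carrier N) \<rho>"
    unfolding X_free_def
  proof (intro allI impI)
    fix c c' :: "'k cvar \<Rightarrow> 'b"
    assume "range c \<subseteq> carrier N" "range c' \<subseteq> carrier N" "\<forall>\<alpha> i l. c (Y \<alpha> i l) = c' (Y \<alpha> i l)"
    then show "\<rho> c \<longleftrightarrow> \<rho> c'" by (intro dfn_agree[OF \<rho>(1)]) (auto simp: vars_def)
  qed
  moreover have "strict_mono (shift \<alpha> \<beta>)" for \<beta> by (auto simp: strict_mono_def shift_def)
  ultimately show False using T_inv[OF \<rho>(1), of "shift \<alpha>"] \<rho>(2) by blast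
qed

text \<open>The formula \<open>\<phi> \<alpha>\<close> of the pattern itself detects the cut: it is
  false at index -1 and true at index 0.\<close>

lemma sensed_n:
  assumes "\<alpha> \<in> A"
  shows "sensed n \<alpha>"
proof -
  define s where "s v = (if v < n then X v else Y \<alpha> (- 1) (v - n))" for v
  define \<rho> :: "('k cvar \<Rightarrow> 'b) \<Rightarrow> bool" where "\<rho> = (\<lambda>c. sat N (c \<circ> s) (\<phi> \<alpha>))"
  have eq: "\<rho> c \<longleftrightarrow> base N n \<phi> \<alpha> (- 1) c" "\<rho> (c \<circ> rv (shift \<alpha>)) \<longleftrightarrow> base N n \<phi> \<alpha> 0 c" for c
    unfolding \<rho>_def base_def by (rule sat_cong, simp add: s_def env_def shift_def)+
  have D: "D n \<rho>"
    unfolding \<rho>_def by (rule D_sat) (use wf assms in \<open>auto simp: s_def vars_def\<close>)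
  have "T (\<lambda>c. \<not> \<rho> c)"
    using base_U[OF assms, of "- 1"] unfolding T_def eq(1) by simp
  moreover have "T (\<lambda>c. \<rho> (c \<circ> rv (shift \<alpha>)))"
    using base_U[OF assms, of 0] unfolding T_def eq(2) by simp
  moreover note D
  ultimately show ?thesis unfolding sensed_def T_not by blast
qed

text \<open>Such a move is a composition of unit steps, and a property of the first \<open>j\<close>
  coordinates remains one after a step. Since no step at an index in \<open>F\<close> changes truth,
  induction on the number of steps applies.\<close>

lemma T_shift:
  assumes "finite F" "\<And>\<alpha>. \<alpha> \<in> F \<Longrightarrow> \<not> sensed j \<alpha>" "D j \<rho>" "\<And>\<alpha>. \<alpha> \<notin> F \<Longrightarrow> h \<alpha> = (0 :: nat)"
  shows "T (\<lambda>c. \<rho> (c \<circ> rv (\<lambda>\<beta> i. i + int (h \<beta>)))) \<longleftrightarrow> T \<rho>"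
  using assms(3,4)
proof (induction "sum h F" arbitrary: h \<rho>)
  case 0
  then have "h \<beta> = 0" for \<beta> using assms(1) by (metis sum_eq_0_iff)
  then show ?case by (simp add: rv_id)
next
  case (Suc k)
  then obtain \<alpha> where \<alpha>: "\<alpha> \<in> F" "h \<alpha> \<noteq> 0" using assms(1) by (metis Zero_not_Suc sum.neutral)
  define h' where "h' = h(\<alpha> := h \<alpha> - 1)"
  have "sum h F = Suc (sum h' F)"
    using \<alpha> assms(1) by (simp add: h'_def sum.remove[of F \<alpha>])
  then have k: "k = sum h' F" using Suc.hyps(2) by simp
  let ?\<rho>' = "\<lambda>c. \<rho> (c \<circ> rv (shift \<alpha>))"
  have h'0: "h' \<beta> = 0" if "\<beta> \<notin> F" for \<beta> using Suc.prems(2)[OF that] \<alpha>(1) that by (auto simp: h'_def)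
  have comp: "(\<lambda>\<beta>. (\<lambda>i. i + int (h' \<beta>)) \<circ> shift \<alpha> \<beta>) = (\<lambda>\<beta> i. i + int (h \<beta>))"
    using \<alpha>(2) by (auto simp: fun_eq_iff shift_def h'_def)
  have "T (\<lambda>c. \<rho> (c \<circ> rv (\<lambda>\<beta> i. i + int (h \<beta>)))) \<longleftrightarrow>
      T (\<lambda>c. ?\<rho>' (c \<circ> rv (\<lambda>\<beta> i. i + int (h' \<beta>))))"
    unfolding rv_comp comp ..
  also have "\<dots> \<longleftrightarrow> T ?\<rho>'"
    using Suc.hyps(1)[OF k D_compose[OF Suc.prems(1), of "shift \<alpha>"]] h'0 by simp
  also have "\<dots> \<longleftrightarrow> T \<rho>" using assms(2)[OF \<alpha>(1)] Suc.prems(1) unfolding sensed_def by blast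
  finally show ?case .
qed

text \<open>Negation normalizes the direction: false before the shift and true after it, as for the
  formulas of a pattern.\<close>

lemma sensed_formula:
  assumes "sensed j \<alpha>"
  shows "\<exists>\<chi> s. wf_fm L \<chi> \<and> s ` fv \<chi> \<subseteq> vars j \<and> \<not> T (\<lambda>c. sat N (c \<circ> s) \<chi>) \<and>
    T (\<lambda>c. sat N (c \<circ> rv (shift \<alpha>) \<circ> s) \<chi>)"
proof -
  obtain \<rho>' where \<rho>': "D j \<rho>'" "T \<rho>' \<longleftrightarrow> \<not> T (\<lambda>c. \<rho>' (c \<circ> rv (shift \<alpha>)))"
    using assms unfolding sensed_def by (elim exE conjE)
  have "\<exists>\<rho>. D j \<rho> \<and> \<not> T \<rho> \<and> T (\<lambda>c. \<rho> (c \<circ> rv (shift \<alpha>)))"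
  proof (cases "T \<rho>'")
    case True
    then show ?thesis
      using \<rho>' dfn_not[OF \<rho>'(1)] by (intro exI[of _ "\<lambda>c. \<not> \<rho>' c"]) (simp add: T_not)
  next
    case False
    then show ?thesis using \<rho>' by (intro exI[of _ \<rho>']) simp
  qed
  then obtain \<rho> where \<rho>: "D j \<rho>" "\<not> T \<rho>" "T (\<lambda>c. \<rho> (c \<circ> rv (shift \<alpha>)))" by blast
  from \<rho>(1) show ?thesis
  proof (rule dfnE)
    fix \<chi> s
    assume \<chi>: "wf_fm L \<chi>" "s ` fv \<chi> \<subseteq> vars j"
      and eq: "\<And>c. range c \<subseteq> carrier N \<Longrightarrow> \<rho> c \<longleftrightarrow> sat N (c \<circ> s) \<chi>"
    have "T \<rho> \<longleftrightarrow> T (\<lambda>c. sat N (c \<circ> s) \<chi>)" by (rule T_cong) (rule eq)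
    moreover have "T (\<lambda>c. \<rho> (c \<circ> rv (shift \<alpha>))) \<longleftrightarrow> T (\<lambda>c. sat N (c \<circ> rv (shift \<alpha>) \<circ> s) \<chi>)"
      by (rule T_cong) (rule eq, auto)
    ultimately show ?thesis using \<rho> \<chi> by blast
  qed
qed

text \<open>The bounds on \<open>t\<close> put it strictly between the images of -2 and 0, which
  keeps \<open>place\<close> increasing. By indiscernibility only the side of the cut on which
  \<open>t\<close> lies matters.\<close>

lemma T_place:
  assumes "D j \<rho>" "a \<ge> 0" "b \<ge> 0" "- a - 2 < t" "t < b"
  shows "T (\<lambda>c. \<rho> (c \<circ> rv (place a b t \<alpha>))) \<longleftrightarrow> (if t < 0 then T \<rho> else T (\<lambda>c. \<rho> (c \<circ> rv (shift \<alpha>))))"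
proof (cases "t < 0")
  case True
  have "strict_mono (place a b t \<alpha> \<beta>)" for \<beta>
    using assms by (auto intro!: strict_monoI simp: place_def)
  moreover have "cut_preserving (place a b t \<alpha>)"
    using assms True by (auto simp: cut_preserving_def place_def)
  ultimately show ?thesis using T_inv[OF assms(1), of "place a b t \<alpha>"] True by simp
next
  case False
  \<comment> \<open>The shift carries -1 across the cut to 0; the remaining motion from 0 to
    \<open>t\<close> respects the cuts.\<close>
  define \<tau> where "\<tau> \<beta> i = (if \<beta> = \<alpha> then if i < 0 then i - 1 - a else if i = 0 then t else i - 1 + b
    else if i < 0 then i - a else i + b)" for \<beta> i
  have "strict_mono (\<tau> \<beta>)" for \<beta>
    using assms by (auto intro!: strict_monoI simp: \<tau>_def)
  moreover have "cut_preserving \<tau>"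
    using assms False by (auto simp: cut_preserving_def \<tau>_def)
  ultimately have "T (\<lambda>c. \<rho> (c \<circ> rv \<tau> \<circ> rv (shift \<alpha>))) \<longleftrightarrow> T (\<lambda>c. \<rho> (c \<circ> rv (shift \<alpha>)))"
    using T_inv[OF D_compose[OF assms(1), of "shift \<alpha>"], of \<tau>] by simp
  moreover have "(\<lambda>\<beta>. \<tau> \<beta> \<circ> shift \<alpha> \<beta>) = place a b t \<alpha>"
    by (auto simp: fun_eq_iff \<tau>_def shift_def place_def)
  ultimately show ?thesis using False unfolding rv_comp by simp
qed

text \<open>Since the tuple of the first \<open>j\<close> coordinates does not sense the cuts in question, these cuts
  can be moved without changing the existence of a suitable next coordinate. The parameters
  not involved in detecting a cut are placed far to the left or right of all cuts.\<close>

lemma finpat_level: "finpat L N 1 {\<alpha> \<in> A. sensed (Suc j) \<alpha> \<and> \<not> sensed j \<alpha>}"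
proof -
  let ?A = "{\<alpha> \<in> A. sensed (Suc j) \<alpha> \<and> \<not> sensed j \<alpha>}"
  have "\<forall>\<alpha>\<in>?A. \<exists>z. wf_fm L (fst z) \<and> snd z ` fv (fst z) \<subseteq> vars (Suc j) \<and>
      \<not> T (\<lambda>c. sat N (c \<circ> snd z) (fst z)) \<and> T (\<lambda>c. sat N (c \<circ> rv (shift \<alpha>) \<circ> snd z) (fst z))"
    using sensed_formula[of "Suc j"] by simp
  from bchoice[OF this] obtain z where z: "\<forall>\<alpha>\<in>?A. wf_fm L (fst (z \<alpha>)) \<and>
      snd (z \<alpha>) ` fv (fst (z \<alpha>)) \<subseteq> vars (Suc j) \<and>
      \<not> T (\<lambda>c. sat N (c \<circ> snd (z \<alpha>)) (fst (z \<alpha>))) \<and>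
      T (\<lambda>c. sat N (c \<circ> rv (shift \<alpha>) \<circ> snd (z \<alpha>)) (fst (z \<alpha>)))" ..
  define \<chi> where "\<chi> \<alpha> = fst (z \<alpha>)" for \<alpha>
  define s where "s \<alpha> = snd (z \<alpha>)" for \<alpha>
  define \<rho> where "\<rho> \<alpha> c \<longleftrightarrow> sat N (c \<circ> s \<alpha>) (\<chi> \<alpha>)" for \<alpha> c
  have \<chi>: "wf_fm L (\<chi> \<alpha>)" "D (Suc j) (\<rho> \<alpha>)" "\<not> T (\<rho> \<alpha>)" "T (\<lambda>c. \<rho> \<alpha> (c \<circ> rv (shift \<alpha>)))"
    if "\<alpha> \<in> ?A" for \<alpha>
    using bspec[OF z that] D_sat[of "\<chi> \<alpha>" "s \<alpha>" "Suc j"] unfolding \<chi>_def s_def \<rho>_def by auto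
  show ?thesis
  proof (rule finpatI[where \<phi> = "\<lambda>\<alpha>. ren (\<chi> \<alpha>) (\<lambda>v. if s \<alpha> v = X j then 0 else Suc v)"])
    show "wf_fm L (ren (\<chi> \<alpha>) (\<lambda>v. if s \<alpha> v = X j then 0 else Suc v))" if "\<alpha> \<in> ?A" for \<alpha>
      using \<chi>(1)[OF that] by (simp add: wf_ren)
  next
    fix F k
    assume F: "finite F" "F \<subseteq> ?A"
    \<comment> \<open>The detecting parameters lie within distance \<open>k\<close> of the cuts and
      shifts have size at most \<open>k\<close>; with \<open>?a\<close> the other parameters stay
      clear on both sides. The extra \<open>k\<close> in \<open>?b\<close> comes from \<tau>
      below.\<close>
    let ?a = "2 * int k + 1" and ?b = "3 * int k + 1"
    define H where "H = {h :: 'k \<Rightarrow> nat. \<forall>\<alpha>. (\<alpha> \<in> F \<longrightarrow> h \<alpha> \<in> {..k}) \<and> (\<alpha> \<notin> F \<longrightarrow> h \<alpha> = 0)}"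
    have "finite H" unfolding H_def by (rule finite_set_of_finite_funs) (use F(1) in auto)
    define \<Theta> where "\<Theta> h c \<longleftrightarrow> (\<exists>x\<in>carrier N. \<forall>\<alpha>\<in>F. \<forall>i\<in>{..<k}.
      \<rho> \<alpha> (c(X j := x) \<circ> rv (place ?a ?b (int i) \<alpha>)) \<longleftrightarrow> h \<alpha> \<le> i)" for h c
    have T\<Theta>: "T (\<Theta> h)" if h: "h \<in> H" for h
    proof -
      define \<Theta>' where "\<Theta>' c \<longleftrightarrow> (\<exists>x\<in>carrier N. \<forall>\<alpha>\<in>F. \<forall>i\<in>{..<k}.
        \<rho> \<alpha> (c(X j := x) \<circ> rv (place ?a ?a (int i - int (h \<alpha>)) \<alpha>)) \<longleftrightarrow> h \<alpha> \<le> i)" for c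
      \<comment> \<open>After the shift by \<open>h\<close>, this map undoes the shift on all far
        parameters, up to adding \<open>k\<close> on the right, and keeps the range next to the cut.
        It respects the cuts, and the total motion becomes
        \<open>place ?a ?b (int i) \<alpha>\<close>, from which \<open>h\<close> has
        disappeared.\<close>
      define \<tau> where "\<tau> \<beta> u = (if u < 0 then u - int (h \<beta>) else if u < ?a then u else u - int (h \<beta>) + int k)"
        for \<beta> :: 'k and u
      have hk: "h \<alpha> \<le> k" for \<alpha> using h by (cases "\<alpha> \<in> F") (auto simp: H_def)
      have "{c. \<rho> \<alpha> (c \<circ> rv (place ?a ?a (int i - int (h \<alpha>)) \<alpha>)) \<longleftrightarrow> h \<alpha> \<le> i} \<in> U"
        if "\<alpha> \<in> F" "i < k" for \<alpha> i
      proof -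
        have \<alpha>: "\<alpha> \<in> ?A" using that F by blast
        have "T (\<lambda>c. \<rho> \<alpha> (c \<circ> rv (place ?a ?a (int i - int (h \<alpha>)) \<alpha>))) \<longleftrightarrow> h \<alpha> \<le> i"
          using T_place[OF \<chi>(2)[OF \<alpha>], of ?a ?a "int i - int (h \<alpha>)" \<alpha>] \<chi>(3,4)[OF \<alpha>] hk[of \<alpha>] that(2)
          by (auto split: if_splits)
        then show ?thesis unfolding T_def
          using ultra_Compl[OF U, of "{c. \<rho> \<alpha> (c \<circ> rv (place ?a ?a (int i - int (h \<alpha>)) \<alpha>))}"]
          by (cases "h \<alpha> \<le> i") (simp_all add: Collect_neg_eq)
      qed
      then have "(\<Inter>\<alpha>\<in>F. \<Inter>i\<in>{..<k}. {c. \<rho> \<alpha> (c \<circ> rv (place ?a ?a (int i - int (h \<alpha>)) \<alpha>)) \<longleftrightarrow> h \<alpha> \<le> i}) \<in> U"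
        using F(1) by (intro ultra_INT[OF U]) auto
      from ultra_Int[OF U this config_U] have "T \<Theta>'"
        unfolding T_def
      proof (rule ultra_mono[OF U], intro subsetI CollectI)
        fix c
        assume c: "c \<in> (\<Inter>\<alpha>\<in>F. \<Inter>i\<in>{..<k}. {c. \<rho> \<alpha> (c \<circ> rv (place ?a ?a (int i - int (h \<alpha>)) \<alpha>)) \<longleftrightarrow>
            h \<alpha> \<le> i}) \<inter> {c. range c \<subseteq> carrier N}"
        have "c(X j := c (X j)) = c" by simp
        moreover have "c (X j) \<in> carrier N" using c by blast
        ultimately show "\<Theta>' c" unfolding \<Theta>'_def using c by (intro bexI[of _ "c (X j)"]) auto
      qed
      have "D (Suc j) (\<lambda>c. \<forall>\<alpha>\<in>F. \<forall>i\<in>{..<k}.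
          \<rho> \<alpha> (c \<circ> rv (place ?a ?a (int i - int (h \<alpha>)) \<alpha>)) \<longleftrightarrow> h \<alpha> \<le> i)"
        using F \<chi>(2) by (intro dfn_ball dfn_iff_const D_compose) auto
      \<comment> \<open>Binding \<open>X j\<close> is what makes the shift by \<open>h\<close>
        invisible: the cuts in \<open>F\<close> are sensed by \<open>j + 1\<close> but not by
        \<open>j\<close> coordinates.\<close>
      from dfn_ex[OF this, of "X j"] have D\<Theta>': "D j \<Theta>'"
        unfolding \<Theta>'_def[abs_def] by (rule dfn_mono) (auto simp: vars_def less_Suc_eq)
      have pl: "(\<lambda>\<beta>. (\<tau> \<beta> \<circ> (\<lambda>i. i + int (h \<beta>))) \<circ> place ?a ?a (int i - int (h \<alpha>)) \<alpha> \<beta>) =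
          place ?a ?b (int i) \<alpha>" if "i < k" for i \<alpha>
      proof (intro ext)
        fix \<beta> u
        show "((\<tau> \<beta> \<circ> (\<lambda>i. i + int (h \<beta>))) \<circ> place ?a ?a (int i - int (h \<alpha>)) \<alpha> \<beta>) u =
          place ?a ?b (int i) \<alpha> \<beta> u"
          using hk[of \<beta>] that by (auto simp: \<tau>_def place_def)
      qed
      have upd: "(c \<circ> rv \<sigma>)(X j := x) = c(X j := x) \<circ> rv \<sigma>" for c :: "'k cvar \<Rightarrow> 'b" and \<sigma> x
      proof
        fix v show "((c \<circ> rv \<sigma>)(X j := x)) v = (c(X j := x) \<circ> rv \<sigma>) v" by (cases v) auto
      qed
      have \<Theta>_eq: "\<Theta> h c \<longleftrightarrow> \<Theta>' (c \<circ> rv \<tau> \<circ> rv (\<lambda>\<beta> i. i + int (h \<beta>)))" for c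
        unfolding \<Theta>_def \<Theta>'_def rv_comp upd
        by (rule bex_cong[OF refl], rule ball_cong[OF refl], rule ball_cong[OF refl])
          (simp only: pl lessThan_iff)
      have mono: "strict_mono (\<tau> \<beta>)" for \<beta>
        using hk[of \<beta>] by (auto intro!: strict_monoI simp: \<tau>_def)
      have "\<tau> \<beta> u < 0 \<longleftrightarrow> u < 0" for \<beta> u using hk[of \<beta>] by (auto simp: \<tau>_def)
      then have cp: "cut_preserving \<tau>" by (simp add: cut_preserving_def)
      have "T (\<Theta> h) \<longleftrightarrow> T (\<lambda>c. \<Theta>' (c \<circ> rv \<tau> \<circ> rv (\<lambda>\<beta> i. i + int (h \<beta>))))"
        unfolding \<Theta>_eq[abs_def] ..
      also have "\<dots> \<longleftrightarrow> T (\<lambda>c. \<Theta>' (c \<circ> rv (\<lambda>\<beta> i. i + int (h \<beta>))))"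
        by (rule T_inv[OF D_compose[OF D\<Theta>']]) (use mono cp in auto)
      also have "\<dots> \<longleftrightarrow> T \<Theta>'"
        by (rule T_shift[OF F(1) _ D\<Theta>']) (use F(2) h in \<open>auto simp: H_def\<close>)
      finally show ?thesis using \<open>T \<Theta>'\<close> by simp
    qed
    \<comment> \<open>Finitely many cut functions are relevant, so one configuration works for all
      of them.\<close>
    have "(\<Inter>h\<in>H. {c. \<Theta> h c}) \<in> U"
      by (rule ultra_INT[OF U \<open>finite H\<close>]) (use T\<Theta> in \<open>simp add: T_def\<close>)
    from ultra_nonempty[OF U ultra_Int[OF U this config_U]] obtain c
      where c: "range c \<subseteq> carrier N" "\<And>h. h \<in> H \<Longrightarrow> \<Theta> h c" by blast
    \<comment> \<open>The first \<open>j\<close> coordinates of \<open>c\<close> enter here as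
      parameters. Entries with \<open>s \<alpha> l = X j\<close> are never read, since that variable
      was renamed to 0.\<close>
    define y where "y \<alpha> i l = c (rv (place ?a ?b (int i) \<alpha>) (s \<alpha> l))" for \<alpha> i l
    have eq: "sat N (env 1 x (y \<alpha> i)) (ren (\<chi> \<alpha>) (\<lambda>v. if s \<alpha> v = X j then 0 else Suc v)) \<longleftrightarrow>
        \<rho> \<alpha> (c(X j := x 0) \<circ> rv (place ?a ?b (int i) \<alpha>))" for x \<alpha> i
      unfolding sat_ren \<rho>_def
    proof (rule sat_cong)
      fix v
      show "(env 1 x (y \<alpha> i) \<circ> (\<lambda>v. if s \<alpha> v = X j then 0 else Suc v)) v =
          (c(X j := x 0) \<circ> rv (place ?a ?b (int i) \<alpha>) \<circ> s \<alpha>) v"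
        by (cases "s \<alpha> v") (auto simp: env_def y_def)
    qed
    have "pattern N 1 (\<lambda>\<alpha>. ren (\<chi> \<alpha>) (\<lambda>v. if s \<alpha> v = X j then 0 else Suc v)) F k y"
      unfolding pattern_def
    proof
      fix g :: "'k \<Rightarrow> nat"
      \<comment> \<open>The successor turns the strict inequality of a pattern into
        \<open>h \<alpha> \<le> i\<close>.\<close>
      define h where "h \<alpha> = (if \<alpha> \<in> F then min k (Suc (g \<alpha>)) else 0)" for \<alpha>
      have "h \<in> H" by (simp add: H_def h_def)
      from c(2)[OF this] obtain x where x: "x \<in> carrier N"
        "\<forall>\<alpha>\<in>F. \<forall>i\<in>{..<k}. \<rho> \<alpha> (c(X j := x) \<circ> rv (place ?a ?b (int i) \<alpha>)) \<longleftrightarrow> h \<alpha> \<le> i"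
        unfolding \<Theta>_def by blast
      have "h \<alpha> \<le> i \<longleftrightarrow> g \<alpha> < i" if "\<alpha> \<in> F" "i < k" for \<alpha> i using that by (auto simp: h_def)
      with x show "\<exists>x. range x \<subseteq> carrier N \<and> (\<forall>\<alpha>\<in>F. \<forall>i<k.
          sat N (env 1 x (y \<alpha> i)) (ren (\<chi> \<alpha>) (\<lambda>v. if s \<alpha> v = X j then 0 else Suc v)) \<longleftrightarrow> g \<alpha> < i)"
        unfolding eq by (intro exI[of _ "\<lambda>_. x"]) auto
    qed
    moreover have "range (y \<alpha> i) \<subseteq> carrier N" for \<alpha> i using c(1) by (auto simp: y_def)
    ultimately show "\<exists>y. (\<forall>\<alpha> i. range (y \<alpha> i) \<subseteq> carrier N) \<and>
        pattern N 1 (\<lambda>\<alpha>. ren (\<chi> \<alpha>) (\<lambda>v. if s \<alpha> v = X j then 0 else Suc v)) F k y" by blast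
  qed
qed

text \<open>Each cut is undetected by 0 coordinates and detected by \<open>n\<close>, so detection
  sets in at some coordinate.\<close>

lemma level_cover: "A = (\<Union>j<n. {\<alpha> \<in> A. sensed (Suc j) \<alpha> \<and> \<not> sensed j \<alpha>})"
proof -
  have "\<exists>j<m. sensed (Suc j) \<alpha> \<and> \<not> sensed j \<alpha>" if "sensed m \<alpha>" for m \<alpha>
    using that
  proof (induction m)
    case 0
    then show ?case using not_sensed_0 by simp
  next
    case (Suc m)
    then show ?case using less_SucI by (cases "sensed m \<alpha>") blast+
  qed
  with sensed_n have "\<exists>j<n. sensed (Suc j) \<alpha> \<and> \<not> sensed j \<alpha>" if "\<alpha> \<in> A" for \<alpha>
    using that by blast
  then show ?thesis by blast
qed

end

lemma finpat_split:
  assumes "finpat L N n A" "carrier N \<noteq> {}"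
  shows "\<exists>A'. A = (\<Union>j<n. A' j) \<and> (\<forall>j<n. finpat L N 1 (A' j))"
proof -
  obtain \<phi> where wf: "\<forall>\<alpha>\<in>A. wf_fm L (\<phi> \<alpha>)" and pat: "\<forall>F k. finite F \<and> F \<subseteq> A \<longrightarrow>
      (\<exists>y. (\<forall>\<alpha> i. range (y \<alpha> i) \<subseteq> carrier N) \<and> pattern N n \<phi> F k y)"
    by (rule finpatE[OF assms(1)])
  obtain d0 where d0: "d0 \<in> carrier N" using assms(2) by blast
  obtain U where U: "ultra U" "{c. range c \<subseteq> carrier N} \<in> U"
    "\<forall>\<alpha>\<in>A. \<forall>i. {c. base N n \<phi> \<alpha> i c \<longleftrightarrow> 0 \<le> i} \<in> U"
    "\<forall>\<rho> \<sigma> F m. finite F \<and> F \<subseteq> A \<and> sup_on (carrier N) \<rho> F m \<and> (\<forall>\<alpha>. strict_mono (\<sigma> \<alpha>)) \<and>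
      (cut_preserving \<sigma> \<or> X_free (carrier N) \<rho>) \<longrightarrow> {c. \<rho> c \<longleftrightarrow> \<rho> (c \<circ> rv \<sigma>)} \<in> U"
    by (rule indiscernible_ultra[OF pat d0])
  interpret indiscernible L N n \<phi> A U
    by unfold_locales (use wf U in blast)+
  show ?thesis using level_cover finpat_level by blast
qed

section \<open>Closure under trace definability\<close>

lemma ex_largest_part:
  assumes "n \<ge> (1 :: nat)"
  shows "\<exists>j<n. \<forall>i<n. |A i| \<le>o |A j|"
  using assms
proof (induction n rule: nat_induct_at_least)
  case base
  then show ?case by (simp add: card_of_mono1)
next
  case (Suc n)
  then obtain j where j: "j < n" "\<forall>i<n. |A i| \<le>o |A j|" by blast
  have "|A j| \<le>o |A n| \<or> |A n| \<le>o |A j|" by (rule ordLeq_total) (rule card_of_Well_order)+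
  then show ?case
  proof
    assume "|A j| \<le>o |A n|"
    then have "\<forall>i<Suc n. |A i| \<le>o |A n|"
      using j(2) by (auto simp: less_Suc_eq intro: ordLeq_transitive card_of_mono1)
    then show ?thesis by blast
  next
    assume "|A n| \<le>o |A j|"
    then have "\<forall>i<Suc n. |A i| \<le>o |A j|" using j(2) by (auto simp: less_Suc_eq)
    then show ?thesis using j(1) less_SucI by blast
  qed
qed

lemma card_UN_le_cprod:
  assumes "n \<ge> (1 :: nat)"
  shows "\<exists>j<n. |\<Union>i<n. A i| \<le>o |{..<n}| *c |A j|"
proof -
  obtain j where j: "j < n" "\<forall>i<n. |A i| \<le>o |A j|" using ex_largest_part[OF assms] by blast
  have "|\<Union>i<n. A i| \<le>o |SIGMA i : {..<n}. A i|" by (rule card_of_UNION_Sigma)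
  also have "|SIGMA i : {..<n}. A i| \<le>o |SIGMA i : {..<n}. A j|"
    by (rule card_of_Sigma_mono1) (use j in auto)
  finally show ?thesis using j(1) by (auto simp: cprod_def Field_card_of)
qed

text \<open>The set \<open>B\<close> is a largest one of the \<open>n\<close> parts into which
  \<open>A\<close> splits.\<close>

lemma trace_definition_finpat_bound:
  fixes A :: "'k set"
  assumes "trace_definition L' M L N n \<tau>" "is_struct L N" "finpat L' M 1 A"
  shows "\<exists>B :: 'k set. finpat L N 1 B \<and> |A| \<le>o |{..<n}| *c |B|"
proof -
  have n: "n \<ge> 1" using assms(1) by (simp add: trace_definition_def)
  have "carrier N \<noteq> {}" using assms(2) by (simp add: is_struct_def)
  from finpat_split[OF trace_definition_finpat[OF assms] this]
  obtain A' where A': "A = (\<Union>j<n. A' j)" "\<forall>j<n. finpat L N 1 (A' j)" by blast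
  obtain j where "j < n" "|\<Union>i<n. A' i| \<le>o |{..<n}| *c |A' j|" using card_UN_le_cprod[OF n] by blast
  with A' show ?thesis by blast
qed

lemma finpat_imp_theory_opd_ge:
  fixes N :: "('b, 'f, 'r) fo_struct"
  assumes T: "complete_theory L T" and N: "is_model L T N" and fp: "finpat L N 1 (Field \<kappa>)"
  shows "theory_opd_ge L T \<kappa>"
proof -
  obtain N' :: "(('f, 'r) fm, 'f, 'r) fo_struct" where N': "is_model L T N'"
    using T by (auto simp: complete_theory_def consistent_def)
  have s: "is_struct L N" "is_struct L N'" using N N' by (simp_all add: is_model_def)
  have "finpat L N' 1 (Field \<kappa>)"
    using finpat_el_equiv[OF complete_theory_el_equiv[OF T N N'] _ _ fp] s by (simp add: is_struct_def)
  then show ?thesis using finpat_imp_opd_ge[OF s(2)] N' unfolding theory_opd_ge_def by blast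
qed

lemma theory_opd_ge_imp_finpat:
  fixes M :: "('a, 'f, 'r) fo_struct"
  assumes T: "complete_theory L T" and M: "is_model L T M" and opd: "theory_opd_ge L T \<kappa>"
  shows "finpat L M 1 (Field \<kappa>)"
proof -
  obtain M' :: "(('f, 'r) fm, 'f, 'r) fo_struct" where M': "is_model L T M'" "opd_ge L M' \<kappa>"
    using opd by (auto simp: theory_opd_ge_def)
  have s: "is_struct L M" "is_struct L M'" using M M' by (simp_all add: is_model_def)
  show ?thesis
    using finpat_el_equiv[OF complete_theory_el_equiv[OF T M'(1) M] _ _ opd_ge_imp_finpat[OF M'(2) s(2)]] s
    by (simp add: is_struct_def)
qed

text \<open>An infinite cardinal absorbs the finite factor \<open>n\<close>, so no depth is
  lost.\<close>

lemma inj_into_factor_infinite: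
  assumes "infinite A" "|A| \<le>o |{..<n :: nat}| *c |B|"
  shows "\<exists>f. inj_on f A \<and> f ` A \<subseteq> B"
proof -
  have le: "|A| \<le>o |{..<n} \<times> B|" using assms(2) by (simp add: cprod_def Field_card_of)
  have "infinite ({..<n} \<times> B)" using assms(1) le card_of_ordLeq_finite by blast
  then have B: "infinite B" by auto
  moreover have "|{..<n}| \<le>o |B|" 
    using B by (intro ordLess_imp_ordLeq finite_ordLess_infinite)
      (simp_all add: Field_card_of card_of_well_order_on)
  moreover have "{..<n} \<noteq> {}" using \<open>infinite ({..<n} \<times> B)\<close> by auto
  ultimately have "|{..<n} \<times> B| =o |B|" by (intro card_of_Times_infinite[THEN conjunct2])
  then have "|A| \<le>o |B|" using le ordLeq_ordIso_trans by blast
  then show ?thesis using card_of_ordLeq by blast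
qed

lemma inj_into_factor_finite:
  fixes n d :: nat
  assumes "n \<ge> 1" "|{..<n * d}| \<le>o |{..<n}| *c |B|"
  shows "\<exists>f. inj_on f {..<d} \<and> f ` {..<d} \<subseteq> B"
proof -
  have "\<exists>B'\<subseteq>B. finite B' \<and> d \<le> card B'"
  proof (cases "finite B")
    case True
    have "|{..<n * d}| \<le>o |{..<n} \<times> B|" using assms(2) by (simp add: cprod_def Field_card_of)
    from card_of_ordLeq[THEN iffD2, OF this]
    obtain f where "inj_on f {..<n * d}" "f ` {..<n * d} \<subseteq> {..<n} \<times> B" by blast
    then have "n * d \<le> n * card B"
      using card_inj_on_le[of f "{..<n * d}" "{..<n} \<times> B"] True by (simp add: card_cartesian_product)
    then show ?thesis using True assms(1) by (intro exI[of _ B]) auto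
  next
    case False
    then show ?thesis using infinite_arbitrarily_large[of B d] by auto
  qed
  then obtain B' where "B' \<subseteq> B" "finite B'" "d \<le> card B'" by blast
  then show ?thesis using card_le_inj[of "{..<d}" B'] by auto
qed

text \<open>Op-dimension is accessible only through the depths of arrays. The inequality is
  therefore stated as: every depth \<theta> attained in \<open>M\<close> is at most \<open>n\<close>
  times a depth \<mu> attained in \<open>N\<close>.\<close>

theorem proposition4p11:
  fixes L :: "('f, 'r) lang" and L' :: "('g, 's) lang"
    and T :: "('f, 'r) fm set" and T' :: "('g, 's) fm set"
    and M :: "('a, 'g, 's) fo_struct" and N :: "('b, 'f, 'r) fo_struct"
    and \<tau> :: "'a \<Rightarrow> 'b list" and n :: nat and \<kappa> :: "'k rel"
  shows
    "(is_struct L' M \<and> is_struct L N \<and> trace_definition L' M L N n \<tau> \<longrightarrow>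
        (\<forall>\<theta> :: 'k rel. Card_order \<theta> \<and> opd_ge L' M \<theta> \<longrightarrow>
           (\<exists>\<mu> :: 'k rel. Card_order \<mu> \<and> opd_ge L N \<mu> \<and> \<theta> \<le>o |{..<n}| *c \<mu>))) \<and>
     (complete_theory L T \<and> complete_theory L' T' \<and>
        trace_defines TYPE('b) TYPE('a) L T L' T' \<longrightarrow>
        (Card_order \<kappa> \<and> cinfinite \<kappa> \<and> theory_opd_less L T \<kappa> \<longrightarrow> theory_opd_less L' T' \<kappa>) \<and>
        (theory_opd_finite L T \<longrightarrow> theory_opd_finite L' T'))"
proof (intro conjI impI)
  assume *: "is_struct L' M \<and> is_struct L N \<and> trace_definition L' M L N n \<tau>"
  show "\<forall>\<theta> :: 'k rel. Card_order \<theta> \<and> opd_ge L' M \<theta> \<longrightarrow>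
      (\<exists>\<mu> :: 'k rel. Card_order \<mu> \<and> opd_ge L N \<mu> \<and> \<theta> \<le>o |{..<n}| *c \<mu>)"
  proof (intro allI impI)
    fix \<theta> :: "'k rel"
    assume \<theta>: "Card_order \<theta> \<and> opd_ge L' M \<theta>"
    then have "finpat L' M 1 (Field \<theta>)" using * opd_ge_imp_finpat by blast
    then obtain B :: "'k set" where B: "finpat L N 1 B" "|Field \<theta>| \<le>o |{..<n}| *c |B|"
      using trace_definition_finpat_bound * by blast
    have "opd_ge L N |B|" using * B(1) by (intro finpat_imp_opd_ge) (simp_all add: Field_card_of)
    moreover have "\<theta> \<le>o |{..<n}| *c |B|"
      using \<theta> B(2) card_of_Field_ordIso ordIso_symmetric ordIso_ordLeq_trans by blast
    ultimately show "\<exists>\<mu> :: 'k rel. Card_order \<mu> \<and> opd_ge L N \<mu> \<and> \<theta> \<le>o |{..<n}| *c \<mu>"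
      using card_of_Card_order by blast
  qed
next
  assume *: "complete_theory L T \<and> complete_theory L' T' \<and> trace_defines TYPE('b) TYPE('a) L T L' T'"
  then have T: "complete_theory L T" and T': "complete_theory L' T'" by simp_all
  from * obtain M :: "('a, 'g, 's) fo_struct" and N :: "('b, 'f, 'r) fo_struct" and n \<tau>
    where M: "is_model L' T' M" and N: "is_model L T N" and tr: "trace_definition L' M L N n \<tau>"
    unfolding trace_defines_def by blast
  have sN: "is_struct L N" using N by (simp add: is_model_def)
  {
    assume \<kappa>: "Card_order \<kappa> \<and> cinfinite \<kappa> \<and> theory_opd_less L T \<kappa>"
    show "theory_opd_less L' T' \<kappa>"
    proof
      assume "theory_opd_ge L' T' \<kappa>"
      from trace_definition_finpat_bound[OF tr sN theory_opd_ge_imp_finpat[OF T' M this]]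
      obtain B :: "'k set" where B: "finpat L N 1 B" "|Field \<kappa>| \<le>o |{..<n}| *c |B|" by blast
      have "infinite (Field \<kappa>)" using \<kappa> by (simp add: cinfinite_def)
      from inj_into_factor_infinite[OF this B(2)] have "finpat L N 1 (Field \<kappa>)"
        using finpat_reindex[OF B(1)] by blast
      then show False using finpat_imp_theory_opd_ge[OF T N] \<kappa> by blast
    qed
  }
  assume "theory_opd_finite L T"
  then obtain d where d: "theory_opd_less L T |{..<d :: nat}|" unfolding theory_opd_finite_def by blast
  \<comment> \<open>Of \<open>n\<close> parts covering \<open>n * d\<close> indices, a largest one
    has at least \<open>d\<close> elements, which would be a pattern excluded for
    \<open>T\<close>.\<close>
  have "theory_opd_less L' T' |{..<n * d}|"
  proof
    assume "theory_opd_ge L' T' |{..<n * d}|"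
    from theory_opd_ge_imp_finpat[OF T' M this] have "finpat L' M 1 {..<n * d}" by (simp add: Field_card_of)
    from trace_definition_finpat_bound[OF tr sN this]
    obtain B :: "nat set" where B: "finpat L N 1 B" "|{..<n * d}| \<le>o |{..<n}| *c |B|" by blast
    have "n \<ge> 1" using tr by (simp add: trace_definition_def)
    from inj_into_factor_finite[OF this B(2)] have "finpat L N 1 {..<d}"
      using finpat_reindex[OF B(1)] by blast
    then show False using finpat_imp_theory_opd_ge[OF T N, of "|{..<d}|"] d by (simp add: Field_card_of)
  qed
  then show "theory_opd_finite L' T'" unfolding theory_opd_finite_def by blast
qed

end
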